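(* Let $\mathbb{K}=\mathbb{R}$ or $\mathbb{C}$, let $E$ and $F$ be $\mathbb{K}$-Banach spaces, let $p,q\in\mathbb{N}$, let $n,m\ge 1$ be integers, and let $\Omega\subset\mathbb{R}^p$ (nonempty) and $\Omega'\subset\mathbb{R}^q$ be open. Let the pair of spaces $A^n(\Omega,E)$, $A^m(\Omega',F)$ be given by either Situation 1 or Situation 2 described in the context. Suppose that $T:A^n(\Omega,E)\to A^m(\Omega',F)$ is a $\mathbb{K}$-linear biseparating map. Then $p=q$, $n=m$, and there exist a diffeomorphism $h$ of class $C^n$ from $\Omega'$ onto $\Omega$ and a map $J:\Omega'\to L(E,F)$ of class $\mathrm{s}\text{-}C^n$ such that for every $y\in\Omega'$ and every $f\in A^n(\Omega,E)$, $$(Tf)(y)=(Jy)(f(h(y))).$$ Moreover, $Jy\in B(E,F)$ for every $y\in\Omega'$.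
   Context: Spaces of differentiable functions. $C^n(\Omega,E)$ is the space of functions $f:\Omega\to E$ whose partial derivatives $\partial^\lambda f$ (with respect to the real variables, $E$ being viewed as a real Banach space) exist and are continuous for every multi-index $\lambda\in(\mathbb{N}\cup\{0\})^p$ with $|\lambda|=\lambda_1+\dots+\lambda_p\le n$; $C^m(\Omega',F)$ is defined likewise. The spaces $A^n(\Omega,E)$ and $A^m(\Omega',F)$ are defined according to one of the following two situations. Situation 1: $\Omega$, $\Omega'$ are (not necessarily bounded) open sets, $A^n(\Omega,E)=C^n(\Omega,E)$ and $A^m(\Omega',F)=C^m(\Omega',F)$. Situation 2: $\Omega$, $\Omega'$ are bounded open sets, $A^n(\Omega,E)=C^n(\bar\Omega,E)$ and $A^m(\Omega',F)=C^m(\bar\Omega',F)$, where $C^n(\bar\Omega,E)$ (resp. $C^m(\bar\Omega',F)$) is the subspace of those functions in $C^n(\Omega,E)$ (resp. $C^m(\Omega',F)$) whose partial derivatives up to order $n$ (resp. $m$) admit continuous extension to the boundary of $\Omega$ (resp. $\Omega'$). Biseparating maps. For $f$ in one of these spaces, $c(f)$ denotes the set of points of the open domain ($\Omega$ or $\Omega'$) at which $f\neq 0$. A map $T:A^n(\Omega,E)\to A^m(\Omega',F)$ is separating if it is additive and $c(Tf)\cap c(Tg)=\emptyset$ whenever $c(f)\cap c(g)=\emptyset$; it is biseparating if it is bijective and both $T$ and $T^{-1}$ are separating. Operators. $L(E,F)$ is the space of continuous ($\mathbb{K}$-)linear maps $E\to F$, and $B(E,F)$ is the set of bijective continuous linear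 maps $E\to F$. Class $\mathrm{s}\text{-}C^n$. Let $U\subset\mathbb{R}^p$ be open and let $K:U\to L(E,F)$ be continuous for the norm topology of $L(E,F)$. For $\mathbf e\in E$ put $K_{\mathbf e}(y):=(Ky)(\mathbf e)$. $K$ is of class $\mathrm{s}\text{-}C^1$ if for every $\mathbf e\in E$ the map $K_{\mathbf e}:U\to F$ admits all first-order partial derivatives in $U$, and for each $i=1,\dots,p$ the map $\frac{\partial_{\mathrm s}}{\partial x_i}K:U\to L(E,F)$, sending $y$ to the operator $\mathbf e\mapsto\frac{\partial}{\partial x_i}K_{\mathbf e}(y)$, is (well defined with values in $L(E,F)$ and) continuous when $L(E,F)$ carries the strong operator topology (the coarsest topology making $A\mapsto A\mathbf e$ continuous for every $\mathbf e\in E$). For $n\ge 2$, a map $J:U\to L(E,F)$ is of class $\mathrm{s}\text{-}C^n$ if it is of class $C^{n-1}$ (with $L(E,F)$ viewed as a Banach space) and all its partial derivatives of order $n-1$ are of class $\mathrm{s}\text{-}C^1$.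
   Formalization: Two hypotheses are added, since the claim fails without them: E is nonzero, and in Situation 2 both Ω and Ω' equal the interior of their closures (restriction from (0,2) to (0,2)∖{1} is a linear biseparating map between the C^1 spaces on the closures). *)

theory Defs
  imports "HOL-Analysis.Analysis"
begin

text \<open>
  The scalar field is \<open>\<real>\<close> or \<open>\<complex>\<close>: a real normed field in which either every element is real, or
  there is an imaginary unit such that every element is of the form \<open>a + b i\<close>.  Since the norm of a
  \<open>real_normed_field\<close> is multiplicative, it is necessarily the usual absolute value.
\<close>

class real_or_complex = real_normed_field +
  assumes real_or_complex:
    "(\<forall>z. \<exists>a. z = a *\<^sub>R 1) \<or> (\<exists>i. i * i = - 1 \<and> (\<forall>z. \<exists>a b. z = a *\<^sub>R 1 + b *\<^sub>R i))"

instance real :: real_or_complex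
  by standard simp

instance complex :: real_or_complex
proof
  have "z = Re z *\<^sub>R 1 + Im z *\<^sub>R \<i>" for z
    by (simp add: complex_eq_iff)
  then show "(\<forall>z::complex. \<exists>a. z = a *\<^sub>R 1) \<or>
      (\<exists>i::complex. i * i = - 1 \<and> (\<forall>z. \<exists>a b. z = a *\<^sub>R 1 + b *\<^sub>R i))"
    using i_squared by blast
qed

text \<open>
  A Banach space over the scalar field: a real Banach space (class \<open>banach\<close>) with a scalar
  multiplication by \<open>'k\<close> that extends the real one and for which the norm is homogeneous.
\<close>

locale banach_over = vector_space scale
  for scale :: "'k::real_or_complex \<Rightarrow> 'e::banach \<Rightarrow> 'e" +
  assumes scale_of_real: "scale (of_real r) x = r *\<^sub>R x"
    and norm_scale: "norm (scale c x) = norm c * norm x"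

lemma banach_over_scaleR: "banach_over (scaleR :: real \<Rightarrow> 'e::banach \<Rightarrow> 'e)"
  by unfold_locales (simp_all add: algebra_simps)

lemma banach_over_mult: "banach_over ((*) :: complex \<Rightarrow> complex \<Rightarrow> complex)"
  by unfold_locales (simp_all add: algebra_simps norm_mult scaleR_conv_of_real)


section \<open>Spaces of differentiable functions\<close>

definition has_partial :: "'p::finite \<Rightarrow> (real^'p \<Rightarrow> 'e::real_normed_vector) \<Rightarrow> real^'p \<Rightarrow> bool"
  where "has_partial i f x \<longleftrightarrow> (\<lambda>t::real. f (x + t *\<^sub>R axis i 1)) differentiable (at 0)"

definition partial_deriv ::
    "'p::finite \<Rightarrow> (real^'p \<Rightarrow> 'e::real_normed_vector) \<Rightarrow> real^'p \<Rightarrow> 'e"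
  where "partial_deriv i f x = vector_derivative (\<lambda>t::real. f (x + t *\<^sub>R axis i 1)) (at 0)"

text \<open>
  Iterated partial derivatives are indexed by lists of coordinate directions.  A list \<open>ks\<close> represents
  the multi-index whose \<open>i\<close>-th entry is the number of occurrences of \<open>i\<close> in \<open>ks\<close> (so
  \<open>length ks\<close> is its order), together with an order of differentiation, which is immaterial
  for functions of class \<open>C\<^sup>n\<close>.
\<close>

fun iter_partial ::
    "'p::finite list \<Rightarrow> (real^'p \<Rightarrow> 'e::real_normed_vector) \<Rightarrow> real^'p \<Rightarrow> 'e"
  where
    "iter_partial [] f = f"
  | "iter_partial (i # ks) f = partial_deriv i (iter_partial ks f)"

text \<open>\<open>U\<close> is meant to be open, so that only the values of \<open>f\<close> on \<open>U\<close> matter.\<close>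

definition class_C :: "nat \<Rightarrow> (real^'p) set \<Rightarrow> (real^'p \<Rightarrow> 'e::real_normed_vector) \<Rightarrow> bool"
  where "class_C n U f \<longleftrightarrow>
    (\<forall>ks. length ks < n \<longrightarrow> (\<forall>i. \<forall>x\<in>U. has_partial i (iter_partial ks f) x)) \<and>
    (\<forall>ks. length ks \<le> n \<longrightarrow> continuous_on U (iter_partial ks f))"

text \<open>
  A function with domain \<open>U\<close> is represented by the total function that agrees with it on \<open>U\<close> and
  vanishes outside \<open>U\<close>.  This makes equality of functions on \<open>U\<close> coincide with equality in HOL; no
  regularity at the boundary is implied.
\<close>

definition C_open :: "nat \<Rightarrow> (real^'p) set \<Rightarrow> (real^'p \<Rightarrow> 'e::real_normed_vector) set"
  where "C_open n U = {f. class_C n U f \<and> (\<forall>x. x \<notin> U \<longrightarrow> f x = 0)}"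

definition C_closure :: "nat \<Rightarrow> (real^'p) set \<Rightarrow> (real^'p \<Rightarrow> 'e::real_normed_vector) set"
  where "C_closure n U = {f \<in> C_open n U. \<forall>ks. length ks \<le> n \<longrightarrow>
    (\<exists>g. continuous_on (closure U) g \<and> (\<forall>x\<in>U. g x = iter_partial ks f x))}"

text \<open>
  Pitfall: \<open>C_closure n U\<close> need not determine \<open>U\<close> unless \<open>interior (closure U) = U\<close>.  For \<open>n \<ge> 1\<close>,
  restriction is a bijection from the functions on \<open>]0,2[\<close> onto those on \<open>]0,2[ - {1}\<close>, since the
  continuous extensions of the derivatives glue at \<open>1\<close>; it preserves disjointness of cozero sets in
  both directions, although the two open sets are not even homeomorphic.
\<close>

definition diffeomorphism_C ::
    "nat \<Rightarrow> (real^'q) set \<Rightarrow> (real^'p) set \<Rightarrow> (real^'q \<Rightarrow> real^'p) \<Rightarrow> bool"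
  where "diffeomorphism_C n V U h \<longleftrightarrow>
    bij_betw h V U \<and> class_C n V h \<and> class_C n U (the_inv_into V h)"


section \<open>Biseparating maps\<close>

definition coz :: "'x set \<Rightarrow> ('x \<Rightarrow> 'e::zero) \<Rightarrow> 'x set"
  where "coz U f = {x \<in> U. f x \<noteq> 0}"

text \<open>\<open>A\<close> and \<open>B\<close> are spaces of functions on \<open>U\<close> and \<open>V\<close>, respectively.\<close>

definition separating ::
    "'x set \<Rightarrow> 'y set \<Rightarrow> ('x \<Rightarrow> 'e::ab_group_add) set \<Rightarrow> ('y \<Rightarrow> 'f::ab_group_add) set
      \<Rightarrow> (('x \<Rightarrow> 'e) \<Rightarrow> 'y \<Rightarrow> 'f) \<Rightarrow> bool"
  where "separating U V A B T \<longleftrightarrow>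
    T \<in> A \<rightarrow> B \<and>
    (\<forall>f\<in>A. \<forall>g\<in>A. T (\<lambda>x. f x + g x) = (\<lambda>y. T f y + T g y)) \<and>
    (\<forall>f\<in>A. \<forall>g\<in>A. coz U f \<inter> coz U g = {} \<longrightarrow> coz V (T f) \<inter> coz V (T g) = {})"

definition biseparating ::
    "'x set \<Rightarrow> 'y set \<Rightarrow> ('x \<Rightarrow> 'e::ab_group_add) set \<Rightarrow> ('y \<Rightarrow> 'f::ab_group_add) set
      \<Rightarrow> (('x \<Rightarrow> 'e) \<Rightarrow> 'y \<Rightarrow> 'f) \<Rightarrow> bool"
  where "biseparating U V A B T \<longleftrightarrow>
    bij_betw T A B \<and> separating U V A B T \<and> separating V U B A (the_inv_into A T)"

definition linear_over ::
    "('k \<Rightarrow> 'e::ab_group_add \<Rightarrow> 'e) \<Rightarrow> ('k \<Rightarrow> 'f::ab_group_add \<Rightarrow> 'f)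
      \<Rightarrow> ('x \<Rightarrow> 'e) set \<Rightarrow> (('x \<Rightarrow> 'e) \<Rightarrow> 'y \<Rightarrow> 'f) \<Rightarrow> bool"
  where "linear_over scaleE scaleF A T \<longleftrightarrow>
    (\<forall>f\<in>A. \<forall>g\<in>A. T (\<lambda>x. f x + g x) = (\<lambda>y. T f y + T g y)) \<and>
    (\<forall>c. \<forall>f\<in>A. T (\<lambda>x. scaleE c (f x)) = (\<lambda>y. scaleF c (T f y)))"


section \<open>Operator-valued functions\<close>

text \<open>
  \<open>L(E,F)\<close> is a subspace of the type \<open>'e \<Rightarrow>\<^sub>L 'f\<close> of continuous real-linear maps, from which it
  inherits the operator norm and the strong operator topology.
\<close>

definition ops ::
    "('k \<Rightarrow> 'e::real_normed_vector \<Rightarrow> 'e) \<Rightarrow> ('k \<Rightarrow> 'f::real_normed_vector \<Rightarrow> 'f)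
      \<Rightarrow> ('e \<Rightarrow>\<^sub>L 'f) set"
  where "ops scaleE scaleF =
    {A. \<forall>c e. blinfun_apply A (scaleE c e) = scaleF c (blinfun_apply A e)}"

definition bij_ops ::
    "('k \<Rightarrow> 'e::real_normed_vector \<Rightarrow> 'e) \<Rightarrow> ('k \<Rightarrow> 'f::real_normed_vector \<Rightarrow> 'f)
      \<Rightarrow> ('e \<Rightarrow>\<^sub>L 'f) set"
  where "bij_ops scaleE scaleF = {A \<in> ops scaleE scaleF. bij (blinfun_apply A)}"

text \<open>The map \<open>D\<close> below is \<open>\<partial>\<^sub>s K / \<partial> x\<^sub>i\<close>; it is determined on \<open>U\<close> by \<open>K\<close>.\<close>

definition class_sC1 ::
    "('k \<Rightarrow> 'e::real_normed_vector \<Rightarrow> 'e) \<Rightarrow> ('k \<Rightarrow> 'f::real_normed_vector \<Rightarrow> 'f)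
      \<Rightarrow> (real^'p) set \<Rightarrow> (real^'p \<Rightarrow> 'e \<Rightarrow>\<^sub>L 'f) \<Rightarrow> bool"
  where "class_sC1 scaleE scaleF U K \<longleftrightarrow>
    K \<in> U \<rightarrow> ops scaleE scaleF \<and>
    continuous_on U K \<and>
    (\<forall>e i. \<forall>y\<in>U. has_partial i (\<lambda>z. blinfun_apply (K z) e) y) \<and>
    (\<forall>i. \<exists>D :: real^'p \<Rightarrow> 'e \<Rightarrow>\<^sub>L 'f.
        D \<in> U \<rightarrow> ops scaleE scaleF \<and>
        (\<forall>y\<in>U. \<forall>e. blinfun_apply (D y) e = partial_deriv i (\<lambda>z. blinfun_apply (K z) e) y) \<and>
        continuous_map (top_of_set U) strong_operator_topology D)"

text \<open>
  Only \<open>n \<ge> 1\<close> is meaningful.  For \<open>n = 1\<close> the first conjunct is continuity, which is part of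
  \<open>class_sC1\<close>, and the only list in the second one is \<open>[]\<close>, so \<open>class_sC _ _ 1\<close> is \<open>class_sC1\<close>.
\<close>

definition class_sC ::
    "('k \<Rightarrow> 'e::real_normed_vector \<Rightarrow> 'e) \<Rightarrow> ('k \<Rightarrow> 'f::real_normed_vector \<Rightarrow> 'f)
      \<Rightarrow> nat \<Rightarrow> (real^'p) set \<Rightarrow> (real^'p \<Rightarrow> 'e \<Rightarrow>\<^sub>L 'f) \<Rightarrow> bool"
  where "class_sC scaleE scaleF n U J \<longleftrightarrow>
    class_C (n - 1) U J \<and>
    (\<forall>ks. length ks = n - 1 \<longrightarrow> class_sC1 scaleE scaleF U (iter_partial ks J))"

lemma class_sC_1: "class_sC scaleE scaleF 1 U J \<longleftrightarrow> class_sC1 scaleE scaleF U J"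
  by (auto simp: class_sC_def class_C_def class_sC1_def)

end

theory Submission
  imports Defs
begin

text \<open>
  The theorem says that a linear bijection \<open>T\<close> between spaces of differentiable functions which,
  together with its inverse \<open>S\<close>, preserves disjointness of cozero sets is a weighted composition.

  \<^bold>\<open>Support points.\<close>  Call \<open>x\<close> and \<open>y\<close> related if \<open>T f y = 0\<close> for every \<open>f\<close> vanishing near \<open>x\<close>.  Cutoffs
  and the separation property show that this relation is the graph of an injection \<open>h\<close>, that it is
  the same relation for \<open>S\<close> (\<open>related_swap\<close>), and that \<open>h\<close> is a homeomorphism between dense open
  subsets of the two domains.

  \<^bold>\<open>Gliding humps.\<close>  By locality of \<open>T\<close>, infinitely many disjoint bumps \<open>g k\<close> with small derivatives
  up to order \<open>n\<close> can be added up, and the image of the sum is \<open>T (g k)\<close> near the \<open>k\<close>-th point.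
  So \<open>T (g k)\<close> cannot have large derivatives of order at most \<open>m\<close> along a sequence that converges in
  the domain of \<open>h\<close> (\<open>gliding_hump\<close>).  First consequence: \<open>e \<mapsto> T e y\<close>, with \<open>e\<close> taken as a constant
  function, is continuous for all \<open>y\<close> outside a set without limit points, and then everywhere, as
  a pointwise limit of continuous operators (\<open>bounded_linear_J0\<close>).

  Second consequence (\<open>order_estimate\<close>): a bump of width \<open>\<epsilon>\<close> cut out of a function has derivatives up
  to order \<open>n\<close> of size \<open>\<epsilon>\<^sup>-\<^sup>n\<close>, and only of size \<open>\<epsilon>\<^sup>1\<^sup>-\<^sup>n\<close> if the function vanishes at the centre.  Its
  image drops from a fixed value to zero between two points whose images under \<open>h\<close> are \<open>\<epsilon>\<close> apart;
  if the points themselves are \<open>\<delta>\<close> apart, the image has an \<open>m\<close>-th derivative of size \<open>\<delta>\<^sup>-\<^sup>m\<close>.  Unless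
  \<open>\<epsilon>\<close> is as small as \<open>\<delta>\<close> to a power greater than \<open>1\<close>, which would make \<open>h\<close> constant on segments, this is too
  large if \<open>m > n\<close>, and if \<open>m \<ge> n\<close> it is too large when the function vanishes at the centre.  Hence
  \<open>n = m\<close> by symmetry, and \<open>T f y = 0\<close> whenever \<open>f (h y) = 0\<close>; that is, \<open>T f y\<close> is the value of the
  continuous operator above at \<open>f (h y)\<close> (\<open>T_representation\<close>).

  \<^bold>\<open>Regularity.\<close>  Applying the representation to \<open>x \<mapsto> (x $ i) *\<^sub>R S e x\<close> yields \<open>(h y $ i) *\<^sub>R e\<close>, so the
  components of \<open>h\<close> are as smooth as functions in the range of \<open>T\<close>, and \<open>h\<close> extends continuously to
  the whole domain.  A point at which the extension left the other domain is excluded by a function with a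
  singularity there (\<open>D_eq_V_open\<close>), or for bounded domains by invariance of domain
  (\<open>D_eq_V_closure\<close>).  Finally, an operator-valued map all of whose evaluations are of class \<open>C^n\<close>
  is strongly of class \<open>C^n\<close>, by uniform boundedness (\<open>class_sC_pointwise\<close>).
\<close>

section \<open>Partial derivatives and functions of class C^n\<close>

text \<open>Existence and value of a partial derivative in one statement about a curve, to which the calculus of
  vector derivatives applies.\<close>

definition has_pd :: "'p::finite \<Rightarrow> (real^'p \<Rightarrow> 'e::real_normed_vector) \<Rightarrow> 'e \<Rightarrow> real^'p \<Rightarrow> bool"
  where "has_pd i f d x \<longleftrightarrow> ((\<lambda>t. f (x + t *\<^sub>R axis i 1)) has_vector_derivative d) (at 0)"

lemma has_pd_iff: "has_pd i f d x \<longleftrightarrow> has_partial i f x \<and> partial_deriv i f x = d"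
  unfolding has_pd_def has_partial_def partial_deriv_def
  by (metis vector_derivative_works vector_derivative_at differentiableI_vector)

lemma has_pd_partial: "has_partial i f x \<Longrightarrow> has_pd i f (partial_deriv i f x) x"
  by (simp add: has_pd_iff)

lemma has_pd_line:
  assumes "has_pd i f d (x + s *\<^sub>R axis i 1)"
  shows "((\<lambda>t. f (x + t *\<^sub>R axis i 1)) has_vector_derivative d) (at s)"
proof -
  have 1: "((\<lambda>t. t - s) has_vector_derivative 1) (at s)"
    by (auto intro!: derivative_eq_intros)
  have 2: "((\<lambda>t. f (x + s *\<^sub>R axis i 1 + t *\<^sub>R axis i 1)) has_vector_derivative d) (at (s - s))"
    using assms by (simp add: has_pd_def)
  have "((\<lambda>t. f (x + s *\<^sub>R axis i 1 + (t - s) *\<^sub>R axis i 1)) has_vector_derivative d) (at s)"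
    using vector_diff_chain_at[OF 1 2] by (simp add: o_def)
  moreover have "x + s *\<^sub>R axis i 1 + (t - s) *\<^sub>R axis i 1 = x + t *\<^sub>R axis i 1" for t
    by (simp add: algebra_simps)
  ultimately show ?thesis by simp
qed

lemma open_axis_line:
  fixes x :: "real^'p"
  assumes "open U" shows "open {t::real. x + t *\<^sub>R axis i 1 \<in> U}"
proof -
  have "open ((\<lambda>t::real. x + t *\<^sub>R axis i 1) -` U)"
    by (intro open_vimage assms continuous_intros)
  then show ?thesis by (simp add: vimage_def)
qed

lemma has_pd_cong:
  assumes U: "open U" "x \<in> U" and eq: "\<And>y. y \<in> U \<Longrightarrow> f y = g y" and f: "has_pd i f d x"
  shows "has_pd i g d x"
  using f unfolding has_pd_def
  by (rule has_vector_derivative_transform_within_open[OF _ open_axis_line[OF U(1), of x i]])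
     (use U eq in auto)

lemma partial_deriv_cong:
  assumes "open U" "x \<in> U" "\<And>y. y \<in> U \<Longrightarrow> f y = g y"
  shows "partial_deriv i f x = partial_deriv i g x"
proof -
  have "has_pd i f d x = has_pd i g d x" for d
    using has_pd_cong[OF assms(1,2)] assms(3) by metis
  then show ?thesis
    by (simp add: has_pd_def partial_deriv_def vector_derivative_def)
qed

lemma iter_partial_cong:
  assumes "open U" "\<And>y. y \<in> U \<Longrightarrow> f y = g y"
  shows "x \<in> U \<Longrightarrow> iter_partial ks f x = iter_partial ks g x"
  using assms(2)
  by (induction ks arbitrary: x) (auto intro: partial_deriv_cong[OF assms(1)])

lemma iter_partial_append: "iter_partial (ks @ ls) f = iter_partial ks (iter_partial ls f)"
  by (induction ks) auto

lemma class_C_0: "class_C 0 U f \<longleftrightarrow> continuous_on U f"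
  by (auto simp: class_C_def)

text \<open>Here the derivative taken first is split off, whereas the definition of \<open>iter_partial\<close> splits off the
  last one.  Inductions on \<open>n\<close> need this form: the functions \<open>partial_deriv i f\<close> are explicit.\<close>

lemma class_C_Suc:
  "class_C (Suc n) U f \<longleftrightarrow> continuous_on U f \<and>
    (\<forall>i. (\<forall>x\<in>U. has_partial i f x) \<and> class_C n U (partial_deriv i f))"
proof
  assume f: "class_C (Suc n) U f"
  have "continuous_on U (iter_partial [] f)" "\<forall>i. \<forall>x\<in>U. has_partial i (iter_partial [] f) x"
    using f unfolding class_C_def by (metis list.size(3) zero_le zero_less_Suc)+
  moreover have "class_C n U (partial_deriv i f)" for i
    unfolding class_C_def
  proof (intro conjI allI impI)
    fix ks :: "'a list" assume "length ks < n"
    then have "length (ks @ [i]) < Suc n" by simp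
    then show "\<forall>x\<in>U. has_partial j (iter_partial ks (partial_deriv i f)) x" for j
      using f unfolding class_C_def by (metis iter_partial_append iter_partial.simps)
  next
    fix ks :: "'a list" assume "length ks \<le> n"
    then have "length (ks @ [i]) \<le> Suc n" by simp
    then show "continuous_on U (iter_partial ks (partial_deriv i f))"
      using f unfolding class_C_def by (metis iter_partial_append iter_partial.simps)
  qed
  ultimately show "continuous_on U f \<and>
    (\<forall>i. (\<forall>x\<in>U. has_partial i f x) \<and> class_C n U (partial_deriv i f))" by simp
next
  assume f: "continuous_on U f \<and>
    (\<forall>i. (\<forall>x\<in>U. has_partial i f x) \<and> class_C n U (partial_deriv i f))"
  show "class_C (Suc n) U f"
    unfolding class_C_def
  proof (intro conjI allI impI)
    fix ks :: "'a list" and i assume l: "length ks < Suc n"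
    show "\<forall>x\<in>U. has_partial i (iter_partial ks f) x"
    proof (cases ks rule: rev_cases)
      case (snoc ls j)
      then show ?thesis using f l by (auto simp: iter_partial_append class_C_def)
    qed (use f in auto)
  next
    fix ks :: "'a list" assume l: "length ks \<le> Suc n"
    show "continuous_on U (iter_partial ks f)"
    proof (cases ks rule: rev_cases)
      case (snoc ls j)
      then show ?thesis using f l by (auto simp: iter_partial_append class_C_def)
    qed (use f in auto)
  qed
qed

lemma class_C_has_pd:
  assumes "class_C n U f" "length ks < n" "x \<in> U"
  shows "has_pd i (iter_partial ks f) (iter_partial (i # ks) f x) x"
  using assms by (simp add: has_pd_iff class_C_def)

lemma class_C_continuous: "class_C n U f \<Longrightarrow> length ks \<le> n \<Longrightarrow> continuous_on U (iter_partial ks f)"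
  by (simp add: class_C_def)

lemma class_C_continuous_0: "class_C n U f \<Longrightarrow> continuous_on U f"
  using class_C_continuous[of n U f "[]"] by simp

lemma class_C_mono: "class_C n U f \<Longrightarrow> m \<le> n \<Longrightarrow> class_C m U f"
  by (simp add: class_C_def)

lemma class_C_subset: "class_C n U f \<Longrightarrow> V \<subseteq> U \<Longrightarrow> class_C n V f"
  by (auto simp: class_C_def intro: continuous_on_subset)

text \<open>Iterated partial derivatives may be exhibited instead of computed: a family \<open>D\<close> in which each member
  is differentiated to the next is the family of iterated derivatives of \<open>D []\<close>, since derivatives are
  unique.\<close>

lemma class_C_I:
  fixes f :: "real^'p \<Rightarrow> 'e::real_normed_vector"
  assumes U: "open U"
    and D0: "\<And>x. x \<in> U \<Longrightarrow> f x = D [] x"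
    and pd: "\<And>ks i x. length ks < n \<Longrightarrow> x \<in> U \<Longrightarrow> has_pd i (D ks) (D (i # ks) x) x"
    and cont: "\<And>ks. length ks \<le> n \<Longrightarrow> continuous_on U (D ks)"
  shows "class_C n U f" "\<And>ks x. length ks \<le> n \<Longrightarrow> x \<in> U \<Longrightarrow> iter_partial ks f x = D ks x"
proof -
  show eq: "iter_partial ks f x = D ks x" if "length ks \<le> n" "x \<in> U" for ks x
    using that
  proof (induction ks arbitrary: x)
    case (Cons i ks)
    have "partial_deriv i (iter_partial ks f) x = partial_deriv i (D ks) x"
      by (rule partial_deriv_cong[OF U Cons.prems(2)]) (use Cons in auto)
    also have "\<dots> = D (i # ks) x"
      using pd[of ks x i] Cons.prems by (simp add: has_pd_iff)
    finally show ?case by simp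
  qed (use D0 in auto)
  show "class_C n U f"
    unfolding class_C_def
  proof (intro conjI allI impI ballI)
    fix ks :: "'p list" and i x assume *: "length ks < n" "x \<in> U"
    have "has_pd i (iter_partial ks f) (D (i # ks) x) x"
      by (rule has_pd_cong[OF U *(2) _ pd[OF *]]) (use eq * in auto)
    then show "has_partial i (iter_partial ks f) x" by (simp add: has_pd_iff)
  next
    fix ks :: "'p list" assume "length ks \<le> n"
    then show "continuous_on U (iter_partial ks f)"
      using cont[of ks] eq by (simp cong: continuous_on_cong)
  qed
qed

lemma class_C_cong:
  assumes "open U" "\<And>x. x \<in> U \<Longrightarrow> f x = g x" "class_C n U f"
  shows "class_C n U g"
  by (rule class_C_I(1)[OF assms(1), where D = "\<lambda>ks. iter_partial ks f"])
     (use assms in \<open>auto simp: class_C_def has_pd_iff\<close>)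

lemma class_C_linear:
  assumes U: "open U" and f: "class_C n U f" and L: "bounded_linear L"
  shows "class_C n U (\<lambda>x. L (f x))"
    and "\<And>ks x. length ks \<le> n \<Longrightarrow> x \<in> U \<Longrightarrow> iter_partial ks (\<lambda>x. L (f x)) x = L (iter_partial ks f x)"
proof -
  let ?D = "\<lambda>ks x. L (iter_partial ks f x)"
  have 1: "has_pd i (?D ks) (?D (i # ks) x) x" if "length ks < n" "x \<in> U" for ks i x
    using bounded_linear.has_vector_derivative[OF L class_C_has_pd[OF f that, of i, unfolded has_pd_def]]
    by (simp add: has_pd_def)
  have 2: "continuous_on U (?D ks)" if "length ks \<le> n" for ks
    using bounded_linear.continuous_on[OF L class_C_continuous[OF f that]] .
  show "class_C n U (\<lambda>x. L (f x))"
    by (rule class_C_I(1)[OF U _ 1 2]) auto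
  show "iter_partial ks (\<lambda>x. L (f x)) x = L (iter_partial ks f x)" if "length ks \<le> n" "x \<in> U" for ks x
    by (rule class_C_I(2)[OF U _ 1 2]) (use that in auto)
qed

lemma class_C_add:
  assumes U: "open U" and f: "class_C n U f" and g: "class_C n U g"
  shows "class_C n U (\<lambda>x. f x + g x)"
    and "\<And>ks x. length ks \<le> n \<Longrightarrow> x \<in> U \<Longrightarrow>
      iter_partial ks (\<lambda>x. f x + g x) x = iter_partial ks f x + iter_partial ks g x"
proof -
  let ?D = "\<lambda>ks x. iter_partial ks f x + iter_partial ks g x"
  have 1: "has_pd i (?D ks) (?D (i # ks) x) x" if "length ks < n" "x \<in> U" for ks i x
    using has_vector_derivative_add[OF class_C_has_pd[OF f that, of i, unfolded has_pd_def]
        class_C_has_pd[OF g that, of i, unfolded has_pd_def]]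
    by (simp add: has_pd_def)
  have 2: "continuous_on U (?D ks)" if "length ks \<le> n" for ks
    by (intro continuous_intros class_C_continuous[OF f that] class_C_continuous[OF g that])
  show "class_C n U (\<lambda>x. f x + g x)"
    by (rule class_C_I(1)[OF U _ 1 2]) auto
  show "iter_partial ks (\<lambda>x. f x + g x) x = ?D ks x" if "length ks \<le> n" "x \<in> U" for ks x
    by (rule class_C_I(2)[OF U _ 1 2]) (use that in auto)
qed

lemma class_C_const:
  assumes "open U"
  shows "class_C n U (\<lambda>x. c)"
    and "\<And>ks x. length ks \<le> n \<Longrightarrow> x \<in> U \<Longrightarrow>
      iter_partial ks (\<lambda>x. c) x = (if ks = [] then c else 0)"
proof -
  let ?D = "\<lambda>ks x. if ks = [] then c else 0"
  have 1: "has_pd i (?D ks) (?D (i # ks) x) x" for ks :: "'a list" and i and x :: "real^'a"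
    by (simp add: has_pd_def)
  show "class_C n U (\<lambda>x. c)"
    by (rule class_C_I(1)[OF assms _ 1]) auto
  show "iter_partial ks (\<lambda>x. c) x = ?D ks x" if "length ks \<le> n" "x \<in> U" for ks :: "'a list" and x
    by (rule class_C_I(2)[OF assms _ 1]) (use that in auto)
qed

lemma class_C_sum:
  assumes "open U" "\<And>j. j \<in> I \<Longrightarrow> class_C n U (f j)"
  shows "class_C n U (\<lambda>x. \<Sum>j\<in>I. f j x)"
  using assms(2)
  by (induction I rule: infinite_finite_induct) (auto intro: class_C_const class_C_add assms(1))

lemma class_C_coordinate: "class_C n U (\<lambda>x::real^'p. x $ i)"
proof -
  have pd: "has_pd j (\<lambda>x::real^'p. x $ i) (if j = i then 1 else 0) x" for j x
    unfolding has_pd_def axis_def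
    by (auto intro!: derivative_eq_intros simp: has_vector_derivative_def vec_eq_iff)
  have "class_C n UNIV (\<lambda>x::real^'p. x $ i)"
  proof (cases n)
    case (Suc m)
    have "partial_deriv j (\<lambda>x::real^'p. x $ i) = (\<lambda>x. if j = i then 1 else 0)" for j
      using pd by (auto simp: has_pd_iff)
    then show ?thesis using pd
      by (auto simp: Suc class_C_Suc has_pd_iff class_C_const intro!: continuous_intros)
  qed (auto simp: class_C_0 intro!: continuous_intros)
  then show ?thesis by (rule class_C_subset) auto
qed

text \<open>The Leibniz rule, with the terms listed explicitly: each of the derivations falls on one of
  the two factors.  Only the number and the orders of the terms will matter.\<close>

fun splittings :: "'a list \<Rightarrow> ('a list \<times> 'a list) list" where
  "splittings [] = [([], [])]"
| "splittings (i # ks) =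
    map (\<lambda>(as, bs). (i # as, bs)) (splittings ks) @ map (\<lambda>(as, bs). (as, i # bs)) (splittings ks)"

lemma length_splittings: "length (splittings ks) = 2 ^ length ks"
  by (induction ks) auto

lemma splittings_length: "(as, bs) \<in> set (splittings ks) \<Longrightarrow> length as + length bs = length ks"
  by (induction ks arbitrary: as bs) auto

lemma has_vector_derivative_sum_list:
  assumes "\<And>z. z \<in> set zs \<Longrightarrow> (f z has_vector_derivative f' z) F"
  shows "((\<lambda>t. \<Sum>z\<leftarrow>zs. f z t) has_vector_derivative (\<Sum>z\<leftarrow>zs. f' z)) F"
  using assms by (induction zs) (auto intro!: derivative_eq_intros)

lemma continuous_on_sum_list:
  fixes f :: "'z \<Rightarrow> 'a::topological_space \<Rightarrow> 'b::real_normed_vector"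
  assumes "\<And>z. z \<in> set zs \<Longrightarrow> continuous_on S (f z)"
  shows "continuous_on S (\<lambda>x. \<Sum>z\<leftarrow>zs. f z x)"
  using assms by (induction zs) (auto intro!: continuous_intros)

lemma Leibniz:
  fixes u :: "real^'p \<Rightarrow> real" and f :: "real^'p \<Rightarrow> 'e::real_normed_vector"
  assumes U: "open U" and u: "class_C n U u" and f: "class_C n U f"
  shows class_C_scaleR: "class_C n U (\<lambda>x. u x *\<^sub>R f x)"
    and iter_partial_scaleR: "\<And>ks x. length ks \<le> n \<Longrightarrow> x \<in> U \<Longrightarrow>
      iter_partial ks (\<lambda>x. u x *\<^sub>R f x) x =
      (\<Sum>(as, bs)\<leftarrow>splittings ks. iter_partial as u x *\<^sub>R iter_partial bs f x)"
proof -
  define D where "D = (\<lambda>ks x. \<Sum>(as, bs)\<leftarrow>splittings ks. iter_partial as u x *\<^sub>R iter_partial bs f x)"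
  have 1: "has_pd i (D ks) (D (i # ks) x) x" if ks: "length ks < n" and x: "x \<in> U" for ks i x
  proof -
    have *: "((\<lambda>t. iter_partial as u (x + t *\<^sub>R axis i 1) *\<^sub>R iter_partial bs f (x + t *\<^sub>R axis i 1))
        has_vector_derivative (iter_partial as u x *\<^sub>R iter_partial (i # bs) f x
          + iter_partial (i # as) u x *\<^sub>R iter_partial bs f x)) (at 0)"
      if "(as, bs) \<in> set (splittings ks)" for as bs
    proof -
      have "length as < n" "length bs < n" using splittings_length[OF that] ks by auto
      then have "has_pd i (iter_partial as u) (iter_partial (i # as) u x) x"
        "has_pd i (iter_partial bs f) (iter_partial (i # bs) f x) x"
        using class_C_has_pd[OF u _ x] class_C_has_pd[OF f _ x] by blast+
      then show ?thesis
        unfolding has_pd_def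
        using has_vector_derivative_scaleR[of "\<lambda>t. iter_partial as u (x + t *\<^sub>R axis i 1)"
            "iter_partial (i # as) u x" 0 UNIV]
        by (force simp: has_real_derivative_iff_has_vector_derivative)
    qed
    have "has_pd i (D ks) (\<Sum>(as, bs)\<leftarrow>splittings ks. iter_partial as u x *\<^sub>R iter_partial (i # bs) f x
          + iter_partial (i # as) u x *\<^sub>R iter_partial bs f x) x"
      unfolding D_def has_pd_def
      by (rule has_vector_derivative_sum_list) (use * in auto)
    also have "(\<Sum>(as, bs)\<leftarrow>splittings ks. iter_partial as u x *\<^sub>R iter_partial (i # bs) f x
          + iter_partial (i # as) u x *\<^sub>R iter_partial bs f x) = D (i # ks) x"
      by (simp add: D_def case_prod_unfold o_def sum_list_addf)
    finally show ?thesis .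
  qed
  have 2: "continuous_on U (D ks)" if "length ks \<le> n" for ks
    unfolding D_def case_prod_unfold
  proof (rule continuous_on_sum_list)
    fix z assume "z \<in> set (splittings ks)"
    then have "length (fst z) \<le> n" "length (snd z) \<le> n"
      using splittings_length[of "fst z" "snd z" ks] that by auto
    then show "continuous_on U (\<lambda>x. iter_partial (fst z) u x *\<^sub>R iter_partial (snd z) f x)"
      by (intro continuous_intros class_C_continuous[OF u] class_C_continuous[OF f])
  qed
  have 3: "u x *\<^sub>R f x = D [] x" for x by (simp add: D_def)
  show "class_C n U (\<lambda>x. u x *\<^sub>R f x)"
    by (rule class_C_I(1)[OF U 3 1 2])
  show "iter_partial ks (\<lambda>x. u x *\<^sub>R f x) x =
      (\<Sum>(as, bs)\<leftarrow>splittings ks. iter_partial as u x *\<^sub>R iter_partial bs f x)"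
    if "length ks \<le> n" "x \<in> U" for ks x
    using class_C_I(2)[OF U 3 1 2 that] by (simp add: D_def)
qed

lemma norm_sum_list_le:
  fixes f :: "'z \<Rightarrow> 'e::real_normed_vector"
  assumes "\<And>z. z \<in> set zs \<Longrightarrow> norm (f z) \<le> c"
  shows "norm (\<Sum>z\<leftarrow>zs. f z) \<le> real (length zs) * c"
  using assms
proof (induction zs)
  case (Cons z zs)
  have "norm (f z) \<le> c" "norm (\<Sum>z\<leftarrow>zs. f z) \<le> real (length zs) * c"
    using Cons by auto
  then show ?case
    using norm_triangle_ineq[of "f z" "\<Sum>z\<leftarrow>zs. f z"] by (simp add: algebra_simps)
qed simp

text \<open>The weights \<open>s ^ length ks\<close> are those of a function varying at the length scale \<open>1/s\<close>; they
  are reproduced by products.\<close>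

lemma Leibniz_bound:
  fixes u :: "real^'p \<Rightarrow> real" and f :: "real^'p \<Rightarrow> 'e::real_normed_vector"
  assumes U: "open U" and u: "class_C n U u" and f: "class_C n U f" and x: "x \<in> U"
    and s: "0 \<le> s" and a: "0 \<le> a"
    and ubd: "\<And>ks. length ks \<le> n \<Longrightarrow> norm (iter_partial ks u x) \<le> a * s ^ length ks"
    and fbd: "\<And>ks. length ks \<le> n \<Longrightarrow> norm (iter_partial ks f x) \<le> b * s ^ length ks"
    and ks: "length ks \<le> n"
  shows "norm (iter_partial ks (\<lambda>x. u x *\<^sub>R f x) x) \<le> 2 ^ length ks * (a * b) * s ^ length ks"
proof -
  have "norm (iter_partial (fst z) u x *\<^sub>R iter_partial (snd z) f x) \<le> a * b * s ^ length ks"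
    if "z \<in> set (splittings ks)" for z
  proof -
    have l: "length (fst z) + length (snd z) = length ks"
      using splittings_length[of "fst z" "snd z" ks] that by simp
    have "norm (iter_partial (fst z) u x *\<^sub>R iter_partial (snd z) f x)
        \<le> (a * s ^ length (fst z)) * (b * s ^ length (snd z))"
      unfolding norm_scaleR real_norm_def[symmetric]
      by (rule mult_mono[OF ubd fbd]) (use l ks s a in auto)
    also have "\<dots> = a * b * s ^ length ks"
      by (simp add: l[symmetric] power_add)
    finally show ?thesis .
  qed
  then have "norm (\<Sum>z\<leftarrow>splittings ks. iter_partial (fst z) u x *\<^sub>R iter_partial (snd z) f x)
      \<le> length (splittings ks) * (a * b * s ^ length ks)"
    by (rule norm_sum_list_le)
  then show ?thesis
    using iter_partial_scaleR[OF U u f ks x] by (simp add: length_splittings case_prod_unfold mult.assoc)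
qed

lemma power_pos_part_has_derivative:
  "((\<lambda>t::real. max 0 t ^ Suc (Suc j)) has_real_derivative real (Suc (Suc j)) * max 0 t ^ Suc j) (at t)"
proof -
  consider "t < 0" | "t = 0" | "t > 0" by linarith
  then show ?thesis
  proof cases
    case 1
    have "((\<lambda>t::real. 0) has_real_derivative 0) (at t)" by simp
    then have "((\<lambda>t::real. max 0 t ^ Suc (Suc j)) has_real_derivative 0) (at t)"
      by (rule has_field_derivative_transform_within_open[of _ _ _ "{..<0}"]) (use 1 in auto)
    then show ?thesis using 1 by simp
  next
    case 3
    have "((\<lambda>t::real. t ^ Suc (Suc j)) has_real_derivative real (Suc (Suc j)) * t ^ Suc j) (at t)"
      using DERIV_pow[of "Suc (Suc j)" t] by simp
    then have "((\<lambda>t::real. max 0 t ^ Suc (Suc j)) has_real_derivative real (Suc (Suc j)) * t ^ Suc j) (at t)"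
      by (rule has_field_derivative_transform_within_open[of _ _ _ "{0<..}"]) (use 3 in auto)
    then show ?thesis using 3 by (simp add: max_def)
  next
    case 2
    have "((\<lambda>y::real. max 0 y ^ Suc (Suc j) / y) \<longlongrightarrow> 0) (at 0)"
    proof (rule Lim_null_comparison)
      show "\<forall>\<^sub>F y in at (0::real). norm (max 0 y ^ Suc (Suc j) / y) \<le> \<bar>y\<bar> ^ Suc j"
      proof (intro always_eventually allI)
        show "norm (max 0 y ^ Suc (Suc j) / y) \<le> \<bar>y\<bar> ^ Suc j" for y :: real
        proof (cases "y > 0")
          case False
          then have "max 0 y ^ Suc (Suc j) = 0" by simp
          then show ?thesis by (simp del: power_Suc)
        qed simp
      qed
      show "((\<lambda>y::real. \<bar>y\<bar> ^ Suc j) \<longlongrightarrow> 0) (at 0)"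
        by (auto intro!: tendsto_eq_intros)
    qed
    then show ?thesis using 2 by (simp add: has_field_derivative_iff)
  qed
qed

text \<open>The derivatives of the one-variable function \<open>d 0\<close> are given as the sequence \<open>d\<close>.\<close>

lemma class_C_compose_real:
  fixes u :: "real^'p \<Rightarrow> real"
  assumes U: "open U" and u: "class_C n U u" and S: "u ` U \<subseteq> S"
    and d: "\<And>l t. l < n \<Longrightarrow> t \<in> S \<Longrightarrow> (d l has_real_derivative d (Suc l) t) (at t)"
    and c: "\<And>l. l \<le> n \<Longrightarrow> continuous_on S (d l)"
  shows "class_C n U (\<lambda>x. d 0 (u x))"
  using u d c
proof (induction n arbitrary: d)
  case 0
  then show ?case
    using S by (auto simp: class_C_0 intro: continuous_on_compose2)
next
  case (Suc n)
  have u': "continuous_on U u" "\<And>i x. x \<in> U \<Longrightarrow> has_partial i u x"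
    "\<And>i. class_C n U (partial_deriv i u)"
    using Suc.prems(1) by (auto simp: class_C_Suc)
  have pd: "has_pd i (\<lambda>x. d 0 (u x)) (partial_deriv i u x * d (Suc 0) (u x)) x" if x: "x \<in> U" for i x
  proof -
    have 1: "((\<lambda>t. u (x + t *\<^sub>R axis i 1)) has_vector_derivative partial_deriv i u x) (at 0)"
      using has_pd_partial[OF u'(2)[OF x]] by (simp add: has_pd_def)
    have 2: "(d 0 has_vector_derivative d (Suc 0) (u x)) (at (u (x + 0 *\<^sub>R axis i 1)))"
      using Suc.prems(2)[of 0 "u x"] x S by (auto simp: has_real_derivative_iff_has_vector_derivative)
    show ?thesis
      using vector_diff_chain_at[OF 1 2] by (simp add: has_pd_def o_def)
  qed
  have "class_C n U (\<lambda>x. d (Suc 0) (u x))"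
    by (rule Suc.IH[of "\<lambda>l. d (Suc l)"]) (use Suc.prems class_C_mono[of "Suc n" U u n] in auto)
  then have *: "class_C n U (\<lambda>x. partial_deriv i u x *\<^sub>R d (Suc 0) (u x))" for i
    by (intro class_C_scaleR U u')
  have "class_C n U (partial_deriv i (\<lambda>x. d 0 (u x)))" for i
    by (rule class_C_cong[OF U _ *[of i]]) (use pd in \<open>simp add: has_pd_iff\<close>)
  moreover have "continuous_on U (\<lambda>x. d 0 (u x))"
    using continuous_on_compose2[OF Suc.prems(3)[of 0] u'(1) S] by simp
  ultimately show ?case
    using pd by (auto simp: class_C_Suc has_pd_iff)
qed

text \<open>The positive part of \<open>u\<close> has a corner where \<open>u = 0\<close>; the power \<open>n + 1\<close> flattens it to order \<open>n\<close>.  This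
  is the source of all cutoff functions below.\<close>

lemma class_C_pos_part_power:
  fixes u :: "real^'p \<Rightarrow> real"
  assumes "open U" "class_C n U u"
  shows "class_C n U (\<lambda>x. max 0 (u x) ^ Suc n)"
proof -
  define d :: "nat \<Rightarrow> real \<Rightarrow> real" where
    "d = (\<lambda>l t. (\<Prod>i<l. real (Suc n - i)) * max 0 t ^ (Suc n - l))"
  have "class_C n U (\<lambda>x. d 0 (u x))"
  proof (rule class_C_compose_real[OF assms, of UNIV])
    fix l :: nat and t :: real assume l: "l < n"
    then obtain j where j: "n = l + Suc j" by (metis add_Suc_right less_iff_Suc_add)
    have "(d l has_real_derivative (\<Prod>i<l. real (Suc n - i)) * (real (Suc (Suc j)) * max 0 t ^ Suc j)) (at t)"
      unfolding d_def using DERIV_cmult[OF power_pos_part_has_derivative[of j t]] by (simp add: j)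
    also have "(\<Prod>i<l. real (Suc n - i)) * (real (Suc (Suc j)) * max 0 t ^ Suc j) = d (Suc l) t"
      by (simp add: d_def j mult_ac)
    finally show "(d l has_real_derivative d (Suc l) t) (at t)" .
  qed (auto simp: d_def intro!: continuous_intros)
  then show ?thesis by (simp add: d_def)
qed

lemma class_C_inverse:
  fixes u :: "real^'p \<Rightarrow> real"
  assumes "open U" "class_C n U u" "\<And>x. x \<in> U \<Longrightarrow> u x > 0"
  shows "class_C n U (\<lambda>x. inverse (u x))"
proof -
  define d :: "nat \<Rightarrow> real \<Rightarrow> real" where "d = (\<lambda>l t. (- 1) ^ l * fact l * inverse t ^ Suc l)"
  have "class_C n U (\<lambda>x. d 0 (u x))"
  proof (rule class_C_compose_real[OF assms(1,2), of "{0<..}"])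
    fix l :: nat and t :: real assume "t \<in> {0<..}"
    then have "(d l has_real_derivative
        (- 1) ^ l * fact l * (real (Suc l) * (- (inverse t ^ Suc (Suc 0)) * inverse t ^ (Suc l - Suc 0)))) (at t)"
      unfolding d_def by (intro DERIV_cmult DERIV_power DERIV_inverse) auto
    also have "(- 1) ^ l * fact l * (real (Suc l) * (- (inverse t ^ Suc (Suc 0)) * inverse t ^ (Suc l - Suc 0)))
        = d (Suc l) t"
      by (simp add: d_def algebra_simps)
    finally show "(d l has_real_derivative d (Suc l) t) (at t)" .
  qed (use assms(3) in \<open>auto simp: d_def intro!: continuous_intros\<close>)
  then show ?thesis by (simp add: d_def)
qed

lemma class_C_norm_square: "class_C n U (\<lambda>x::real^'p. (norm (x - a))\<^sup>2)"
proof -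
  have "class_C n UNIV (\<lambda>x::real^'p. \<Sum>i\<in>UNIV. (x $ i + - (a $ i)) *\<^sub>R (x $ i + - (a $ i)))"
    by (intro class_C_sum class_C_scaleR class_C_add class_C_coordinate class_C_const open_UNIV)
  moreover have "(\<Sum>i\<in>UNIV. (x $ i + - (a $ i)) *\<^sub>R (x $ i + - (a $ i))) = (norm (x - a))\<^sup>2" for x
    by (simp add: norm_vec_def L2_set_def sum_nonneg power2_eq_square)
  ultimately have "class_C n UNIV (\<lambda>x::real^'p. (norm (x - a))\<^sup>2)" by simp
  then show ?thesis by (rule class_C_subset) auto
qed

lemma class_C_vec:
  fixes h :: "real^'q \<Rightarrow> real^'p"
  assumes U: "open U" and "\<And>i. class_C n U (\<lambda>y. h y $ i)"
  shows "class_C n U h"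
proof -
  have "class_C n U (\<lambda>y. \<Sum>i\<in>UNIV. (h y $ i) *\<^sub>R axis i (1::real))"
    by (intro class_C_sum class_C_scaleR class_C_const U assms)
  moreover have "(\<Sum>i\<in>UNIV. (h y $ i) *\<^sub>R axis i (1::real)) = h y" for y
    using basis_expansion[of "h y"] by (simp add: scalar_mult_eq_scaleR)
  ultimately show ?thesis by simp
qed

text \<open>The line spanned by a vector is closed, because \<open>r \<mapsto> r *\<^sub>R e\<close> is a multiple of an isometry; so
  differentiating a function with values on the line gives no information beyond the coefficient.\<close>

lemma closed_line: "closed (range (\<lambda>r::real. r *\<^sub>R (e::'e::real_normed_vector)))"
proof (cases "e = 0")
  case False
  show ?thesis
    unfolding closed_sequential_limits
  proof (intro allI impI)
    fix x l assume "(\<forall>n. x n \<in> range (\<lambda>r. r *\<^sub>R e)) \<and> x \<longlonglongrightarrow> l"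
    then obtain r where x: "x = (\<lambda>n. r n *\<^sub>R e)" and l: "x \<longlonglongrightarrow> l"
      unfolding image_iff by (metis (no_types, lifting) ext)
    have "Cauchy r"
    proof (rule metric_CauchyI)
      fix \<epsilon> :: real assume "\<epsilon> > 0"
      then have "\<epsilon> * norm e > 0" using False by simp
      then obtain M where M: "\<And>m n. m \<ge> M \<Longrightarrow> n \<ge> M \<Longrightarrow> dist (x m) (x n) < \<epsilon> * norm e"
        using LIMSEQ_imp_Cauchy[OF l] by (meson metric_CauchyD)
      have "dist (r m) (r n) < \<epsilon>" if "m \<ge> M" "n \<ge> M" for m n
        using M[OF that] False by (simp add: x dist_norm flip: scaleR_diff_left)
      then show "\<exists>M. \<forall>m\<ge>M. \<forall>n\<ge>M. dist (r m) (r n) < \<epsilon>" by blast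
    qed
    then obtain c where "r \<longlonglongrightarrow> c" using Cauchy_convergent convergent_def by blast
    then have "x \<longlonglongrightarrow> c *\<^sub>R e" unfolding x by (intro tendsto_intros)
    then show "l \<in> range (\<lambda>r. r *\<^sub>R e)" using l LIMSEQ_unique by blast
  qed
qed simp

lemma scaleR_tendsto_cancel:
  fixes e :: "'e::real_normed_vector"
  assumes e: "e \<noteq> 0" and F: "F \<noteq> bot" and lim: "((\<lambda>t. q t *\<^sub>R e) \<longlongrightarrow> d) F"
  obtains c where "(q \<longlongrightarrow> c) F" "d = c *\<^sub>R e"
proof -
  have "d \<in> range (\<lambda>r. r *\<^sub>R e)"
    by (rule Lim_in_closed_set[OF closed_line always_eventually F lim]) auto
  then obtain c where c: "d = c *\<^sub>R e" by blast
  have "((\<lambda>t. norm (q t *\<^sub>R e - d) / norm e) \<longlongrightarrow> 0) F"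
    using tendsto_divide[OF tendsto_norm[OF LIM_zero[OF lim]] tendsto_const[of "norm e"]] e by simp
  moreover have "norm (q t *\<^sub>R e - d) / norm e = norm (q t - c)" for t
    using e by (simp add: c flip: scaleR_diff_left)
  ultimately have "((\<lambda>t. q t - c) \<longlongrightarrow> 0) F" by (simp add: tendsto_rabs_zero_iff)
  then show thesis using that c LIM_zero_cancel by blast
qed

lemma continuous_on_scaleR_cancel:
  fixes e :: "'e::real_normed_vector"
  assumes e: "e \<noteq> 0" and "continuous_on S (\<lambda>x. u x *\<^sub>R e)"
  shows "continuous_on S u"
  unfolding continuous_on_def
proof
  fix x assume x: "x \<in> S"
  show "(u \<longlongrightarrow> u x) (at x within S)"
  proof (cases "at x within S = bot")
    case False
    have "((\<lambda>x. u x *\<^sub>R e) \<longlongrightarrow> u x *\<^sub>R e) (at x within S)"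
      using assms(2) x by (simp add: continuous_on_def)
    then show ?thesis
      using scaleR_tendsto_cancel[OF e False, of u] e
      by (metis scaleR_right_imp_eq)
  qed simp
qed

lemma has_pd_tendsto:
  "has_pd i f d x \<longleftrightarrow> ((\<lambda>t. (f (x + t *\<^sub>R axis i 1) - f x) /\<^sub>R t) \<longlongrightarrow> d) (at 0)"
proof -
  define q where "q = (\<lambda>t. (f (x + t *\<^sub>R axis i 1) - f x) /\<^sub>R t - d)"
  have "norm (f (x + t *\<^sub>R axis i 1) - f x - t *\<^sub>R d) / norm t = norm (q t)" if "t \<noteq> 0" for t
  proof -
    have "q t = (f (x + t *\<^sub>R axis i 1) - f x - t *\<^sub>R d) /\<^sub>R t"
      using that by (simp add: q_def scaleR_diff_right)
    then show ?thesis by (simp add: divide_inverse mult.commute)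
  qed
  then have "((\<lambda>t. norm (f (x + t *\<^sub>R axis i 1) - f x - t *\<^sub>R d) / norm t) \<longlongrightarrow> 0) (at 0)
      \<longleftrightarrow> ((\<lambda>t. norm (q t)) \<longlongrightarrow> 0) (at 0)"
    by (intro filterlim_cong refl) (auto simp: eventually_at_filter)
  also have "\<dots> \<longleftrightarrow> ((\<lambda>t. (f (x + t *\<^sub>R axis i 1) - f x) /\<^sub>R t) \<longlongrightarrow> d) (at 0)"
    unfolding tendsto_norm_zero_iff q_def by (rule LIM_zero_iff)
  finally show ?thesis
    by (simp add: has_pd_def has_vector_derivative_def has_derivative_at bounded_linear_scaleR_left)
qed

text \<open>The components of the support map are found as coefficients of a fixed vector, and acquire their
  smoothness in this way.\<close>

lemma class_C_scaleR_cancel: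
  fixes e :: "'e::real_normed_vector"
  assumes U: "open U" and e: "e \<noteq> 0" and "class_C n U (\<lambda>x. u x *\<^sub>R e)"
  shows "class_C n U u"
  using assms(3)
proof (induction n arbitrary: u)
  case 0
  then show ?case using continuous_on_scaleR_cancel[OF e] by (simp add: class_C_0)
next
  case (Suc n)
  have pd: "has_partial i u x" "partial_deriv i (\<lambda>x. u x *\<^sub>R e) x = partial_deriv i u x *\<^sub>R e"
    if x: "x \<in> U" for i x
  proof -
    define \<delta> where "\<delta> = (\<lambda>t. (u (x + t *\<^sub>R axis i 1) - u x) / t)"
    obtain d where d: "has_pd i (\<lambda>x. u x *\<^sub>R e) d x"
      using Suc.prems x has_pd_partial by (force simp: class_C_Suc)
    have "((\<lambda>t. (u (x + t *\<^sub>R axis i 1) *\<^sub>R e - u x *\<^sub>R e) /\<^sub>R t) \<longlongrightarrow> d) (at 0)"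
      using d by (simp add: has_pd_tendsto)
    then have "((\<lambda>t. \<delta> t *\<^sub>R e) \<longlongrightarrow> d) (at 0)"
      by (simp add: \<delta>_def divide_inverse mult.commute flip: scaleR_diff_left)
    then obtain c where c: "(\<delta> \<longlongrightarrow> c) (at 0)" "d = c *\<^sub>R e"
      using scaleR_tendsto_cancel[OF e] by (metis at_neq_bot)
    have "((\<lambda>t. u (x + t *\<^sub>R axis i 1)) has_real_derivative c) (at 0)"
      using c(1) by (simp add: has_field_derivative_iff \<delta>_def)
    then have "has_pd i u c x"
      by (simp add: has_pd_def has_real_derivative_iff_has_vector_derivative)
    then show "has_partial i u x" "partial_deriv i (\<lambda>x. u x *\<^sub>R e) x = partial_deriv i u x *\<^sub>R e"
      using d c by (simp_all add: has_pd_iff)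
  qed
  have "class_C n U (partial_deriv i u)" for i
  proof (rule Suc.IH)
    have *: "class_C n U (partial_deriv i (\<lambda>x. u x *\<^sub>R e))" using Suc.prems by (simp add: class_C_Suc)
    show "class_C n U (\<lambda>x. partial_deriv i u x *\<^sub>R e)"
      by (rule class_C_cong[OF U _ *]) (use pd in auto)
  qed
  then show ?case
    using pd Suc.prems continuous_on_scaleR_cancel[OF e] by (auto simp: class_C_Suc)
qed

text \<open>Termwise differentiation on axis-parallel lines, the Weierstrass test giving uniform convergence of
  all derivatives.  Infinite sums of humps are differentiated with it.\<close>

lemma class_C_series:
  fixes g :: "nat \<Rightarrow> real^'p \<Rightarrow> 'e::banach"
  assumes U: "open U" and g: "\<And>k. class_C n U (g k)" and M: "summable M"
    and bd: "\<And>k ks x. length ks \<le> n \<Longrightarrow> x \<in> U \<Longrightarrow> norm (iter_partial ks (g k) x) \<le> M k"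
  shows "class_C n U (\<lambda>x. \<Sum>k. g k x)"
proof (rule class_C_I(1)[OF U])
  define D where "D = (\<lambda>ks x. \<Sum>k. iter_partial ks (g k) x)"
  have ul: "uniform_limit U (\<lambda>N x. \<Sum>k<N. iter_partial ks (g k) x) (D ks) sequentially"
    if "length ks \<le> n" for ks
    unfolding D_def by (rule Weierstrass_m_test[OF _ M]) (use bd that in auto)
  show "(\<Sum>k. g k x) = D [] x" for x by (simp add: D_def)
  show "continuous_on U (D ks)" if "length ks \<le> n" for ks
    by (rule uniform_limit_theorem[OF always_eventually ul[OF that]])
       (auto intro!: continuous_on_sum class_C_continuous[OF g that])
  show "has_pd i (D ks) (D (i # ks) x) x" if ks: "length ks < n" and x: "x \<in> U" for ks i x
  proof -
    define L where "L = (\<lambda>t::real. x + t *\<^sub>R axis i (1::real))"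
    have "open {t. L t \<in> U}" "0 \<in> {t. L t \<in> U}"
      using open_axis_line[OF U, of x i] x by (auto simp: L_def)
    then obtain r where "r > 0" "ball 0 r \<subseteq> {t. L t \<in> U}"
      by (rule openE)
    then have r: "r > 0" "\<And>t. t \<in> ball 0 r \<Longrightarrow> L t \<in> U" by auto
    have sums: "(\<lambda>k. iter_partial ks (g k) (L 0)) sums D ks (L 0)"
      unfolding D_def
      by (rule summable_sums, rule summable_comparison_test'[OF M, of 0]) (use bd ks x in \<open>auto simp: L_def\<close>)
    have "\<exists>G. \<forall>t\<in>ball 0 r. (\<lambda>k. iter_partial ks (g k) (L t)) sums G t \<and>
        (G has_derivative (\<lambda>h. h *\<^sub>R D (i # ks) (L t))) (at t within ball 0 r)"
    proof (rule has_derivative_series)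
      show "((\<lambda>t. iter_partial ks (g k) (L t)) has_derivative (\<lambda>h. h *\<^sub>R iter_partial (i # ks) (g k) (L t)))
          (at t within ball 0 r)" if "t \<in> ball 0 r" for k t
        using has_pd_line[OF class_C_has_pd[OF g ks r(2)[OF that, unfolded L_def], of i]]
        by (auto simp: L_def has_vector_derivative_def intro: has_derivative_at_withinI)
      show "\<forall>\<^sub>F N in sequentially. \<forall>t\<in>ball 0 r. \<forall>h.
          norm ((\<Sum>k<N. h *\<^sub>R iter_partial (i # ks) (g k) (L t)) - h *\<^sub>R D (i # ks) (L t)) \<le> \<epsilon> * norm h"
        if "\<epsilon> > 0" for \<epsilon>
      proof -
        have "length (i # ks) \<le> n" using ks by simp
        from uniform_limitD[OF ul[OF this] that]
        show ?thesis
        proof eventually_elim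
          case (elim N)
          show ?case
          proof (intro ballI allI)
            fix t h :: real assume "t \<in> ball 0 r"
            then have "norm ((\<Sum>k<N. iter_partial (i # ks) (g k) (L t)) - D (i # ks) (L t)) \<le> \<epsilon>"
              using elim r(2) by (force simp: dist_norm)
            then have "norm h * norm ((\<Sum>k<N. iter_partial (i # ks) (g k) (L t)) - D (i # ks) (L t)) \<le> norm h * \<epsilon>"
              by (rule mult_left_mono) simp
            then show "norm ((\<Sum>k<N. h *\<^sub>R iter_partial (i # ks) (g k) (L t)) - h *\<^sub>R D (i # ks) (L t)) \<le> \<epsilon> * norm h"
              by (simp add: mult.commute flip: scaleR_sum_right scaleR_diff_right)
          qed
        qed
      qed
    qed (use r(1) sums in auto)
    then obtain G where "\<forall>t\<in>ball 0 r. (\<lambda>k. iter_partial ks (g k) (L t)) sums G t \<and>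
        (G has_derivative (\<lambda>h. h *\<^sub>R D (i # ks) (L t))) (at t within ball 0 r)" ..
    then have G: "\<And>t. t \<in> ball 0 r \<Longrightarrow> (\<lambda>k. iter_partial ks (g k) (L t)) sums G t"
      "\<And>t. t \<in> ball 0 r \<Longrightarrow> (G has_vector_derivative D (i # ks) (L t)) (at t within ball 0 r)"
      by (simp_all add: has_vector_derivative_def)
    have 0: "at 0 within ball 0 r = at (0::real)" "L 0 = x" "0 \<in> ball (0::real) r"
      using r(1) by (auto simp: L_def intro: at_within_open)
    have "(G has_vector_derivative D (i # ks) x) (at 0)"
      using G(2)[OF 0(3)] unfolding 0(1,2) .
    then have "((\<lambda>t. D ks (L t)) has_vector_derivative D (i # ks) x) (at 0)"
      by (rule has_vector_derivative_transform_within_open[of _ _ _ "ball 0 r"])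
         (use r(1) G(1) in \<open>auto simp: D_def sums_iff\<close>)
    then show ?thesis by (simp add: has_pd_def L_def)
  qed
qed

section \<open>The uniform boundedness principle\<close>

text \<open>Because \<open>2 *\<^sub>R A \<eta> = A (x + \<eta>) - A (x - \<eta>)\<close>, one of the two values is at least as large as \<open>A \<eta>\<close>;
  so the centre \<open>x\<close> is irrelevant.\<close>

lemma blinfun_large_in_ball:
  fixes A :: "'e::real_normed_vector \<Rightarrow>\<^sub>L 'f::real_normed_vector"
  assumes r: "r > 0"
  obtains y where "norm (y - x) \<le> r" "norm (A y) \<ge> 2/3 * r * norm A"
proof (cases "norm A = 0")
  case True
  then show ?thesis using that[of x] r by simp
next
  case False
  have "\<exists>\<xi>. norm (A \<xi>) > 2/3 * norm A * norm \<xi>"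
  proof (rule ccontr)
    assume "\<not> ?thesis"
    then have "norm A \<le> 2/3 * norm A" by (intro norm_blinfun_bound) (auto simp: not_less)
    then show False using False by simp
  qed
  then obtain \<xi> where \<xi>: "norm (A \<xi>) > 2/3 * norm A * norm \<xi>" by blast
  then have "\<xi> \<noteq> 0" by auto
  define \<eta> where "\<eta> = (r / norm \<xi>) *\<^sub>R \<xi>"
  have \<eta>: "norm \<eta> = r" using \<open>\<xi> \<noteq> 0\<close> r by (simp add: \<eta>_def)
  have "norm (A \<eta>) = r / norm \<xi> * norm (A \<xi>)" using r by (simp add: \<eta>_def blinfun.scaleR_right)
  also have "\<dots> \<ge> r / norm \<xi> * (2/3 * norm A * norm \<xi>)"
    by (rule mult_left_mono) (use \<xi> r in auto)
  finally have A\<eta>: "norm (A \<eta>) \<ge> 2/3 * r * norm A" using \<open>\<xi> \<noteq> 0\<close> by simp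
  have "2 *\<^sub>R A \<eta> = A (x + \<eta>) - A (x - \<eta>)"
    by (simp add: blinfun.add_right blinfun.diff_right scaleR_2)
  then have "2 * norm (A \<eta>) \<le> norm (A (x + \<eta>)) + norm (A (x - \<eta>))"
    by (metis norm_scaleR abs_numeral norm_triangle_ineq4)
  then have "norm (A (x + \<eta>)) \<ge> norm (A \<eta>) \<or> norm (A (x - \<eta>)) \<ge> norm (A \<eta>)" by linarith
  then show ?thesis using that[of "x + \<eta>"] that[of "x - \<eta>"] \<eta> A\<eta> by auto
qed

text \<open>Operators with norms exceeding \<open>4 ^ k\<close> are made large at points \<open>x (k + 1)\<close> within \<open>3 ^ - k\<close> of \<open>x k\<close>.
  The later moves add up to at most \<open>1/2 * 3 ^ - k\<close>, which takes away only part of the share \<open>2/3\<close> of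
  the norm that is attained, so that the limit point contradicts pointwise boundedness.\<close>

lemma uniform_boundedness:
  fixes A :: "'i \<Rightarrow> 'e::banach \<Rightarrow>\<^sub>L 'f::real_normed_vector"
  assumes pw: "\<And>e. \<exists>M. \<forall>i\<in>I. norm (A i e) \<le> M"
  shows "\<exists>M. \<forall>i\<in>I. norm (A i) \<le> M"
proof (rule ccontr)
  assume "\<not> ?thesis"
  then have "\<forall>k::nat. \<exists>i\<in>I. norm (A i) > 4 ^ k" by (meson not_le)
  then obtain i where i: "\<And>k::nat. i k \<in> I" "\<And>k::nat. norm (A (i k)) > 4 ^ k" by metis
  define P where "P = (\<lambda>(k::nat) x y. norm (y - x) \<le> (1/3) ^ k \<and>
      norm (A (i k) y) \<ge> 2/3 * (1/3) ^ k * norm (A (i k)))"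
  have "\<exists>x. \<forall>k. P k (x k) (x (Suc k))"
  proof -
    have "\<exists>y. P k x y" for k x
      using blinfun_large_in_ball[of "(1/3) ^ k" x "A (i k)"] unfolding P_def
      by (metis zero_less_divide_1_iff zero_less_numeral zero_less_power)
    then show ?thesis
      using dependent_nat_choice[of "\<lambda>_ _. True" "\<lambda>k x y. P k x y"] by auto
  qed
  then obtain x where x: "\<And>k. norm (x (Suc k) - x k) \<le> (1/3) ^ k"
    "\<And>k. norm (A (i k) (x (Suc k))) \<ge> 2/3 * (1/3) ^ k * norm (A (i k))"
    unfolding P_def by blast
  have geo: "summable (\<lambda>k. (1/3::real) ^ k)" by (rule summable_geometric) simp
  have sd: "summable (\<lambda>k. norm (x (Suc k) - x k))"
    by (rule summable_comparison_test'[OF geo, of 0]) (use x(1) in auto)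
  have "convergent x"
  proof -
    have "convergent (\<lambda>n. \<Sum>k<n. x (Suc k) - x k)"
      using summable_norm_cancel[OF sd] by (simp add: summable_iff_convergent)
    then have "convergent (\<lambda>n. x n - x 0)" by (simp add: sum_lessThan_telescope)
    then show ?thesis using convergent_add_const_right_iff[of "\<lambda>n. x n - x 0" "x 0"]
      convergent_diff_const_right_iff by blast
  qed
  then obtain z where z: "x \<longlonglongrightarrow> z" by (auto simp: convergent_def)
  have near: "norm (z - x k) \<le> 3/2 * (1/3) ^ k" for k
  proof -
    have "norm (x (j + k) - x k) \<le> 3/2 * (1/3) ^ k" for j
    proof -
      have "norm (x (j + k) - x k) \<le> 3/2 * (1/3) ^ k * (1 - (1/3) ^ j)"
      proof (induction j)
        case (Suc j)
        have "norm (x (Suc j + k) - x k) \<le> norm (x (Suc (j + k)) - x (j + k)) + norm (x (j + k) - x k)"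
          using norm_triangle_ineq[of "x (Suc (j + k)) - x (j + k)" "x (j + k) - x k"] by simp
        also have "\<dots> \<le> (1/3) ^ (j + k) + 3/2 * (1/3) ^ k * (1 - (1/3) ^ j)"
          using x(1) Suc by (intro add_mono) auto
        also have "\<dots> = 3/2 * (1/3) ^ k * (1 - (1/3) ^ Suc j)"
          by (simp add: power_add field_simps)
        finally show ?case .
      qed simp
      also have "\<dots> \<le> 3/2 * (1/3) ^ k * 1" by (intro mult_left_mono) auto
      finally show ?thesis by simp
    qed
    then show ?thesis
      using tendsto_upperbound[OF tendsto_norm[OF tendsto_diff[OF LIMSEQ_ignore_initial_segment[OF z, of k]
            tendsto_const[of "x k"]]], of "3/2 * (1/3) ^ k"] by auto
  qed
  have big: "norm (A (i k) z) \<ge> 1/6 * (4/3) ^ k" for k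
  proof -
    have "norm (A (i k) (x (Suc k))) \<le> norm (A (i k) z) + norm (A (i k) (x (Suc k) - z))"
      using norm_triangle_ineq[of "A (i k) z" "A (i k) (x (Suc k) - z)"] by (simp flip: blinfun.add_right)
    also have "norm (A (i k) (x (Suc k) - z)) \<le> norm (A (i k)) * (3/2 * (1/3) ^ Suc k)"
      by (rule order_trans[OF norm_blinfun mult_left_mono])
         (use near[of "Suc k"] in \<open>auto simp: norm_minus_commute\<close>)
    finally have "norm (A (i k) z) \<ge> 1/6 * (1/3) ^ k * norm (A (i k))"
      using x(2)[of k] by (simp add: algebra_simps)
    moreover have "1/6 * (1/3) ^ k * norm (A (i k)) \<ge> 1/6 * (1/3) ^ k * 4 ^ k"
      by (rule mult_left_mono) (use i(2)[of k] in auto)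
    ultimately show ?thesis by (simp add: power_divide)
  qed
  obtain M where M: "\<And>k. norm (A (i k) z) \<le> M" using pw[of z] i(1) by blast
  obtain k where "(4/3::real) ^ k > 6 * M" using real_arch_pow[of "4/3"] by auto
  then show False using M[of k] big[of k] by simp
qed

text \<open>A pointwise limit of continuous operators is continuous.\<close>

lemma bounded_linear_limit:
  fixes A :: "nat \<Rightarrow> 'e::banach \<Rightarrow>\<^sub>L 'f::real_normed_vector"
  assumes "\<And>e. (\<lambda>k. A k e) \<longlonglongrightarrow> L e"
  shows "bounded_linear L"
proof -
  have "\<exists>M. \<forall>k. norm (A k e) \<le> M" for e
    using convergent_imp_Bseq[of "\<lambda>k. A k e"] assms[of e] unfolding Bseq_def convergent_def by blast
  then obtain M where M: "\<And>k. norm (A k) \<le> M"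
    using uniform_boundedness[of UNIV A] by auto
  show ?thesis
  proof (rule bounded_linear_intro)
    show "L (x + y) = L x + L y" for x y
      using tendsto_add[OF assms[of x] assms[of y]] assms[of "x + y"]
      by (simp add: blinfun.add_right LIMSEQ_unique)
    show "L (r *\<^sub>R x) = r *\<^sub>R L x" for r x
      using tendsto_scaleR[OF tendsto_const[of r] assms[of x]] assms[of "r *\<^sub>R x"]
      by (simp add: blinfun.scaleR_right LIMSEQ_unique)
    show "norm (L x) \<le> norm x * M" for x
    proof (rule tendsto_upperbound[OF tendsto_norm[OF assms]])
      show "\<forall>\<^sub>F k in sequentially. norm (A k x) \<le> norm x * M"
      proof (intro always_eventually allI)
        fix k
        have "norm (A k x) \<le> norm (A k) * norm x" by (rule norm_blinfun)
        also have "\<dots> \<le> M * norm x" by (rule mult_right_mono) (use M in auto)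
        finally show "norm (A k x) \<le> norm x * M" by (simp add: mult.commute)
      qed
    qed simp
  qed
qed

section \<open>Bounds for functions of class C^n\<close>

lemma norm_increment_le_axis:
  fixes f :: "real^'p \<Rightarrow> 'e::real_normed_vector"
  assumes pd: "\<And>s. s \<in> closed_segment 0 t \<Longrightarrow> has_pd i f (f' s) (x + s *\<^sub>R axis i 1)"
    and bd: "\<And>s. s \<in> closed_segment 0 t \<Longrightarrow> norm (f' s) \<le> M"
    and ab: "a \<in> closed_segment 0 t" "b \<in> closed_segment 0 t"
  shows "norm (f (x + a *\<^sub>R axis i 1) - f (x + b *\<^sub>R axis i 1)) \<le> M * \<bar>a - b\<bar>"
proof -
  have "norm (f (x + a *\<^sub>R axis i 1) - f (x + b *\<^sub>R axis i 1)) \<le> M * norm (a - b)"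
  proof (rule differentiable_bound[OF convex_closed_segment[of 0 t], where f' = "\<lambda>s h. h *\<^sub>R f' s"])
    show "((\<lambda>s. f (x + s *\<^sub>R axis i 1)) has_derivative (\<lambda>h. h *\<^sub>R f' s)) (at s within closed_segment 0 t)"
      if "s \<in> closed_segment 0 t" for s
      using has_pd_line[OF pd[OF that]] by (simp add: has_vector_derivative_def has_derivative_at_withinI)
    show "onorm (\<lambda>h. h *\<^sub>R f' s) \<le> M" if "s \<in> closed_segment 0 t" for s
    proof (rule onorm_le)
      show "norm (h *\<^sub>R f' s) \<le> M * norm h" for h
        using mult_left_mono[OF bd[OF that] abs_ge_zero[of h]] by (simp add: mult.commute)
    qed
  qed (use ab in auto)
  then show ?thesis by simp
qed

text \<open>Taylor's estimate along an axis, for a function vanishing to order \<open>m\<close> at the end point.\<close>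

lemma norm_le_of_flat_end:
  fixes G :: "real^'q \<Rightarrow> 'f::real_normed_vector"
  assumes G: "class_C m V G" and V: "\<And>s. s \<in> closed_segment 0 t \<Longrightarrow> x + s *\<^sub>R axis i 1 \<in> V"
    and flat: "\<And>l. l < m \<Longrightarrow> iter_partial (replicate l i) G (x + t *\<^sub>R axis i 1) = 0"
    and bd: "\<And>s. s \<in> closed_segment 0 t \<Longrightarrow> norm (iter_partial (replicate m i) G (x + s *\<^sub>R axis i 1)) \<le> M"
  shows "norm (G x) \<le> M * \<bar>t\<bar> ^ m"
proof -
  have M: "0 \<le> M" by (rule order_trans[OF norm_ge_zero bd[of 0]]) simp
  have "\<forall>s\<in>closed_segment 0 t. norm (iter_partial (replicate (m - j) i) G (x + s *\<^sub>R axis i 1)) \<le> M * \<bar>t\<bar> ^ j"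
    if "j \<le> m" for j
    using that
  proof (induction j)
    case 0
    then show ?case using bd by simp
  next
    case (Suc j)
    have eq: "m - j = Suc (m - Suc j)" and lt: "m - Suc j < m" using Suc.prems by auto
    show ?case
    proof
      fix s assume s: "s \<in> closed_segment 0 t"
      have "norm (iter_partial (replicate (m - Suc j) i) G (x + s *\<^sub>R axis i 1)
          - iter_partial (replicate (m - Suc j) i) G (x + t *\<^sub>R axis i 1)) \<le> (M * \<bar>t\<bar> ^ j) * \<bar>s - t\<bar>"
      proof (rule norm_increment_le_axis[where f' = "\<lambda>s. iter_partial (replicate (m - j) i) G (x + s *\<^sub>R axis i 1)"])
        show "has_pd i (iter_partial (replicate (m - Suc j) i) G)
            (iter_partial (replicate (m - j) i) G (x + s *\<^sub>R axis i 1)) (x + s *\<^sub>R axis i 1)"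
          if "s \<in> closed_segment 0 t" for s
          using class_C_has_pd[OF G _ V[OF that], of "replicate (m - Suc j) i" i] lt by (simp add: eq)
      qed (use Suc s in auto)
      also have "\<dots> \<le> (M * \<bar>t\<bar> ^ j) * \<bar>t\<bar>"
        by (rule mult_left_mono) (use s M in \<open>auto simp: closed_segment_eq_real_ivl split: if_splits\<close>)
      finally show "norm (iter_partial (replicate (m - Suc j) i) G (x + s *\<^sub>R axis i 1)) \<le> M * \<bar>t\<bar> ^ Suc j"
        using flat[OF lt] by (simp add: mult_ac)
    qed
  qed
  from this[of m] show ?thesis by force
qed

text \<open>A path of axis-parallel segments leads from \<open>a\<close> to \<open>x\<close>; it stays in the ball because each coordinate
  stays between those of \<open>a\<close> and \<open>x\<close>.  This avoids total derivatives.\<close>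

lemma norm_increment_le:
  fixes f :: "real^'p \<Rightarrow> 'e::real_normed_vector" and M :: real
  assumes pd: "\<And>i z. z \<in> cball a (norm (x - a)) \<Longrightarrow> has_pd i f (f' i z) z"
    and bd: "\<And>i z. z \<in> cball a (norm (x - a)) \<Longrightarrow> norm (f' i z) \<le> M"
  shows "norm (f x - f a) \<le> CARD('p) * M * norm (x - a)"
proof -
  define z where "z = (\<lambda>S. a + (\<Sum>i\<in>S. ((x - a) $ i) *\<^sub>R axis i (1::real)))"
  have M: "0 \<le> M"
  proof -
    have "norm (f' undefined a) \<le> M" by (rule bd) simp
    then show ?thesis using norm_ge_zero[of "f' undefined a"] by linarith
  qed
  have comp: "z S $ j = (if j \<in> S then x $ j else a $ j)" for S j
    by (simp add: z_def axis_def if_distrib[of "\<lambda>t. _ * t"] cong: if_cong)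
  have "norm (f (z S) - f a) \<le> card S * M * norm (x - a)" if "finite S" for S
    using that
  proof (induction S rule: finite_induct)
    case empty
    then show ?case by (simp add: z_def)
  next
    case (insert j S)
    let ?t = "(x - a) $ j"
    have ins: "z (insert j S) = z S + ?t *\<^sub>R axis j 1" using insert by (simp add: z_def algebra_simps)
    have in_ball: "z S + s *\<^sub>R axis j 1 \<in> cball a (norm (x - a))" if "s \<in> closed_segment 0 ?t" for s
    proof -
      have "norm (z S + s *\<^sub>R axis j 1 - a) \<le> norm (x - a)"
      proof (rule norm_le_componentwise_cart)
        fix k
        have "(z S + s *\<^sub>R axis j 1 - a) $ k = (z S - a) $ k + s * axis j 1 $ k" by simp
        then show "norm ((z S + s *\<^sub>R axis j 1 - a) $ k) \<le> norm ((x - a) $ k)"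
          using that insert.hyps
          by (cases "k = j") (auto simp: comp axis_def closed_segment_eq_real_ivl split: if_splits)
      qed
      then show ?thesis by (simp add: dist_norm norm_minus_commute)
    qed
    have "norm (f (z S + ?t *\<^sub>R axis j 1) - f (z S + 0 *\<^sub>R axis j 1)) \<le> M * \<bar>?t - 0\<bar>"
      by (rule norm_increment_le_axis[where t = ?t and f' = "\<lambda>s. f' j (z S + s *\<^sub>R axis j 1)"]) (use pd bd in_ball in auto)
    also have "\<dots> \<le> M * norm (x - a)"
      using component_le_norm_cart[of "x - a" j] M by (intro mult_left_mono) auto
    finally have "norm (f (z (insert j S)) - f (z S)) \<le> M * norm (x - a)" by (simp add: ins)
    then have "norm (f (z (insert j S)) - f a) \<le> M * norm (x - a) + card S * M * norm (x - a)"
      using insert.IH norm_triangle_ineq[of "f (z (insert j S)) - f (z S)" "f (z S) - f a"] by simp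
    then show ?case using insert.hyps by (simp add: algebra_simps)
  qed
  from this[of UNIV] have "norm (f (z UNIV) - f a) \<le> CARD('p) * M * norm (x - a)" by simp
  moreover have "z UNIV = x"
  proof -
    show ?thesis by (simp add: vec_eq_iff comp)
  qed
  ultimately show ?thesis by simp
qed

section \<open>Cutoff functions\<close>

lemma iter_partial_scaled:
  fixes \<kappa> :: "real^'p \<Rightarrow> 'e::real_normed_vector"
  assumes \<kappa>: "class_C n UNIV \<kappa>"
  shows "class_C n UNIV (\<lambda>x. \<kappa> (s *\<^sub>R (x - a)))"
    and "\<And>ks x. length ks \<le> n \<Longrightarrow>
      iter_partial ks (\<lambda>x. \<kappa> (s *\<^sub>R (x - a))) x = s ^ length ks *\<^sub>R iter_partial ks \<kappa> (s *\<^sub>R (x - a))"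
proof -
  let ?D = "\<lambda>ks x. s ^ length ks *\<^sub>R iter_partial ks \<kappa> (s *\<^sub>R (x - a))"
  have 1: "has_pd i (?D ks) (?D (i # ks) x) x" if "length ks < n" for ks i x
  proof -
    have d1: "((\<lambda>t. s * t) has_vector_derivative s) (at (0::real))"
      by (auto intro!: derivative_eq_intros simp: has_vector_derivative_def)
    have d2: "((\<lambda>t. iter_partial ks \<kappa> (s *\<^sub>R (x - a) + t *\<^sub>R axis i 1)) has_vector_derivative
        iter_partial (i # ks) \<kappa> (s *\<^sub>R (x - a))) (at (s * 0))"
      using class_C_has_pd[OF \<kappa> that, of "s *\<^sub>R (x - a)" i] by (simp add: has_pd_def)
    have "((\<lambda>t. iter_partial ks \<kappa> (s *\<^sub>R (x - a) + (s * t) *\<^sub>R axis i 1)) has_vector_derivative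
        s *\<^sub>R iter_partial (i # ks) \<kappa> (s *\<^sub>R (x - a))) (at 0)"
      using vector_diff_chain_at[OF d1 d2] by (simp add: o_def)
    moreover have "s *\<^sub>R (x - a) + (s * t) *\<^sub>R axis i 1 = s *\<^sub>R (x + t *\<^sub>R axis i 1 - a)" for t
      by (simp add: algebra_simps)
    ultimately have "((\<lambda>t. iter_partial ks \<kappa> (s *\<^sub>R (x + t *\<^sub>R axis i 1 - a))) has_vector_derivative
        s *\<^sub>R iter_partial (i # ks) \<kappa> (s *\<^sub>R (x - a))) (at 0)" by simp
    then have "((\<lambda>t. s ^ length ks *\<^sub>R iter_partial ks \<kappa> (s *\<^sub>R (x + t *\<^sub>R axis i 1 - a)))
        has_vector_derivative s ^ length ks *\<^sub>R (s *\<^sub>R iter_partial (i # ks) \<kappa> (s *\<^sub>R (x - a)))) (at 0)"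
      by (rule bounded_linear.has_vector_derivative[OF bounded_linear_scaleR_right])
    then show ?thesis by (simp add: has_pd_def mult.commute)
  qed
  have 2: "continuous_on UNIV (?D ks)" if "length ks \<le> n" for ks
    by (intro continuous_intros continuous_on_compose2[OF class_C_continuous[OF \<kappa> that]]) auto
  show "class_C n UNIV (\<lambda>x. \<kappa> (s *\<^sub>R (x - a)))"
    by (rule class_C_I(1)[OF open_UNIV _ 1 2]) auto
  show "iter_partial ks (\<lambda>x. \<kappa> (s *\<^sub>R (x - a))) x = ?D ks x" if "length ks \<le> n" for ks x
    by (rule class_C_I(2)[OF open_UNIV _ 1 2]) (use that in auto)
qed

lemma iter_partial_zero_outside:
  fixes f :: "real^'p \<Rightarrow> 'e::real_normed_vector"
  assumes "open W" "\<And>x. x \<in> W \<Longrightarrow> f x = 0" "x \<in> W"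
  shows "iter_partial ks f x = 0"
proof -
  have "iter_partial ks f x = iter_partial ks (\<lambda>x. 0::'e) x"
    by (rule iter_partial_cong[OF assms(1) _ assms(3)]) (use assms in auto)
  also have "\<dots> = 0" using class_C_const(2)[OF open_UNIV, of ks "length ks" x "0::'e"] by simp
  finally show ?thesis .
qed

lemma class_C_bounded_on_compact:
  fixes f :: "real^'p \<Rightarrow> 'e::real_normed_vector"
  assumes f: "class_C n U f" and K: "compact K" "K \<subseteq> U"
  obtains M where "M > 0" "\<And>ks x. length ks \<le> n \<Longrightarrow> x \<in> K \<Longrightarrow> norm (iter_partial ks f x) \<le> M"
proof -
  have "\<exists>M. \<forall>x\<in>K. norm (iter_partial ks f x) \<le> M" if "length ks \<le> n" for ks
  proof -
    have "compact (iter_partial ks f ` K)"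
      by (intro compact_continuous_image continuous_on_subset[OF class_C_continuous[OF f that]] K)
    then have "bounded (iter_partial ks f ` K)" by (rule compact_imp_bounded)
    then show ?thesis by (simp add: bounded_iff)
  qed
  then obtain M where M: "\<And>ks x. length ks \<le> n \<Longrightarrow> x \<in> K \<Longrightarrow> norm (iter_partial ks f x) \<le> M ks" by metis
  have fin: "finite {ks :: 'p list. length ks \<le> n}"
    using finite_lists_length_le[of "UNIV :: 'p set" n] by simp
  show thesis
  proof
    show "1 + (\<Sum>ks\<in>{ks :: 'p list. length ks \<le> n}. \<bar>M ks\<bar>) > 0"
      by (intro add_pos_nonneg sum_nonneg) auto
    fix ks :: "'p list" and x assume *: "length ks \<le> n" "x \<in> K"
    have "norm (iter_partial ks f x) \<le> \<bar>M ks\<bar>" using M[OF *] by linarith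
    also have "\<dots> \<le> (\<Sum>ks | length ks \<le> n. \<bar>M ks\<bar>)"
      by (rule member_le_sum) (use * fin in auto)
    finally show "norm (iter_partial ks f x) \<le> 1 + (\<Sum>ks | length ks \<le> n. \<bar>M ks\<bar>)" by simp
  qed
qed

text \<open>With \<open>P t = max 0 t ^ (n + 1)\<close> the function is \<open>1 - P (1 - P (4 - norm x ^ 2))\<close>: the inner \<open>P\<close> is at
  least \<open>1\<close> on the unit ball and vanishes outside the ball of radius \<open>2\<close>.\<close>

lemma unit_cutoff:
  fixes n :: nat
  obtains \<kappa> :: "real^'p \<Rightarrow> real" and M where "class_C n UNIV \<kappa>" "M > 0"
    "\<And>x. norm x \<le> 1 \<Longrightarrow> \<kappa> x = 1" "\<And>x. norm x \<ge> 2 \<Longrightarrow> \<kappa> x = 0"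
    "\<And>ks x. length ks \<le> n \<Longrightarrow> norm (iter_partial ks \<kappa> x) \<le> M"
proof -
  define \<kappa> :: "real^'p \<Rightarrow> real" where
    "\<kappa> x = 1 + (-1) *\<^sub>R (max 0 (1 + (-1) *\<^sub>R max 0 (4 + (-1) *\<^sub>R (norm (x - 0))\<^sup>2) ^ Suc n) ^ Suc n)" for x
  have C: "class_C n UNIV \<kappa>"
    unfolding \<kappa>_def
    by (intro class_C_add class_C_scaleR class_C_const class_C_pos_part_power class_C_norm_square open_UNIV)
  have one: "\<kappa> x = 1" if "norm x \<le> 1" for x
  proof -
    have "(norm x)\<^sup>2 \<le> 1\<^sup>2" by (rule power_mono) (use that in auto)
    then have "1 \<le> (max 0 (4 - (norm x)\<^sup>2)) ^ Suc n" by (intro one_le_power) auto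
    then show ?thesis by (simp add: \<kappa>_def)
  qed
  have zero: "\<kappa> x = 0" if "norm x \<ge> 2" for x
  proof -
    have "(norm x)\<^sup>2 \<ge> 2\<^sup>2" by (rule power_mono) (use that in auto)
    then have "max 0 (4 - (norm x)\<^sup>2) = 0" by simp
    then show ?thesis by (simp add: \<kappa>_def)
  qed
  obtain M where M: "M > 0" "\<And>ks x. length ks \<le> n \<Longrightarrow> x \<in> cball 0 2 \<Longrightarrow> norm (iter_partial ks \<kappa> x) \<le> M"
    using class_C_bounded_on_compact[OF C compact_cball[of 0 2]] by auto
  have "norm (iter_partial ks \<kappa> x) \<le> M" if "length ks \<le> n" for ks x
  proof (cases "x \<in> cball 0 2")
    case False
    have "iter_partial ks \<kappa> x = 0"
      by (rule iter_partial_zero_outside[of "- cball 0 2"]) (use False zero in auto)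
    then show ?thesis using M(1) by simp
  qed (use M(2) that in auto)
  then show ?thesis using that C one zero M(1) by blast
qed

text \<open>The parameter \<open>s\<close> is the reciprocal of the width; \<open>M\<close> bounds the derivatives after rescaling.\<close>

definition is_cutoff :: "nat \<Rightarrow> real \<Rightarrow> real^'p \<Rightarrow> real \<Rightarrow> (real^'p \<Rightarrow> real) \<Rightarrow> bool"
  where "is_cutoff n M a s \<phi> \<longleftrightarrow> class_C n UNIV \<phi> \<and>
    (\<forall>x. norm (x - a) \<le> 1 / s \<longrightarrow> \<phi> x = 1) \<and> (\<forall>x. norm (x - a) \<ge> 2 / s \<longrightarrow> \<phi> x = 0) \<and>
    (\<forall>ks x. length ks \<le> n \<longrightarrow> norm (iter_partial ks \<phi> x) \<le> M * s ^ length ks)"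

text \<open>Dilation and translation of one cutoff: hence one constant \<open>M\<close> serves all centres and all widths.\<close>

lemma cutoff:
  fixes n :: nat
  obtains M where "M > 0"
    "\<And>(a::real^'p) s. s > 0 \<Longrightarrow> \<exists>\<phi>. is_cutoff n M a s \<phi>"
proof -
  obtain \<kappa> :: "real^'p \<Rightarrow> real" and M where \<kappa>: "class_C n UNIV \<kappa>" "M > 0"
    "\<And>x. norm x \<le> 1 \<Longrightarrow> \<kappa> x = 1" "\<And>x. norm x \<ge> 2 \<Longrightarrow> \<kappa> x = 0"
    "\<And>ks x. length ks \<le> n \<Longrightarrow> norm (iter_partial ks \<kappa> x) \<le> M"
    using unit_cutoff by blast
  show thesis
  proof (rule that[OF \<kappa>(2)])
    fix a :: "real^'p" and s :: real assume s: "s > 0"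
    let ?\<phi> = "\<lambda>x. \<kappa> (s *\<^sub>R (x - a))"
    have "norm (iter_partial ks ?\<phi> x) \<le> M * s ^ length ks" if "length ks \<le> n" for ks x
    proof -
      have "norm (iter_partial ks ?\<phi> x) = s ^ length ks * norm (iter_partial ks \<kappa> (s *\<^sub>R (x - a)))"
        unfolding iter_partial_scaled(2)[OF \<kappa>(1) that] using s by (simp add: abs_mult)
      also have "\<dots> \<le> s ^ length ks * M" by (rule mult_left_mono) (use \<kappa>(5) that s in auto)
      finally show ?thesis by (simp add: mult.commute)
    qed
    moreover have "?\<phi> x = 1" if "norm (x - a) \<le> 1 / s" for x
      by (rule \<kappa>(3)) (use that s in \<open>simp add: pos_le_divide_eq pos_divide_le_eq mult.commute\<close>)
    moreover have "?\<phi> x = 0" if "norm (x - a) \<ge> 2 / s" for x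
      by (rule \<kappa>(4)) (use that s in \<open>simp add: pos_le_divide_eq pos_divide_le_eq mult.commute\<close>)
    ultimately show "\<exists>\<phi>. is_cutoff n M a s \<phi>"
      using iter_partial_scaled(1)[OF \<kappa>(1)] unfolding is_cutoff_def by blast
  qed
qed

section \<open>Operator-valued functions that are differentiable pointwise\<close>

text \<open>The difference quotients are continuous operators, and a pointwise limit of such is continuous.\<close>

lemma strong_partial_exists:
  fixes K :: "real^'q \<Rightarrow> 'e::banach \<Rightarrow>\<^sub>L 'f::banach"
  assumes U: "open U" and K: "\<And>e y. y \<in> U \<Longrightarrow> has_partial i (\<lambda>z. K z e) y"
  obtains D where "\<And>y e. y \<in> U \<Longrightarrow> blinfun_apply (D y) e = partial_deriv i (\<lambda>z. K z e) y"
proof -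
  have "bounded_linear (\<lambda>e. partial_deriv i (\<lambda>z. K z e) y)" if y: "y \<in> U" for y
  proof (rule bounded_linear_limit[where A = "\<lambda>k. (K (y + inverse (real (Suc k)) *\<^sub>R axis i 1) - K y) /\<^sub>R inverse (real (Suc k))"])
    fix e
    have "((\<lambda>t. (K (y + t *\<^sub>R axis i 1) e - K y e) /\<^sub>R t) \<longlongrightarrow> partial_deriv i (\<lambda>z. K z e) y) (at 0)"
      using has_pd_partial[OF K[OF y], of e] by (simp add: has_pd_tendsto)
    moreover have "filterlim (\<lambda>k. inverse (real (Suc k))) (at 0) sequentially"
      using LIMSEQ_inverse_real_of_nat by (simp add: filterlim_at)
    ultimately have "(\<lambda>k. (K (y + inverse (real (Suc k)) *\<^sub>R axis i 1) e - K y e) /\<^sub>R inverse (real (Suc k)))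
        \<longlonglongrightarrow> partial_deriv i (\<lambda>z. K z e) y"
      by (rule filterlim_compose)
    then show "(\<lambda>k. blinfun_apply ((K (y + inverse (real (Suc k)) *\<^sub>R axis i 1) - K y) /\<^sub>R inverse (real (Suc k))) e)
        \<longlonglongrightarrow> partial_deriv i (\<lambda>z. K z e) y"
      by (simp add: blinfun.scaleR_left blinfun.diff_left)
  qed
  then show thesis
    using that[of "\<lambda>y. Blinfun (\<lambda>e. partial_deriv i (\<lambda>z. K z e) y)"] by (simp add: bounded_linear_Blinfun_apply)
qed

text \<open>On a compact ball the partial derivatives are bounded for each \<open>e\<close>, hence bounded in operator norm;
  so \<open>K\<close> is locally Lipschitz in operator norm.\<close>

lemma pointwise_C1_continuous:
  fixes K :: "real^'q \<Rightarrow> 'e::banach \<Rightarrow>\<^sub>L 'f::banach"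
  assumes U: "open U" and K: "\<And>e. class_C 1 U (\<lambda>z. K z e)"
  shows "continuous_on U K"
proof -
  have hp: "has_partial i (\<lambda>z. K z e) y" if "y \<in> U" for i e y
    using K[of e] that by (simp add: class_C_Suc)
  have ct: "continuous_on U (partial_deriv i (\<lambda>z. K z e))" for i e
    using K[of e] by (simp add: class_C_Suc class_C_0)
  have "\<exists>D. \<forall>y\<in>U. \<forall>e. blinfun_apply (D y) e = partial_deriv i (\<lambda>z. K z e) y" for i
    by (rule strong_partial_exists[OF U hp, of i]) auto
  then obtain D where D: "\<And>i y e. y \<in> U \<Longrightarrow> blinfun_apply (D i y) e = partial_deriv i (\<lambda>z. K z e) y"
    by metis
  have "isCont K y" if y: "y \<in> U" for y
  proof -
    obtain r where r: "r > 0" "cball y r \<subseteq> U" using U y open_contains_cball by blast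
    have "\<exists>M. \<forall>p\<in>UNIV \<times> cball y r. norm (D (fst p) (snd p) e) \<le> M" for e
    proof -
      have "\<exists>M. \<forall>z\<in>cball y r. norm (D i z e) \<le> M" for i
      proof -
        have "compact (partial_deriv i (\<lambda>z. K z e) ` cball y r)"
          by (intro compact_continuous_image continuous_on_subset[OF ct] r) auto
        then have "bounded (partial_deriv i (\<lambda>z. K z e) ` cball y r)" by (rule compact_imp_bounded)
        then show ?thesis using r(2) D by (fastforce simp: bounded_iff)
      qed
      then obtain M where M: "\<And>i z. z \<in> cball y r \<Longrightarrow> norm (D i z e) \<le> M i" by metis
      have "norm (D i z e) \<le> Max (range M)" if "z \<in> cball y r" for i z
        using order_trans[OF M[OF that, of i] Max_ge[of "range M" "M i"]] by simp
      then show ?thesis by (intro exI[of _ "Max (range M)"]) auto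
    qed
    then have "\<exists>M. \<forall>p\<in>UNIV \<times> cball y r. norm (D (fst p) (snd p)) \<le> M"
      by (rule uniform_boundedness)
    then obtain M where M': "\<forall>p\<in>UNIV \<times> cball y r. norm (D (fst p) (snd p)) \<le> M" ..
    have M: "norm (D i z) \<le> M" if "z \<in> cball y r" for i z
      using bspec[OF M', of "(i, z)"] that by simp
    have "0 \<le> M"
    proof -
      have "norm (D undefined y) \<le> M" by (rule M) (use r(1) in simp)
      then show ?thesis using norm_ge_zero[of "D undefined y"] by linarith
    qed
    define C where "C = real CARD('q) * M"
    have lip: "norm (K z - K y) \<le> C * norm (z - y)" if z: "z \<in> ball y r" for z
    proof (rule norm_blinfun_bound)
      fix e
      have sub: "cball y (norm (z - y)) \<subseteq> cball y r"
        using z by (auto simp: dist_norm norm_minus_commute)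
      have "norm (K z e - K y e) \<le> real CARD('q) * (M * norm e) * norm (z - y)"
      proof (rule norm_increment_le)
        fix i w assume w: "w \<in> cball y (norm (z - y))"
        then have "w \<in> U" using sub r(2) by blast
        then show "has_pd i (\<lambda>z. K z e) (D i w e) w"
          by (simp add: has_pd_iff hp D)
        have "norm (D i w e) \<le> norm (D i w) * norm e" by (rule norm_blinfun)
        also have "\<dots> \<le> M * norm e" by (rule mult_right_mono) (use M w sub in auto)
        finally show "norm (D i w e) \<le> M * norm e" .
      qed
      then show "norm ((K z - K y) e) \<le> C * norm (z - y) * norm e"
        by (simp add: C_def blinfun.diff_left mult_ac)
    qed (simp add: C_def \<open>0 \<le> M\<close>)
    have "((\<lambda>z. K z - K y) \<longlongrightarrow> 0) (at y)"
    proof (rule Lim_null_comparison)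
      show "\<forall>\<^sub>F z in at y. norm (K z - K y) \<le> C * norm (z - y)"
        using eventually_at_ball[OF r(1), of y UNIV] by eventually_elim (use lip in auto)
      show "((\<lambda>z. C * norm (z - y)) \<longlongrightarrow> 0) (at y)" by (auto intro!: tendsto_eq_intros)
    qed
    then show ?thesis by (simp add: isCont_def LIM_zero_iff)
  qed
  then show ?thesis by (simp add: continuous_at_imp_continuous_on)
qed

text \<open>The mean value estimate for \<open>K z e\<close> is uniform in \<open>e\<close> of norm at most \<open>1\<close>, since \<open>D\<close> is continuous in
  norm.\<close>

lemma has_pd_operator_norm:
  fixes K D :: "real^'q \<Rightarrow> 'e::banach \<Rightarrow>\<^sub>L 'f::banach"
  assumes U: "open U" and K: "\<And>e y. y \<in> U \<Longrightarrow> has_pd i (\<lambda>z. K z e) (D y e) y"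
    and D: "continuous_on U D" and y: "y \<in> U"
  shows "has_pd i K (D y) y"
  unfolding has_pd_tendsto
proof (rule tendstoI)
  fix \<epsilon> :: real assume \<epsilon>: "\<epsilon> > 0"
  have "isCont D y" using D U y by (simp add: continuous_on_eq_continuous_at)
  then have "\<forall>\<^sub>F z in at y. dist (D z) (D y) < \<epsilon> / 2"
    using \<epsilon> by (intro tendstoD) (auto simp: isCont_def)
  then have "\<forall>\<^sub>F z in nhds y. dist (D z) (D y) < \<epsilon> / 2 \<and> z \<in> U"
    using \<epsilon> eventually_nhds_in_open[OF U y]
    by (auto simp: eventually_at_filter elim: eventually_elim2)
  then obtain \<delta> where \<delta>: "\<delta> > 0" "\<And>z. dist z y < \<delta> \<Longrightarrow> dist (D z) (D y) < \<epsilon> / 2 \<and> z \<in> U"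
    unfolding eventually_nhds_metric by blast
  have "dist ((K (y + t *\<^sub>R axis i 1) - K y) /\<^sub>R t) (D y) < \<epsilon>" if t: "t \<noteq> 0" "\<bar>t\<bar> < \<delta>" for t
  proof -
    have near: "dist (D (y + s *\<^sub>R axis i 1)) (D y) < \<epsilon> / 2" "y + s *\<^sub>R axis i 1 \<in> U"
      if "s \<in> closed_segment 0 t" for s
    proof -
      have "dist (y + s *\<^sub>R axis i 1) y < \<delta>"
        using that t by (auto simp: dist_norm norm_axis_1 closed_segment_eq_real_ivl split: if_splits)
      then show "dist (D (y + s *\<^sub>R axis i 1)) (D y) < \<epsilon> / 2" "y + s *\<^sub>R axis i 1 \<in> U" using \<delta>(2) by auto
    qed
    have "norm (K (y + t *\<^sub>R axis i 1) - K y - t *\<^sub>R D y) \<le> \<bar>t\<bar> * (\<epsilon> / 2)"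
    proof (rule norm_blinfun_bound)
      fix e
      have "norm (K (y + t *\<^sub>R axis i 1) e - K (y + 0 *\<^sub>R axis i 1) e - (t - 0) *\<^sub>R D (y + 0 *\<^sub>R axis i 1) e)
          \<le> norm (t - 0) * (\<epsilon> / 2 * norm e)"
      proof (rule vector_differentiable_bound_linearization[where S = "closed_segment 0 t"
            and f' = "\<lambda>s. D (y + s *\<^sub>R axis i 1) e"])
        fix s assume s: "s \<in> closed_segment 0 t"
        show "((\<lambda>t. K (y + t *\<^sub>R axis i 1) e) has_vector_derivative D (y + s *\<^sub>R axis i 1) e)
            (at s within closed_segment 0 t)"
          by (rule has_vector_derivative_at_within[OF has_pd_line[OF K[OF near(2)[OF s]]]])
        have "norm (D (y + s *\<^sub>R axis i 1) e - D y e) \<le> norm (D (y + s *\<^sub>R axis i 1) - D y) * norm e"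
          using norm_blinfun[of "D (y + s *\<^sub>R axis i 1) - D y" e] by (simp add: blinfun.diff_left)
        also have "\<dots> \<le> \<epsilon> / 2 * norm e"
          by (rule mult_right_mono) (use near(1)[OF s] in \<open>auto simp: dist_norm\<close>)
        finally show "norm (D (y + s *\<^sub>R axis i 1) e - D (y + 0 *\<^sub>R axis i 1) e) \<le> \<epsilon> / 2 * norm e" by simp
      qed auto
      then show "norm ((K (y + t *\<^sub>R axis i 1) - K y - t *\<^sub>R D y) e) \<le> \<bar>t\<bar> * (\<epsilon> / 2) * norm e"
        by (simp add: blinfun.diff_left blinfun.scaleR_left mult_ac)
    qed (use \<epsilon> in simp)
    then have "norm (K (y + t *\<^sub>R axis i 1) - K y - t *\<^sub>R D y) / \<bar>t\<bar> \<le> \<epsilon> / 2"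
      using t by (simp add: field_simps)
    moreover have eq: "(K (y + t *\<^sub>R axis i 1) - K y) /\<^sub>R t - D y = (K (y + t *\<^sub>R axis i 1) - K y - t *\<^sub>R D y) /\<^sub>R t"
      using t by (simp add: scaleR_diff_right)
    have "dist ((K (y + t *\<^sub>R axis i 1) - K y) /\<^sub>R t) (D y) = norm (K (y + t *\<^sub>R axis i 1) - K y - t *\<^sub>R D y) / \<bar>t\<bar>"
      unfolding dist_norm eq norm_scaleR by (simp add: divide_inverse mult.commute)
    ultimately show ?thesis using \<epsilon> by linarith
  qed
  then show "\<forall>\<^sub>F t in at 0. dist ((K (y + t *\<^sub>R axis i 1) - K y) /\<^sub>R t) (D y) < \<epsilon>"
    unfolding eventually_at using \<delta>(1) by (intro exI[of _ \<delta>]) (auto simp: dist_norm)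
qed

lemma (in banach_over) bounded_linear_scale: "bounded_linear (scale c)"
proof (rule bounded_linear_intro)
  show "scale c (x + y) = scale c x + scale c y" for x y by (rule scale_right_distrib)
  show "scale c (r *\<^sub>R x) = r *\<^sub>R scale c x" for r x
    by (metis scale_of_real scale_left_commute)
  show "norm (scale c x) \<le> norm x * norm c" for x by (simp add: norm_scale mult.commute)
qed

lemma class_sC1_pointwise:
  fixes K :: "real^'q \<Rightarrow> 'e::banach \<Rightarrow>\<^sub>L 'f::banach"
  assumes F: "banach_over scaleF"
    and U: "open U" and ops: "K \<in> U \<rightarrow> ops scaleE scaleF"
    and K: "\<And>e. class_C 1 U (\<lambda>z. K z e)"
  shows "class_sC1 scaleE scaleF U K"
  unfolding class_sC1_def
proof (intro conjI allI ballI)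
  show "K \<in> U \<rightarrow> ops scaleE scaleF" by (rule ops)
  show "continuous_on U K" by (rule pointwise_C1_continuous[OF U K])
  show hp: "has_partial i (\<lambda>z. K z e) y" if "y \<in> U" for i e y
    using K[of e] that by (simp add: class_C_Suc)
  fix i
  obtain D where D: "\<And>y e. y \<in> U \<Longrightarrow> blinfun_apply (D y) e = partial_deriv i (\<lambda>z. K z e) y"
    by (rule strong_partial_exists[OF U hp, of i]) auto
  have "D y \<in> ops scaleE scaleF" if y: "y \<in> U" for y
  proof -
    have "D y (scaleE c e) = scaleF c (D y e)" for c e
    proof -
      have "D y (scaleE c e) = partial_deriv i (\<lambda>z. scaleF c (K z e)) y"
        unfolding D[OF y] by (rule partial_deriv_cong[OF U y]) (use ops in \<open>auto simp: ops_def\<close>)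
      also have "\<dots> = scaleF c (D y e)"
        using class_C_linear(2)[OF U K[of e] banach_over.bounded_linear_scale[OF F, of c], of "[i]" y] y
        by (simp add: D[OF y])
      finally show ?thesis .
    qed
    then show ?thesis by (simp add: ops_def)
  qed
  moreover have "continuous_map (top_of_set U) strong_operator_topology D"
    unfolding continuous_on_strong_operator_topo_iff_coordinatewise
  proof
    fix e
    have "continuous_on U (partial_deriv i (\<lambda>z. K z e))"
      using K[of e] by (simp add: class_C_Suc class_C_0)
    then have "continuous_on U (\<lambda>y. D y e)" using D by (simp cong: continuous_on_cong)
    then show "continuous_map (top_of_set U) euclidean (\<lambda>y. D y e)" by simp
  qed
  ultimately show "\<exists>D. D \<in> U \<rightarrow> ops scaleE scaleF \<and>
      (\<forall>y\<in>U. \<forall>e. blinfun_apply (D y) e = partial_deriv i (\<lambda>z. K z e) y) \<and>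
      continuous_map (top_of_set U) strong_operator_topology D"
    using D by blast
qed

text \<open>A partial derivative of order less than \<open>n\<close> is pointwise of class \<open>C^1\<close>, hence norm continuous.  So
  each one of order less than \<open>n\<close> is a derivative in operator norm, and only the derivatives of the
  last order remain strong ones.\<close>

lemma class_sC_pointwise:
  fixes J :: "real^'q \<Rightarrow> 'e::banach \<Rightarrow>\<^sub>L 'f::banach"
  assumes F: "banach_over scaleF"
    and U: "open U" and n: "n \<ge> 1" and ops: "J \<in> U \<rightarrow> ops scaleE scaleF"
    and J: "\<And>e. class_C n U (\<lambda>z. J z e)"
  shows "class_sC scaleE scaleF n U J"
proof -
  have smooth: "class_C m U (iter_partial ks (\<lambda>z. J z e))" if "length ks + m \<le> n" for ks e m
    unfolding class_C_def
  proof (intro conjI allI impI)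
    fix ls :: "'q list"
    show "\<forall>x\<in>U. has_partial i (iter_partial ls (iter_partial ks (\<lambda>z. J z e))) x" if "length ls < m" for i
      using J[of e] that \<open>length ks + m \<le> n\<close> unfolding class_C_def
      by (simp flip: iter_partial_append)
    show "continuous_on U (iter_partial ls (iter_partial ks (\<lambda>z. J z e)))" if "length ls \<le> m"
      using J[of e] that \<open>length ks + m \<le> n\<close> unfolding class_C_def
      by (simp flip: iter_partial_append)
  qed
  have step: "has_partial i (iter_partial ks J) y \<and>
      blinfun_apply (iter_partial (i # ks) J y) e = iter_partial (i # ks) (\<lambda>z. J z e) y"
    if len: "length ks + 2 \<le> n" and y: "y \<in> U"
      and IH: "\<And>y e. y \<in> U \<Longrightarrow> blinfun_apply (iter_partial ks J y) e = iter_partial ks (\<lambda>z. J z e) y"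
    for i ks y e
  proof -
    let ?K = "iter_partial ks J"
    have K2: "class_C 2 U (\<lambda>z. ?K z e)" for e
      by (rule class_C_cong[OF U _ smooth[OF len, of e]]) (simp add: IH)
    then have hp: "has_partial i (\<lambda>z. ?K z e) y" if "y \<in> U" for i e y
      using that by (simp add: numeral_2_eq_2 class_C_Suc)
    obtain D where D: "\<And>y e. y \<in> U \<Longrightarrow> blinfun_apply (D y) e = partial_deriv i (\<lambda>z. ?K z e) y"
      by (rule strong_partial_exists[OF U hp, of i]) auto
    have "class_C 1 U (\<lambda>z. D z e)" for e
    proof (rule class_C_cong[OF U])
      show "class_C 1 U (partial_deriv i (\<lambda>z. ?K z e))"
        using K2[of e] by (simp add: numeral_2_eq_2 class_C_Suc)
    qed (simp add: D)
    then have "continuous_on U D" by (rule pointwise_C1_continuous[OF U])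
    moreover have "has_pd i (\<lambda>z. ?K z e) (D y e) y" if "y \<in> U" for e y
      using hp[OF that] that by (simp add: has_pd_iff D)
    ultimately have "has_pd i ?K (D y) y" by (intro has_pd_operator_norm[OF U _ _ y]) auto
    moreover have "blinfun_apply (D y) e = iter_partial (i # ks) (\<lambda>z. J z e) y"
      using partial_deriv_cong[OF U y, of "\<lambda>z. ?K z e" "iter_partial ks (\<lambda>z. J z e)" i] IH
      by (simp add: D[OF y])
    ultimately show ?thesis by (simp add: has_pd_iff)
  qed
  have pw: "blinfun_apply (iter_partial ks J y) e = iter_partial ks (\<lambda>z. J z e) y"
    if "length ks \<le> n - 1" "y \<in> U" for ks y e
    using that
  proof (induction ks arbitrary: y e)
    case (Cons i ks)
    then show ?case using step[of ks y i e] by simp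
  qed simp
  have hp: "has_partial i (iter_partial ks J) y" if "length ks < n - 1" "y \<in> U" for i ks y
    using step[of ks y] pw[of ks] that by simp
  have C1: "class_C 1 U (\<lambda>z. iter_partial ks J z e)" if "length ks \<le> n - 1" for ks e
  proof -
    have "length ks + 1 \<le> n" using that n by simp
    show ?thesis
      by (rule class_C_cong[OF U _ smooth[OF \<open>length ks + 1 \<le> n\<close>, of e]]) (use pw[OF that, of _ e] in simp)
  qed
  have "iter_partial ks J \<in> U \<rightarrow> ops scaleE scaleF" if len: "length ks \<le> n - 1" for ks
  proof
    fix y assume y: "y \<in> U"
    have "iter_partial ks J y (scaleE c e) = scaleF c (iter_partial ks J y e)" for c e
    proof -
      have "iter_partial ks J y (scaleE c e) = iter_partial ks (\<lambda>z. scaleF c (J z e)) y"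
        unfolding pw[OF len y]
        by (rule iter_partial_cong[OF U _ y]) (use ops in \<open>auto simp: ops_def\<close>)
      also have "\<dots> = scaleF c (iter_partial ks J y e)"
        using class_C_linear(2)[OF U J[of e] banach_over.bounded_linear_scale[OF F, of c], of ks y] y len pw[OF len y]
        by simp
      finally show ?thesis .
    qed
    then show "iter_partial ks J y \<in> ops scaleE scaleF" by (simp add: ops_def)
  qed
  then show ?thesis
    unfolding class_sC_def class_C_def
    using hp pointwise_C1_continuous[OF U C1] class_sC1_pointwise[OF F U _ C1] by auto
qed

section \<open>Spaces of functions of class C^n\<close>

abbreviation const_on :: "'x set \<Rightarrow> 'e::zero \<Rightarrow> 'x \<Rightarrow> 'e"
  where "const_on U e \<equiv> \<lambda>x. if x \<in> U then e else 0"

text \<open>What the two kinds of spaces have in common.  The analysis of \<open>T\<close> rests on these closure properties; the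
  two kinds are distinguished only when the support map is shown to be defined everywhere.\<close>

definition function_space :: "nat \<Rightarrow> (real^'p) set \<Rightarrow> (real^'p \<Rightarrow> 'e::real_normed_vector) set \<Rightarrow> bool"
  where "function_space n U A \<longleftrightarrow> A \<subseteq> C_open n U \<and>
    (\<forall>f\<in>A. \<forall>g\<in>A. (\<lambda>x. f x + g x) \<in> A) \<and>
    (\<forall>\<phi>. \<forall>f\<in>A. class_C n UNIV \<phi> \<longrightarrow> (\<lambda>x. \<phi> x *\<^sub>R f x) \<in> A) \<and>
    (\<forall>f\<in>C_open n U. \<forall>K. compact K \<and> K \<subseteq> U \<and> (\<forall>x. x \<notin> K \<longrightarrow> f x = 0) \<longrightarrow> f \<in> A) \<and>
    (\<forall>e. (const_on U e) \<in> A)"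

lemma C_openI: "class_C n U f \<Longrightarrow> (\<And>x. x \<notin> U \<Longrightarrow> f x = 0) \<Longrightarrow> f \<in> C_open n U"
  by (simp add: C_open_def)

lemma C_open_const: "open U \<Longrightarrow> (const_on U e) \<in> C_open n U"
  by (rule C_openI, rule class_C_cong[OF _ _ class_C_const(1)[of U n e]]) auto

lemma C_open_scaleR:
  "open U \<Longrightarrow> class_C n U \<phi> \<Longrightarrow> f \<in> C_open n U \<Longrightarrow> (\<lambda>x. \<phi> x *\<^sub>R f x) \<in> C_open n U"
  by (auto simp: C_open_def intro: class_C_scaleR)

lemma function_space_C_open:
  fixes U :: "(real^'p) set"
  assumes U: "open U" shows "function_space n U (C_open n U :: (real^'p \<Rightarrow> 'e::real_normed_vector) set)"
  unfolding function_space_def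
proof (intro conjI ballI allI impI)
  show "(\<lambda>x. f x + g x) \<in> C_open n U" if "f \<in> C_open n U" "g \<in> C_open n U" for f g :: "real^'p \<Rightarrow> 'e"
    using that by (auto simp: C_open_def intro: class_C_add[OF U])
  show "(\<lambda>x. \<phi> x *\<^sub>R f x) \<in> C_open n U" if "f \<in> C_open n U" "class_C n UNIV \<phi>"
    for f :: "real^'p \<Rightarrow> 'e" and \<phi>
    by (rule C_open_scaleR[OF U class_C_subset[OF that(2)] that(1)]) simp
  show "(const_on U e) \<in> C_open n U" for e :: 'e by (rule C_open_const[OF U])
qed auto

text \<open>By the Leibniz rule, derivatives of a product extend to the closure if those of the factors do; for a
  compactly supported function the extension is by zero.\<close>

lemma function_space_C_closure:
  fixes U :: "(real^'p) set"
  assumes U: "open U" shows "function_space n U (C_closure n U :: (real^'p \<Rightarrow> 'e::real_normed_vector) set)"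
  unfolding function_space_def
proof (intro conjI ballI allI impI)
  show "(C_closure n U :: (real^'p \<Rightarrow> 'e) set) \<subseteq> C_open n U" by (auto simp: C_closure_def)
  show "(\<lambda>x. f x + g x) \<in> C_closure n U" if f: "f \<in> C_closure n U" and g: "g \<in> C_closure n U"
    for f g :: "real^'p \<Rightarrow> 'e"
  proof -
    have C: "class_C n U f" "class_C n U g" "(\<lambda>x. f x + g x) \<in> C_open n U"
      using f g class_C_add(1)[OF U] by (auto simp: C_closure_def C_open_def)
    moreover have "\<exists>h. continuous_on (closure U) h \<and> (\<forall>x\<in>U. h x = iter_partial ks (\<lambda>x. f x + g x) x)"
      if ks: "length ks \<le> n" for ks
    proof -
      obtain f' g' where "continuous_on (closure U) f'" "\<forall>x\<in>U. f' x = iter_partial ks f x"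
        "continuous_on (closure U) g'" "\<forall>x\<in>U. g' x = iter_partial ks g x"
        using f g ks unfolding C_closure_def by blast
      then show ?thesis
        using class_C_add(2)[OF U C(1,2) ks] by (intro exI[of _ "\<lambda>x. f' x + g' x"]) (auto intro: continuous_intros)
    qed
    ultimately show ?thesis by (simp add: C_closure_def)
  qed
  show "(\<lambda>x. \<phi> x *\<^sub>R f x) \<in> C_closure n U" if f: "f \<in> C_closure n U" and \<phi>: "class_C n UNIV \<phi>"
    for f :: "real^'p \<Rightarrow> 'e" and \<phi> :: "real^'p \<Rightarrow> real"
  proof -
    have C: "class_C n U f" "class_C n U \<phi>" "(\<lambda>x. \<phi> x *\<^sub>R f x) \<in> C_open n U"
      using f class_C_subset[OF \<phi>] C_open_scaleR[OF U] by (auto simp: C_closure_def C_open_def)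
    obtain f' where f': "\<And>bs. length bs \<le> n \<Longrightarrow> continuous_on (closure U) (f' bs)"
      "\<And>bs x. length bs \<le> n \<Longrightarrow> x \<in> U \<Longrightarrow> f' bs x = iter_partial bs f x"
      using f unfolding C_closure_def by simp metis
    have "\<exists>h. continuous_on (closure U) h \<and> (\<forall>x\<in>U. h x = iter_partial ks (\<lambda>x. \<phi> x *\<^sub>R f x) x)"
      if ks: "length ks \<le> n" for ks
    proof (intro exI conjI ballI)
      let ?h = "\<lambda>x. \<Sum>z\<leftarrow>splittings ks. iter_partial (fst z) \<phi> x *\<^sub>R f' (snd z) x"
      have len: "length (fst z) \<le> n" "length (snd z) \<le> n" if "z \<in> set (splittings ks)" for z
        using splittings_length[of "fst z" "snd z" ks] that ks by auto
      show "continuous_on (closure U) ?h"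
        by (intro continuous_on_sum_list continuous_on_scaleR f' len
            continuous_on_subset[OF class_C_continuous[OF \<phi>]]) auto
      show "?h x = iter_partial ks (\<lambda>x. \<phi> x *\<^sub>R f x) x" if "x \<in> U" for x
        unfolding iter_partial_scaleR[OF U C(2,1) ks that] case_prod_unfold
        by (rule arg_cong[where f = sum_list], rule map_cong[OF refl]) (use f'(2) len that in auto)
    qed
    then show ?thesis using C by (simp add: C_closure_def)
  qed
  show "f \<in> C_closure n U" if f: "f \<in> C_open n U" and K: "compact K \<and> K \<subseteq> U \<and> (\<forall>x. x \<notin> K \<longrightarrow> f x = 0)"
    for f :: "real^'p \<Rightarrow> 'e" and K
  proof -
    have "\<exists>h. continuous_on (closure U) h \<and> (\<forall>x\<in>U. h x = iter_partial ks f x)"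
      if ks: "length ks \<le> n" for ks
    proof (intro exI conjI ballI)
      let ?h = "iter_partial ks f"
      have op: "open (- K)" using K by (simp add: compact_imp_closed open_Compl)
      have "0 = iter_partial ks f x" if "x \<in> - K" for x
        by (rule sym, rule iter_partial_zero_outside[OF op _ that]) (use K in auto)
      then have "continuous_on (- K) ?h" by (rule continuous_on_eq[OF continuous_on_const])
      moreover have "continuous_on U ?h"
        using f ks by (auto simp: C_open_def intro: class_C_continuous)
      ultimately have "continuous_on (U \<union> - K) ?h"
        using op U by (intro continuous_on_open_Un) auto
      then show "continuous_on (closure U) ?h"
        by (rule continuous_on_subset) (use K in auto)
    qed simp
    then show ?thesis using f by (simp add: C_closure_def)
  qed
  show "(const_on U e) \<in> C_closure n U" for e :: 'e
  proof -
    have "iter_partial ks (const_on U e) x = (if ks = [] then e else 0)" if "x \<in> U" for ks x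
      using iter_partial_cong[OF U, of "const_on U e" "\<lambda>x. e" x ks]
        class_C_const(2)[OF U, of ks "length ks" x e] that by simp
    then show ?thesis
      using C_open_const[OF U]
      by (auto simp: C_closure_def intro!: exI[of _ "\<lambda>x. if _ = [] then e else 0"] continuous_intros)
  qed
qed

section \<open>The support map of a biseparating map\<close>

lemma local_cutoff:
  fixes a :: "real^'p"
  assumes "open W" "a \<in> W"
  obtains \<phi> :: "real^'p \<Rightarrow> real" and N where "class_C n UNIV \<phi>" "open N" "a \<in> N"
    "\<And>x. x \<in> N \<Longrightarrow> \<phi> x = 1" "\<And>x. x \<notin> W \<Longrightarrow> \<phi> x = 0"
proof -
  obtain r where r: "r > 0" "ball a r \<subseteq> W" using assms by (rule openE)
  obtain M where M: "\<And>(a::real^'p) s. s > 0 \<Longrightarrow> \<exists>\<phi>. is_cutoff n M a s \<phi>"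
    using cutoff[of n] by metis
  obtain \<phi> where \<phi>: "class_C n UNIV \<phi>" "\<And>x. norm (x - a) \<le> 1 / (2 / r) \<Longrightarrow> \<phi> x = (1::real)"
    "\<And>x. norm (x - a) \<ge> 2 / (2 / r) \<Longrightarrow> \<phi> x = 0"
    using M[of "2 / r" a] r(1) unfolding is_cutoff_def by auto
  show thesis
  proof (rule that[OF \<phi>(1) open_ball[of a "r / 2"]])
    show "\<phi> x = 1" if "x \<in> ball a (r / 2)" for x
      using that by (intro \<phi>(2)) (simp add: dist_norm norm_minus_commute)
    show "\<phi> x = 0" if "x \<notin> W" for x
    proof (rule \<phi>(3))
      have "x \<notin> ball a r" using that r(2) by blast
      then show "2 / (2 / r) \<le> norm (x - a)" using r(1) by (simp add: dist_norm norm_minus_commute)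
    qed
  qed (use r(1) in simp)
qed

text \<open>The hypotheses are symmetric in \<open>T\<close> and \<open>S\<close>, so that every statement below holds with the two sides
  exchanged.  Functions in \<open>A\<close> and \<open>B\<close> vanish outside \<open>U\<close> and \<open>V\<close>, which allows disjointness of cozero
  sets to be stated without reference to the domains.\<close>

locale biseparating_pair =
  fixes U :: "(real^'p) set" and V :: "(real^'q) set" and n m :: nat
    and A :: "(real^'p \<Rightarrow> 'e::banach) set" and B :: "(real^'q \<Rightarrow> 'f::banach) set"
    and T :: "(real^'p \<Rightarrow> 'e) \<Rightarrow> real^'q \<Rightarrow> 'f" and S :: "(real^'q \<Rightarrow> 'f) \<Rightarrow> real^'p \<Rightarrow> 'e"
  assumes U: "open U" "U \<noteq> {}" and V: "open V" "V \<noteq> {}"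
    and n: "n \<ge> 1" and m: "m \<ge> 1"
    and E: "\<exists>e::'e. e \<noteq> 0" and F: "\<exists>e::'f. e \<noteq> 0"
    and A: "function_space n U A" and B: "function_space m V B"
    and T_in: "\<And>f. f \<in> A \<Longrightarrow> T f \<in> B" and S_in: "\<And>g. g \<in> B \<Longrightarrow> S g \<in> A"
    and S_T: "\<And>f. f \<in> A \<Longrightarrow> S (T f) = f" and T_S: "\<And>g. g \<in> B \<Longrightarrow> T (S g) = g"
    and T_add: "\<And>f g. f \<in> A \<Longrightarrow> g \<in> A \<Longrightarrow> T (\<lambda>x. f x + g x) = (\<lambda>y. T f y + T g y)"
    and S_add: "\<And>f g. f \<in> B \<Longrightarrow> g \<in> B \<Longrightarrow> S (\<lambda>x. f x + g x) = (\<lambda>y. S f y + S g y)"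
    and T_scaleR: "\<And>f r. f \<in> A \<Longrightarrow> T (\<lambda>x. r *\<^sub>R f x) = (\<lambda>y. r *\<^sub>R T f y)"
    and S_scaleR: "\<And>f r. f \<in> B \<Longrightarrow> S (\<lambda>x. r *\<^sub>R f x) = (\<lambda>y. r *\<^sub>R S f y)"
    and T_separating: "\<And>f g y. f \<in> A \<Longrightarrow> g \<in> A \<Longrightarrow> (\<And>x. f x = 0 \<or> g x = 0) \<Longrightarrow> T f y = 0 \<or> T g y = 0"
    and S_separating: "\<And>f g y. f \<in> B \<Longrightarrow> g \<in> B \<Longrightarrow> (\<And>x. f x = 0 \<or> g x = 0) \<Longrightarrow> S f y = 0 \<or> S g y = 0"

lemma biseparating_pair_swap:
  "biseparating_pair U V n m A B T S \<Longrightarrow> biseparating_pair V U m n B A S T"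
  unfolding biseparating_pair_def by (elim conjE, intro conjI) assumption+

context biseparating_pair
begin

lemmas swap = biseparating_pair_swap[OF biseparating_pair_axioms]

lemmas space_A = A[unfolded function_space_def]

lemma A_add: "f \<in> A \<Longrightarrow> g \<in> A \<Longrightarrow> (\<lambda>x. f x + g x) \<in> A"
  by (rule space_A[THEN conjunct2, THEN conjunct1, rule_format])

lemma A_mult: "class_C n UNIV \<phi> \<Longrightarrow> f \<in> A \<Longrightarrow> (\<lambda>x. \<phi> x *\<^sub>R f x) \<in> A"
  by (rule space_A[THEN conjunct2, THEN conjunct2, THEN conjunct1, rule_format])

lemma A_C_open: "f \<in> A \<Longrightarrow> f \<in> C_open n U"
  by (rule subsetD[OF space_A[THEN conjunct1]])

lemma A_zero: "f \<in> A \<Longrightarrow> x \<notin> U \<Longrightarrow> f x = 0"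
  and A_class: "f \<in> A \<Longrightarrow> class_C n U f"
  using A_C_open[of f] by (simp_all add: C_open_def)

lemma A_compact:
  assumes "class_C n U f" "compact K" "K \<subseteq> U" "\<And>x. x \<notin> K \<Longrightarrow> f x = 0"
  shows "f \<in> A"
proof -
  have "f \<in> C_open n U" using assms by (auto simp: C_open_def)
  then show ?thesis
    by (rule space_A[THEN conjunct2, THEN conjunct2, THEN conjunct2, THEN conjunct1, rule_format]) (use assms in auto)
qed

lemma A_const: "(const_on U e) \<in> A"
  by (rule space_A[THEN conjunct2, THEN conjunct2, THEN conjunct2, THEN conjunct2, rule_format])

lemma A_scaleR: "f \<in> A \<Longrightarrow> (\<lambda>x. r *\<^sub>R f x) \<in> A"
  by (rule A_mult[OF class_C_const(1)[OF open_UNIV]])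

lemma A_diff: "f \<in> A \<Longrightarrow> g \<in> A \<Longrightarrow> (\<lambda>x. f x - g x) \<in> A"
  using A_add[OF _ A_scaleR[of g "- 1"], of f] by simp

lemma T_diff: "f \<in> A \<Longrightarrow> g \<in> A \<Longrightarrow> T (\<lambda>x. f x - g x) y = T f y - T g y"
  using T_add[OF _ A_scaleR[of g "- 1"], of f] T_scaleR[of g "- 1"] by (simp add: fun_eq_iff)

lemma A_0: "(\<lambda>x. 0) \<in> A"
proof -
  have "(\<lambda>x. 0) = (\<lambda>x. if x \<in> U then 0 else (0::'e))" by auto
  then show ?thesis using A_const[of 0] by simp
qed

lemma T_0: "T (\<lambda>x. 0) = (\<lambda>y. 0)"
  using T_scaleR[OF A_0, of 0] by simp

lemma T_class: "f \<in> A \<Longrightarrow> class_C m V (T f)"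
  by (rule biseparating_pair.A_class[OF swap T_in])

lemma T_isCont: "f \<in> A \<Longrightarrow> y \<in> V \<Longrightarrow> isCont (T f) y"
  using class_C_continuous_0[OF T_class] V(1) by (simp add: continuous_on_eq_continuous_at)

lemma T_nonzero:
  assumes "y \<in> V" obtains f where "f \<in> A" "T f y \<noteq> 0"
proof -
  interpret inv: biseparating_pair V U m n B A S T by (rule swap)
  obtain e :: 'f where e: "e \<noteq> 0" using F by blast
  show thesis
    using that[OF S_in[OF inv.A_const[of e]]] T_S[OF inv.A_const[of e]] assms e by simp
qed

text \<open>The value of \<open>T f\<close> at \<open>y\<close> depends only on the germ of \<open>f\<close> at \<open>x\<close>.\<close>

definition related :: "real^'p \<Rightarrow> real^'q \<Rightarrow> bool"
  where "related x y \<longleftrightarrow> x \<in> U \<and> y \<in> V \<and> (\<forall>f\<in>A. (\<forall>\<^sub>F x' in nhds x. f x' = 0) \<longrightarrow> T f y = 0)"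

lemma T_local:
  assumes "related x y" "f \<in> A" "g \<in> A" "\<forall>\<^sub>F x' in nhds x. f x' = g x'"
  shows "T f y = T g y"
proof -
  have "T (\<lambda>x. f x - g x) y = 0"
    using assms A_diff[OF assms(2,3)] unfolding related_def by simp
  then show ?thesis using T_diff[OF assms(2,3)] by simp
qed

lemma related_localize:
  assumes xy: "related x y" and W: "open W" "x \<in> W"
  obtains g where "g \<in> A" "T g y \<noteq> 0" "\<And>z. z \<notin> W \<Longrightarrow> g z = 0"
proof -
  obtain f where f: "f \<in> A" "T f y \<noteq> 0" using T_nonzero xy related_def by blast
  obtain \<phi> :: "real^'p \<Rightarrow> real" and N where \<phi>: "class_C n UNIV \<phi>" "open N" "x \<in> N"
    "\<And>x. x \<in> N \<Longrightarrow> \<phi> x = 1" "\<And>x. x \<notin> W \<Longrightarrow> \<phi> x = 0"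
    using local_cutoff[OF W] by blast
  have "\<forall>\<^sub>F z in nhds x. f z = \<phi> z *\<^sub>R f z"
    using eventually_nhds_in_open[OF \<phi>(2,3)] by eventually_elim (simp add: \<phi>(4))
  then have "T f y = T (\<lambda>z. \<phi> z *\<^sub>R f z) y"
    by (rule T_local[OF xy f(1) A_mult[OF \<phi>(1) f(1)]])
  then show thesis using that[OF A_mult[OF \<phi>(1) f(1)]] f(2) \<phi>(5) by simp
qed

lemma related_unique:
  assumes "related x y" "related x' y" shows "x = x'"
proof (rule ccontr)
  assume "x \<noteq> x'"
  from hausdorff[OF this] obtain W W' where
    W: "open W" "open W'" "x \<in> W" "x' \<in> W'" "W \<inter> W' = {}" by auto
  obtain g where g: "g \<in> A" "T g y \<noteq> 0" "\<And>z. z \<notin> W \<Longrightarrow> g z = 0"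
    using related_localize[OF assms(1) W(1,3)] by blast
  have "\<forall>\<^sub>F z in nhds x'. g z = 0"
    using eventually_nhds_in_open[OF W(2,4)] by eventually_elim (use g(3) W(5) in blast)
  then show False using assms(2) g unfolding related_def by blast
qed

text \<open>Suppose \<open>g\<close> vanishes near \<open>y\<close> but \<open>S g\<close> does not vanish at \<open>x\<close>.  Cut \<open>T f\<close>, for \<open>f\<close> supported where \<open>S g\<close>
  does not vanish, down to a function \<open>g'\<close> supported where \<open>g\<close> vanishes.  Then \<open>S g'\<close> is disjoint from
  \<open>S g\<close>, hence from \<open>f\<close>, so that \<open>g'\<close> would be disjoint from \<open>T f\<close>, although both equal \<open>T f y\<close> at \<open>y\<close>.\<close>

lemma related_swap:
  assumes xy: "related x y"
  shows "biseparating_pair.related V U B S y x"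
proof -
  interpret inv: biseparating_pair V U m n B A S T by (rule swap)
  have x: "x \<in> U" and y: "y \<in> V" using xy by (auto simp: related_def)
  have "S g x = 0" if g: "g \<in> B" and g0: "\<forall>\<^sub>F y' in nhds y. g y' = 0" for g
  proof (rule ccontr)
    assume nz: "S g x \<noteq> 0"
    obtain W where W: "open W" "y \<in> W" "\<And>y'. y' \<in> W \<Longrightarrow> g y' = 0"
      using g0 unfolding eventually_nhds by blast
    have "\<forall>\<^sub>F x' in nhds x. S g x' \<noteq> 0"
      using inv.T_isCont[OF g x] nz unfolding isCont_def
      by (auto simp: eventually_nhds_conv_at dest: tendsto_imp_eventually_ne)
    then obtain O' where O': "open O'" "x \<in> O'" "\<And>x'. x' \<in> O' \<Longrightarrow> S g x' \<noteq> 0"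
      unfolding eventually_nhds by blast
    obtain f where f: "f \<in> A" "T f y \<noteq> 0" "\<And>z. z \<notin> O' \<Longrightarrow> f z = 0"
      using related_localize[OF xy O'(1,2)] by blast
    obtain \<phi> :: "real^'q \<Rightarrow> real" and N where \<phi>: "class_C m UNIV \<phi>" "open N" "y \<in> N"
      "\<And>x. x \<in> N \<Longrightarrow> \<phi> x = 1" "\<And>x. x \<notin> W \<Longrightarrow> \<phi> x = 0"
      using local_cutoff[OF W(1,2)] by blast
    define g' where "g' = (\<lambda>y'. \<phi> y' *\<^sub>R T f y')"
    have g': "g' \<in> B" unfolding g'_def by (rule inv.A_mult[OF \<phi>(1) T_in[OF f(1)]])
    have "S g' z = 0 \<or> S g z = 0" for z
      by (rule S_separating[OF g' g]) (use W(3) \<phi>(5) g'_def in auto)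
    then have "S g' z = 0 \<or> f z = 0" for z using O'(3) f(3) by blast
    then have "T (S g') y = 0 \<or> T f y = 0"
      by (rule T_separating[OF S_in[OF g'] f(1)])
    moreover have "T (S g') y = T f y"
      unfolding T_S[OF g'] by (simp add: g'_def \<phi>(3,4))
    ultimately show False using f(2) by simp
  qed
  then show ?thesis using x y by (simp add: inv.related_def)
qed

text \<open>If no point of \<open>K\<close> is related to \<open>y\<close>, each has a neighbourhood such that functions supported in it are
  sent to functions vanishing at \<open>y\<close>.  Finitely many of these cover \<open>K\<close>; cutting them away one after
  the other does not change the value at \<open>y\<close> but ends with the zero function.\<close>

lemma related_exists:
  assumes K: "compact K" "K \<subseteq> U" and y: "y \<in> V"
    and f: "f \<in> A" "T f y \<noteq> 0" "\<And>x. x \<notin> K \<Longrightarrow> f x = 0"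
  obtains x where "x \<in> K" "related x y"
proof (rule ccontr)
  assume "\<not> thesis"
  then have nr: "\<not> related x y" if "x \<in> K" for x using that \<open>\<And>x. x \<in> K \<Longrightarrow> related x y \<Longrightarrow> thesis\<close> by blast
  have "\<exists>\<phi> N. class_C n UNIV \<phi> \<and> open N \<and> x \<in> N \<and> (\<forall>z\<in>N. \<phi> z = (1::real)) \<and>
      (\<forall>f\<in>A. T (\<lambda>z. \<phi> z *\<^sub>R f z) y = 0)" if x: "x \<in> K" for x
  proof -
    \<comment> \<open>A function supported where \<open>g\<close> vanishes is disjoint from \<open>g\<close>, and \<open>T g y \<noteq> 0\<close>.\<close>
    obtain g where g: "g \<in> A" "\<forall>\<^sub>F x' in nhds x. g x' = 0" "T g y \<noteq> 0"
      using nr[OF x] x K(2) y unfolding related_def by blast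
    then obtain W where W: "open W" "x \<in> W" "\<And>x'. x' \<in> W \<Longrightarrow> g x' = 0"
      unfolding eventually_nhds by blast
    obtain \<phi> :: "real^'p \<Rightarrow> real" and N where \<phi>: "class_C n UNIV \<phi>" "open N" "x \<in> N"
      "\<And>x. x \<in> N \<Longrightarrow> \<phi> x = 1" "\<And>x. x \<notin> W \<Longrightarrow> \<phi> x = 0"
      using local_cutoff[OF W(1,2)] by blast
    have "T g y = 0 \<or> T (\<lambda>z. \<phi> z *\<^sub>R f z) y = 0" if "f \<in> A" for f
      by (rule T_separating[OF g(1) A_mult[OF \<phi>(1) that]]) (use W(3) \<phi>(5) in auto)
    then show ?thesis using g(3) \<phi> by blast
  qed
  then have "\<forall>x\<in>K. \<exists>p. class_C n UNIV (fst p) \<and> open (snd p) \<and> x \<in> snd p \<and>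
      (\<forall>z\<in>snd p. fst p z = (1::real)) \<and> (\<forall>f\<in>A. T (\<lambda>z. fst p z *\<^sub>R f z) y = 0)"
    by simp
  from bchoice[OF this] obtain p where p: "\<forall>x\<in>K. class_C n UNIV (fst (p x)) \<and> open (snd (p x)) \<and>
      x \<in> snd (p x) \<and> (\<forall>z\<in>snd (p x). fst (p x) z = (1::real)) \<and> (\<forall>f\<in>A. T (\<lambda>z. fst (p x) z *\<^sub>R f z) y = 0)" ..
  define \<phi> N where "\<phi> = (\<lambda>x. fst (p x))" and "N = (\<lambda>x. snd (p x))"
  have \<phi>: "\<And>x. x \<in> K \<Longrightarrow> class_C n UNIV (\<phi> x)" "\<And>x. x \<in> K \<Longrightarrow> open (N x)"
    "\<And>x. x \<in> K \<Longrightarrow> x \<in> N x" "\<And>x z. x \<in> K \<Longrightarrow> z \<in> N x \<Longrightarrow> \<phi> x z = (1::real)"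
    "\<And>x f. x \<in> K \<Longrightarrow> f \<in> A \<Longrightarrow> T (\<lambda>z. \<phi> x z *\<^sub>R f z) y = 0"
    using p by (simp_all add: \<phi>_def N_def)
  obtain C where C: "C \<subseteq> K" "finite C" "K \<subseteq> (\<Union>x\<in>C. N x)"
    using compactE_image[OF K(1), of K N] \<phi>(2,3) by blast
  have "\<exists>g\<in>A. T g y \<noteq> 0 \<and> (\<forall>z. (f z = 0 \<or> (\<exists>x\<in>C. z \<in> N x)) \<longrightarrow> g z = 0)"
    using C(2,1)
  proof (induction C rule: finite_induct)
    case empty
    then show ?case using f by auto
  next
    case (insert c C)
    then obtain g where g: "g \<in> A" "T g y \<noteq> 0" "\<And>z. (f z = 0 \<or> (\<exists>x\<in>C. z \<in> N x)) \<Longrightarrow> g z = 0"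
      by auto
    have c: "c \<in> K" using insert by simp
    let ?g = "\<lambda>z. g z - \<phi> c z *\<^sub>R g z"
    have "?g \<in> A" by (intro A_diff A_mult g(1) \<phi>(1) c)
    moreover have "T ?g y \<noteq> 0"
      using T_diff[OF g(1) A_mult[OF \<phi>(1)[OF c] g(1)], of y] \<phi>(5)[OF c g(1)] g(2) by simp
    ultimately show ?case using g(3) \<phi>(4)[OF c] by (intro bexI[of _ ?g]) auto
  qed
  then obtain g where "g \<in> A" "T g y \<noteq> 0" "\<And>z. f z = 0 \<or> (\<exists>x\<in>C. z \<in> N x) \<Longrightarrow> g z = 0"
    by blast
  moreover from this have "g = (\<lambda>z. 0)" using f(3) C(3) by blast
  ultimately show False using T_0 by simp
qed

text \<open>The support map and its domain of definition.  That \<open>D\<close> is all of \<open>V\<close> is proved last: a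
  point of \<open>V\<close> might have its support on the boundary of \<open>U\<close> or at infinity.\<close>

definition D :: "(real^'q) set" where "D = {y. \<exists>x. related x y}"
definition h :: "real^'q \<Rightarrow> real^'p" where "h y = (THE x. related x y)"

lemma h_eq:
  assumes "related x y" shows "h y = x"
  unfolding h_def
proof (rule the_equality)
  show "related x y" by (rule assms)
  show "x' = x" if "related x' y" for x' using that assms by (rule related_unique)
qed

lemma related_h:
  assumes "y \<in> D" shows "related (h y) y"
proof -
  obtain x where x: "related x y" using assms by (auto simp: D_def)
  show ?thesis unfolding h_eq[OF x] by (rule x)
qed

lemma relatedD: "related x y \<Longrightarrow> y \<in> D"
  unfolding D_def by (rule CollectI, rule exI)

lemma relatedU: "related x y \<Longrightarrow> x \<in> U"
  by (simp add: related_def)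

lemma relatedV: "related x y \<Longrightarrow> y \<in> V"
  by (simp add: related_def)

lemma D_subset: "D \<subseteq> V"
  by (rule subsetI, rule relatedV, rule related_h)

lemma h_in: "y \<in> D \<Longrightarrow> h y \<in> U"
  by (rule relatedU, rule related_h)

lemma h_inverse:
  assumes "y \<in> D"
  shows "h y \<in> biseparating_pair.D V U B S" "biseparating_pair.h V U B S (h y) = y"
proof -
  interpret inv: biseparating_pair V U m n B A S T by (rule swap)
  have "inv.related y (h y)" by (rule related_swap[OF related_h[OF assms]])
  then show "h y \<in> inv.D" "inv.h (h y) = y" by (rule inv.relatedD, rule inv.h_eq)
qed

lemma inj_on_h: "inj_on h D"
  by (rule inj_on_inverseI[where g = "biseparating_pair.h V U B S"]) (rule h_inverse(2))

text \<open>The support of a point \<open>x\<close> at which \<open>S g\<close> does not vanish lies in the support of \<open>g\<close>, which can be chosen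
  small and compact.\<close>

lemma D_dense:
  assumes "open W" "y \<in> W" "y \<in> V" shows "W \<inter> D \<noteq> {}"
proof -
  interpret inv: biseparating_pair V U m n B A S T by (rule swap)
  have "open (W \<inter> V)" "y \<in> W \<inter> V" using assms V by auto
  then obtain r where r: "r > 0" "cball y r \<subseteq> W \<inter> V" using open_contains_cball by blast
  obtain \<phi> :: "real^'q \<Rightarrow> real" and N where \<phi>: "class_C m UNIV \<phi>" "open N" "y \<in> N"
    "\<And>x. x \<in> N \<Longrightarrow> \<phi> x = 1" "\<And>x. x \<notin> ball y r \<Longrightarrow> \<phi> x = 0"
    using local_cutoff[of "ball y r" y m] r(1) by auto
  obtain e :: 'f where e: "e \<noteq> 0" using F by blast
  define g where "g = (\<lambda>y'. \<phi> y' *\<^sub>R (if y' \<in> V then e else 0))"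
  have g: "g \<in> B" unfolding g_def by (rule inv.A_mult[OF \<phi>(1) inv.A_const])
  have "g y \<noteq> 0" using \<phi>(3,4) assms(3) e by (simp add: g_def)
  then have "S g \<noteq> (\<lambda>x. 0)" using T_S[OF g] T_0 by auto
  then obtain x where x: "S g x \<noteq> 0" by auto
  then have xU: "x \<in> U" using A_zero[OF S_in[OF g]] by blast
  have "\<And>y'. y' \<notin> cball y r \<Longrightarrow> g y' = 0" using \<phi>(5) by (simp add: g_def)
  then obtain y' where y': "y' \<in> cball y r" "inv.related y' x"
    using inv.related_exists[OF compact_cball _ xU g x] r(2) by blast
  then have "related x y'" using inv.related_swap by blast
  then have "y' \<in> D" by (rule relatedD)
  then show ?thesis using y'(1) r(2) by blast
qed

lemma eventually_T_nonzero:
  assumes "f \<in> A" "y \<in> V" "T f y \<noteq> 0"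
  shows "\<forall>\<^sub>F y' in nhds y. y' \<in> V \<and> T f y' \<noteq> 0"
proof -
  have "\<forall>\<^sub>F y' in nhds y. T f y' \<noteq> 0"
    using T_isCont[OF assms(1,2)] assms(3) unfolding isCont_def
    by (auto simp: eventually_nhds_conv_at dest: tendsto_imp_eventually_ne)
  then show ?thesis using eventually_nhds_in_open[OF V(1) assms(2)] by eventually_elim simp
qed

text \<open>A function \<open>g\<close> supported near \<open>h y\<close> with \<open>T g y \<noteq> 0\<close> also has \<open>T g y' \<noteq> 0\<close> for \<open>y'\<close> close to \<open>y\<close>, so that
  \<open>y'\<close> has a support point, and it lies in the support of \<open>g\<close>.  This gives openness of \<open>D\<close> and continuity
  of \<open>h\<close> at once.\<close>

lemma h_near:
  assumes y: "y \<in> D" and W: "open W" "h y \<in> W"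
  shows "\<forall>\<^sub>F y' in nhds y. y' \<in> D \<and> h y' \<in> W"
proof -
  have "open (W \<inter> U)" "h y \<in> W \<inter> U" using W U h_in[OF y] by auto
  then obtain r where r: "r > 0" "cball (h y) r \<subseteq> W \<inter> U" using open_contains_cball by blast
  obtain g where g: "g \<in> A" "T g y \<noteq> 0" "\<And>z. z \<notin> ball (h y) r \<Longrightarrow> g z = 0"
    using related_localize[OF related_h[OF y], of "ball (h y) r"] r(1) by auto
  have yV: "y \<in> V" using y D_subset by blast
  show ?thesis
    using eventually_T_nonzero[OF g(1) yV g(2)]
  proof eventually_elim
    case (elim y')
    then obtain x where x: "x \<in> cball (h y) r" "related x y'"
      using related_exists[OF compact_cball _ _ g(1), of "h y" r y'] r(2) g(3) by auto
    then show ?case using h_eq[OF x(2)] r(2) by (auto simp: D_def)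
  qed
qed

lemma open_D: "open D"
  unfolding open_subopen[of D]
proof
  fix y assume y: "y \<in> D"
  have "\<forall>\<^sub>F y' in nhds y. y' \<in> D \<and> h y' \<in> UNIV" by (rule h_near[OF y]) auto
  then show "\<exists>W. open W \<and> y \<in> W \<and> W \<subseteq> D" unfolding eventually_nhds by blast
qed

lemma isCont_h: "y \<in> D \<Longrightarrow> isCont h y"
  unfolding isCont_def tendsto_def eventually_at_filter
  by (intro allI impI) (rule eventually_mono[OF h_near], auto)

lemma continuous_on_h: "continuous_on D h"
  by (simp add: continuous_at_imp_continuous_on isCont_h)

lemma D_nonempty: "D \<noteq> {}"
  using D_dense[of UNIV] V(2) by auto

lemma related_limit:
  assumes y: "\<And>k. y k \<in> D" "y \<longlonglongrightarrow> y'" "y' \<in> V" and x: "(\<lambda>k. h (y k)) \<longlonglongrightarrow> x'" "x' \<in> U"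
  shows "related x' y'"
  unfolding related_def
proof (intro conjI ballI impI)
  fix f assume f: "f \<in> A" "\<forall>\<^sub>F x in nhds x'. f x = 0"
  then obtain W where W: "open W" "x' \<in> W" "\<And>x. x \<in> W \<Longrightarrow> f x = 0"
    unfolding eventually_nhds by blast
  have "\<forall>\<^sub>F k in sequentially. T f (y k) = 0"
    using topological_tendstoD[OF x(1) W(1,2)]
  proof eventually_elim
    case (elim k)
    then have "\<forall>\<^sub>F x in nhds (h (y k)). f x = 0"
      using W(1,3) unfolding eventually_nhds by blast
    then show ?case using related_h[OF y(1)[of k]] f(1) unfolding related_def by blast
  qed
  then have "(\<lambda>k. T f (y k)) \<longlonglongrightarrow> 0" by (rule tendsto_eventually)
  moreover have "(\<lambda>k. T f (y k)) \<longlonglongrightarrow> T f y'"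
    using isCont_tendsto_compose[OF T_isCont[OF f(1) y(3)] y(2)] .
  ultimately show "T f y' = 0" by (rule LIMSEQ_unique[symmetric])
qed (use y(3) x(2) in auto)

end

section \<open>The gliding hump\<close>

context biseparating_pair
begin

text \<open>The factor \<open>4\<close> makes the balls about \<open>h (y k)\<close> whose radius is half the distance to \<open>h y0\<close> pairwise
  disjoint.\<close>

lemma isolating_sequence:
  assumes y0: "y0 \<in> D" and N: "N \<subseteq> D" and lim: "y0 islimpt N" and R: "R > 0"
  obtains y where "\<And>k. y k \<in> N" "\<And>k. dist (y k) y0 < inverse (real (Suc k))"
    "\<And>k. 0 < dist (h (y k)) (h y0)" "\<And>k. dist (h (y k)) (h y0) < R"
    "\<And>j k. j < k \<Longrightarrow> dist (h (y k)) (h y0) < dist (h (y j)) (h y0) / 4"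
proof -
  have pick: "\<exists>y. y \<in> N \<and> dist y y0 < \<delta> \<and> 0 < dist (h y) (h y0) \<and> dist (h y) (h y0) < \<epsilon>"
    if "\<delta> > 0" "\<epsilon> > 0" for \<delta> \<epsilon>
  proof -
    have "h y0 \<in> ball (h y0) \<epsilon>" using that(2) by simp
    then have "\<forall>\<^sub>F y in nhds y0. y \<in> D \<and> h y \<in> ball (h y0) \<epsilon>"
      by (rule h_near[OF y0 open_ball])
    moreover have "\<forall>\<^sub>F y in nhds y0. y \<in> ball y0 \<delta>"
      by (rule eventually_nhds_in_open) (use that(1) in auto)
    ultimately have "\<forall>\<^sub>F y in nhds y0. h y \<in> ball (h y0) \<epsilon> \<and> y \<in> ball y0 \<delta>"
      by eventually_elim simp
    then obtain W where W: "open W" "y0 \<in> W" "\<And>y. y \<in> W \<Longrightarrow> h y \<in> ball (h y0) \<epsilon> \<and> y \<in> ball y0 \<delta>"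
      unfolding eventually_nhds by blast
    from lim W(1,2) obtain y where y: "y \<in> N" "y \<in> W" "y \<noteq> y0" by (auto elim: islimptE)
    have "h y \<noteq> h y0" using inj_on_h y(1,3) N y0 by (auto dest: inj_onD)
    then show ?thesis using y W(3)[OF y(2)] by (intro exI[of _ y]) (auto simp: dist_commute)
  qed
  define P where "P = (\<lambda>k y. y \<in> N \<and> dist y y0 < inverse (real (Suc k)) \<and>
    0 < dist (h y) (h y0) \<and> dist (h y) (h y0) < R)"
  have "\<exists>y. \<forall>k. P k (y k) \<and> dist (h (y (Suc k))) (h y0) < dist (h (y k)) (h y0) / 4"
  proof (rule dependent_nat_choice)
    show "\<exists>y. P 0 y" using pick[of 1 R] R unfolding P_def by auto
    fix y k assume "P k y"
    then have "min R (dist (h y) (h y0) / 4) > 0" using R by (simp add: P_def)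
    then show "\<exists>z. P (Suc k) z \<and> dist (h z) (h y0) < dist (h y) (h y0) / 4"
      using pick[of "inverse (real (Suc (Suc k)))" "min R (dist (h y) (h y0) / 4)"]
      unfolding P_def by auto
  qed
  then obtain y where y: "\<And>k. P k (y k)"
    "\<And>k. dist (h (y (Suc k))) (h y0) < dist (h (y k)) (h y0) / 4" by blast
  have "dist (h (y k)) (h y0) < dist (h (y j)) (h y0) / 4" if "j < k" for j k
    using that
  proof (induction k)
    case (Suc k)
    show ?case
    proof (cases "j = k")
      case False
      then have "dist (h (y k)) (h y0) < dist (h (y j)) (h y0) / 4" using Suc by simp
      moreover have "dist (h (y (Suc k))) (h y0) < dist (h (y k)) (h y0) / 4" by (rule y(2))
      ultimately show ?thesis using zero_le_dist[of "h (y k)" "h y0"] by linarith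
    qed (use y(2) in simp)
  qed simp
  then show thesis using that[of y] y(1) unfolding P_def by blast
qed

text \<open>Pick humps \<open>g k\<close> in disjoint balls about \<open>h (y k)\<close>, where \<open>y k\<close> tends to \<open>y0\<close>, such that a derivative of
  \<open>T (g k)\<close> exceeds \<open>k * 2 ^ k\<close> close to \<open>y k\<close>.  The sum \<open>\<Phi>\<close> of the functions \<open>2 ^ - k *\<^sub>R g k\<close> belongs to \<open>A\<close>, and
  by locality its image coincides with \<open>2 ^ - k *\<^sub>R T (g k)\<close> near \<open>y k\<close>.  So the derivative of \<open>T \<Phi>\<close> is unbounded
  near \<open>y0\<close>, although it is continuous there.\<close>

lemma gliding_hump:
  assumes ks: "length ks \<le> m" and y0: "y0 \<in> D" and N: "N \<subseteq> D" and lim: "y0 islimpt N"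
    and hump: "\<And>y W \<rho> M. y \<in> N \<Longrightarrow> open W \<Longrightarrow> y \<in> W \<Longrightarrow> \<rho> > 0 \<Longrightarrow>
      \<exists>g\<in>A. (\<forall>x. x \<notin> ball (h y) \<rho> \<longrightarrow> g x = 0) \<and>
        (\<forall>js. \<forall>x\<in>U. length js \<le> n \<longrightarrow> norm (iter_partial js g x) \<le> 1) \<and>
        (\<exists>w\<in>W. norm (iter_partial ks (T g) w) > (M::real))"
  shows False
proof -
  have y0V: "y0 \<in> V" using y0 D_subset by blast
  define x0 where "x0 = h y0"
  \<comment> \<open>All humps will be supported in the compact set \<open>cball x0 (2 * R)\<close>.\<close>
  obtain R where R: "R > 0" "cball x0 (2 * R) \<subseteq> U"
  proof -
    obtain r where "r > 0" "cball x0 r \<subseteq> U"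
      using U(1) h_in[OF y0] open_contains_cball unfolding x0_def by blast
    then show ?thesis using that[of "r / 2"] by simp
  qed
  obtain y where y: "\<And>k. y k \<in> N" "\<And>k. dist (y k) y0 < inverse (real (Suc k))"
    "\<And>k. 0 < dist (h (y k)) x0" "\<And>k. dist (h (y k)) x0 < R"
    "\<And>j k. j < k \<Longrightarrow> dist (h (y k)) x0 < dist (h (y j)) x0 / 4"
    using isolating_sequence[OF y0 N lim R(1)] unfolding x0_def by blast
  define \<beta> where "\<beta> = (\<lambda>k. ball (h (y k)) (dist (h (y k)) x0 / 2))"
  define W where "W = (\<lambda>k. (D \<inter> h -` \<beta> k) \<inter> ball (y k) (inverse (real (Suc k))))"
  have disj: "x \<notin> \<beta> k" if "x \<in> \<beta> j" "j \<noteq> k" for x j k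
  proof -
    have *: False if "j < k" "x \<in> \<beta> j" "x \<in> \<beta> k" for j k
    proof -
      have "dist (h (y j)) x < dist (h (y j)) x0 / 2" "dist (h (y k)) x < dist (h (y k)) x0 / 2"
        using that by (simp_all add: \<beta>_def)
      then show False
        using y(5)[OF that(1)] y(3)[of j] dist_triangle[of "h (y j)" x0 x] dist_triangle[of x x0 "h (y k)"]
          dist_commute[of x "h (y k)"] by linarith
    qed
    then show ?thesis using that by (metis linorder_neqE_nat)
  qed
  have yD: "y k \<in> D" for k using y(1) N by blast
  have openW: "open (W k)" for k
    unfolding W_def \<beta>_def
    by (intro open_Int continuous_open_preimage[OF continuous_on_h open_D] open_ball)
  have yW: "y k \<in> W k" for k using y(3)[of k] yD by (simp add: W_def \<beta>_def)
  have "\<exists>g. g \<in> A \<and> (\<forall>x. x \<notin> \<beta> k \<longrightarrow> g x = 0) \<and>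
      (\<forall>js. \<forall>x\<in>U. length js \<le> n \<longrightarrow> norm (iter_partial js g x) \<le> 1) \<and>
      (\<exists>w\<in>W k. norm (iter_partial ks (T g) w) > real k * 2 ^ k)" for k
    using hump[OF y(1)[of k] openW yW, of "dist (h (y k)) x0 / 2" "real k * 2 ^ k"] y(3)[of k]
    unfolding \<beta>_def by (simp add: Bex_def)
  then obtain g where "\<forall>k. g k \<in> A \<and> (\<forall>x. x \<notin> \<beta> k \<longrightarrow> g k x = 0) \<and>
      (\<forall>js. \<forall>x\<in>U. length js \<le> n \<longrightarrow> norm (iter_partial js (g k) x) \<le> 1) \<and>
      (\<exists>w\<in>W k. norm (iter_partial ks (T (g k)) w) > real k * 2 ^ k)"
    by metis
  then have g: "\<And>k. g k \<in> A" "\<And>k x. x \<notin> \<beta> k \<Longrightarrow> g k x = 0"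
    "\<And>k js x. x \<in> U \<Longrightarrow> length js \<le> n \<Longrightarrow> norm (iter_partial js (g k) x) \<le> 1"
    "\<And>k. \<exists>w\<in>W k. norm (iter_partial ks (T (g k)) w) > real k * 2 ^ k" by blast+
  define G where "G = (\<lambda>k x. (1/2::real) ^ k *\<^sub>R g k x)"
  define \<Phi> where "\<Phi> = (\<lambda>x. \<Sum>k. G k x)"
  have GA: "G k \<in> A" for k unfolding G_def by (rule A_scaleR[OF g(1)])
  have \<Phi>_on: "\<Phi> x = G k x" if "x \<in> \<beta> k" for x k
  proof -
    have "(\<lambda>j. G j x) sums (\<Sum>j\<in>{k}. G j x)"
      by (rule sums_finite) (use disj[OF that] g(2) in \<open>auto simp: G_def\<close>)
    then show ?thesis by (simp add: \<Phi>_def sums_iff)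
  qed
  have \<Phi>: "\<Phi> \<in> A"
  proof (rule A_compact[of _ "cball x0 (2 * R)"])
    show "class_C n U \<Phi>"
      unfolding \<Phi>_def
    proof (rule class_C_series[OF U(1)])
      show "class_C n U (G k)" for k by (rule A_class[OF GA])
      show "summable (\<lambda>k. (1/2::real) ^ k)" by (rule summable_geometric) simp
      show "norm (iter_partial js (G k) x) \<le> (1/2) ^ k" if "length js \<le> n" "x \<in> U" for k js x
        using class_C_linear(2)[OF U(1) A_class[OF g(1)] bounded_linear_scaleR_right[of "(1/2) ^ k"] that, of k]
          g(3)[OF that(2,1), of k] by (simp add: G_def)
    qed
    show "\<Phi> x = 0" if "x \<notin> cball x0 (2 * R)" for x
    proof -
      have "x \<notin> \<beta> k" for k
        using that y(4)[of k] R(1) dist_triangle[of x0 x "h (y k)"] by (auto simp: \<beta>_def dist_commute)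
      then show ?thesis using g(2) by (simp add: \<Phi>_def G_def)
    qed
  qed (use R in auto)
  have "\<exists>w\<in>W k. norm (iter_partial ks (T \<Phi>) w) > k" for k
  proof -
    obtain w where w: "w \<in> W k" "norm (iter_partial ks (T (g k)) w) > real k * 2 ^ k" using g(4) by blast
    then have wV: "w \<in> V" using D_subset by (auto simp: W_def)
    have "T \<Phi> z = (1/2) ^ k *\<^sub>R T (g k) z" if z: "z \<in> W k" for z
    proof -
      have zD: "z \<in> D" and hz: "h z \<in> \<beta> k" using z by (auto simp: W_def)
      have "\<forall>\<^sub>F x in nhds (h z). x \<in> \<beta> k"
        by (rule eventually_nhds_in_open) (use hz in \<open>auto simp: \<beta>_def\<close>)
      then have "\<forall>\<^sub>F x in nhds (h z). \<Phi> x = G k x" by eventually_elim (rule \<Phi>_on)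
      then have "T \<Phi> z = T (G k) z" by (rule T_local[OF related_h[OF zD] \<Phi> GA])
      then show ?thesis using T_scaleR[OF g(1)[of k], of "(1/2) ^ k"] by (simp add: G_def)
    qed
    then have "iter_partial ks (T \<Phi>) w = iter_partial ks (\<lambda>z. (1/2) ^ k *\<^sub>R T (g k) z) w"
      by (rule iter_partial_cong[OF openW _ w(1)])
    also have "\<dots> = (1/2) ^ k *\<^sub>R iter_partial ks (T (g k)) w"
      by (rule class_C_linear(2)[OF V(1) T_class[OF g(1)] bounded_linear_scaleR_right ks wV])
    finally have "norm (iter_partial ks (T \<Phi>) w) = (1/2) ^ k * norm (iter_partial ks (T (g k)) w)" by simp
    also have "\<dots> > (1/2) ^ k * (real k * 2 ^ k)" by (rule mult_strict_left_mono[OF w(2)]) simp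
    also have "(1/2) ^ k * (real k * 2 ^ k) = real k" by (simp add: power_divide)
    finally show ?thesis using w(1) by blast
  qed
  then obtain w where w: "\<And>k. w k \<in> W k" "\<And>k. norm (iter_partial ks (T \<Phi>) (w k)) > real k" by metis
  have "w \<longlonglongrightarrow> y0"
  proof (rule metric_tendsto_imp_tendsto)
    have "(\<lambda>k. 2 * inverse (real (Suc k))) \<longlonglongrightarrow> 2 * 0"
      by (intro tendsto_mult tendsto_const LIMSEQ_inverse_real_of_nat)
    then show "(\<lambda>k. 2 * inverse (real (Suc k))) \<longlonglongrightarrow> 0" by simp
    show "\<forall>\<^sub>F k in sequentially. dist (w k) y0 \<le> dist (2 * inverse (real (Suc k))) 0"
    proof (intro always_eventually allI)
      fix k
      have "dist (y k) (w k) < inverse (real (Suc k))" using w(1)[of k] by (simp add: W_def)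
      then show "dist (w k) y0 \<le> dist (2 * inverse (real (Suc k))) 0"
        using y(2)[of k] dist_triangle[of "w k" y0 "y k"] by (simp add: dist_commute)
    qed
  qed
  moreover have "isCont (iter_partial ks (T \<Phi>)) y0"
    using class_C_continuous[OF T_class[OF \<Phi>] ks] V(1) y0V by (simp add: continuous_on_eq_continuous_at)
  ultimately have "(\<lambda>k. iter_partial ks (T \<Phi>) (w k)) \<longlonglongrightarrow> iter_partial ks (T \<Phi>) y0"
    by (rule isCont_tendsto_compose[rotated])
  then have "Bseq (\<lambda>k. iter_partial ks (T \<Phi>) (w k))"
    by (intro convergent_imp_Bseq) (auto simp: convergent_def)
  then obtain K where K: "\<And>k. norm (iter_partial ks (T \<Phi>) (w k)) \<le> K" unfolding Bseq_def by blast
  obtain k :: nat where "real k > K" using reals_Archimedean2 by blast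
  then show False using K[of k] w(2)[of k] by simp
qed

section \<open>Continuity of the operators\<close>

text \<open>The weight of the composition operator, before it is known to be continuous.\<close>

definition J0 :: "real^'q \<Rightarrow> 'e \<Rightarrow> 'f" where "J0 y e = T (const_on U e) y"

lemma J0_add: "J0 y (e + e') = J0 y e + J0 y e'"
proof -
  have "(\<lambda>x. if x \<in> U then e + e' else 0) = (\<lambda>x. (if x \<in> U then e else 0) + (if x \<in> U then e' else 0))"
    by auto
  then show ?thesis by (simp add: J0_def T_add[OF A_const A_const])
qed

lemma J0_scaleR: "J0 y (r *\<^sub>R e) = r *\<^sub>R J0 y e"
proof -
  have "(\<lambda>x. if x \<in> U then r *\<^sub>R e else 0) = (\<lambda>x. r *\<^sub>R (if x \<in> U then e else 0))"
    by auto
  then show ?thesis by (simp add: J0_def T_scaleR[OF A_const])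
qed

lemma isCont_J0: "y \<in> V \<Longrightarrow> isCont (\<lambda>y. J0 y e) y"
  unfolding J0_def by (rule T_isCont[OF A_const])

text \<open>At points where \<open>J0 y\<close> is unbounded, multiples of a cutoff by tiny vectors \<open>e\<close> with large \<open>J0 y e\<close>
  serve as humps; no derivative of the image is needed.\<close>

lemma J0_unbounded_isolated:
  assumes y0: "y0 \<in> D"
  shows "\<not> y0 islimpt {y \<in> D. \<not> bounded_linear (J0 y)}"
proof
  assume lim: "y0 islimpt {y \<in> D. \<not> bounded_linear (J0 y)}"
  show False
  proof (rule gliding_hump[OF _ y0 _ lim, of "[]"])
    fix y :: "real^'q" and W and \<rho> M :: real
    assume y: "y \<in> {y \<in> D. \<not> bounded_linear (J0 y)}" and W: "y \<in> W" and \<rho>: "\<rho> > 0"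
    have yD: "y \<in> D" using y by simp
    define x where "x = h y"
    obtain \<kappa> where \<kappa>: "\<kappa> > 0" "\<And>(a::real^'p) s. s > 0 \<Longrightarrow> \<exists>\<phi>. is_cutoff n \<kappa> a s \<phi>"
      using cutoff[of n] by metis
    define s where "s = max 1 (2 / \<rho>)"
    have s: "s \<ge> 1" "2 / s \<le> \<rho>" using \<rho> by (auto simp: s_def field_simps max_def)
    then have s0: "s > 0" by simp
    from \<kappa>(2)[OF s0, of x] obtain \<phi> where \<phi>: "class_C n UNIV \<phi>" "\<And>z. norm (z - x) \<le> 1 / s \<Longrightarrow> \<phi> z = (1::real)"
      "\<And>z. norm (z - x) \<ge> 2 / s \<Longrightarrow> \<phi> z = 0"
      "\<And>ks z. length ks \<le> n \<Longrightarrow> norm (iter_partial ks \<phi> z) \<le> \<kappa> * s ^ length ks"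
        unfolding is_cutoff_def by auto
    define C where "C = 2 ^ n * \<kappa> * s ^ n"
    have C: "C > 0" using \<kappa>(1) s0 by (simp add: C_def)
    have "\<exists>e. norm (J0 y e) > norm e * (C * \<bar>M\<bar>)"
    proof (rule ccontr)
      assume "\<not> ?thesis"
      then have "bounded_linear (J0 y)"
        by (intro bounded_linear_intro[of _ "C * \<bar>M\<bar>"]) (auto simp: J0_add J0_scaleR not_less)
      then show False using y by simp
    qed
    then obtain e0 where e0: "norm (J0 y e0) > norm e0 * (C * \<bar>M\<bar>)" by blast
    have "e0 \<noteq> 0" using e0 J0_scaleR[of y 0 0] by auto
    define e where "e = (1 / (C * norm e0)) *\<^sub>R e0"
    have e: "C * norm e = 1" using C \<open>e0 \<noteq> 0\<close> by (simp add: e_def)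
    have big: "norm (J0 y e) > M"
    proof -
      have "norm (J0 y e) = norm (J0 y e0) / (C * norm e0)"
        using C by (simp add: e_def J0_scaleR)
      also have "\<dots> > \<bar>M\<bar>" using e0 C \<open>e0 \<noteq> 0\<close> by (simp add: field_simps)
      finally show ?thesis by linarith
    qed
    define g where "g = (\<lambda>z. \<phi> z *\<^sub>R (if z \<in> U then e else 0))"
    have g: "g \<in> A" unfolding g_def by (rule A_mult[OF \<phi>(1) A_const])
    have "norm (iter_partial js g z) \<le> 1" if js: "length js \<le> n" and z: "z \<in> U" for js z
    proof -
      have "iter_partial js g z = iter_partial js (\<lambda>z. \<phi> z *\<^sub>R e) z"
        by (rule iter_partial_cong[OF U(1) _ z]) (simp add: g_def)
      also have "norm \<dots> \<le> 2 ^ length js * (\<kappa> * norm e) * s ^ length js"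
      proof (rule Leibniz_bound[OF U(1) class_C_subset[OF \<phi>(1)] class_C_const(1)[OF U(1)] z])
        show "norm (iter_partial ks (\<lambda>x. e) z) \<le> norm e * s ^ length ks" if "length ks \<le> n" for ks
          using class_C_const(2)[OF U(1) that z, of e] s0 by simp
      qed (use \<kappa>(1) s0 \<phi>(4) js in auto)
      also have "\<dots> \<le> 2 ^ n * (\<kappa> * norm e) * s ^ n"
        using s js \<kappa>(1) by (intro mult_mono power_increasing) auto
      also have "\<dots> = 1" using e by (simp add: C_def mult_ac)
      finally show ?thesis .
    qed
    moreover have "g z = 0" if "z \<notin> ball (h y) \<rho>" for z
    proof -
      have "norm (z - x) \<ge> 2 / s" using that s(2) by (simp add: x_def dist_norm norm_minus_commute)
      then show ?thesis by (simp add: g_def \<phi>(3))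
    qed
    moreover have "T g y = J0 y e"
      unfolding J0_def
    proof (rule T_local[OF related_h[OF yD] g A_const])
      have "\<forall>\<^sub>F z in nhds (h y). z \<in> ball (h y) (1 / s)"
        by (rule eventually_nhds_in_open) (use s0 in auto)
      then show "\<forall>\<^sub>F z in nhds (h y). g z = (if z \<in> U then e else 0)"
        by eventually_elim (use \<phi>(2) in \<open>auto simp: g_def x_def dist_norm norm_minus_commute\<close>)
    qed
    ultimately show "\<exists>g\<in>A. (\<forall>x. x \<notin> ball (h y) \<rho> \<longrightarrow> g x = 0) \<and>
        (\<forall>js. \<forall>x\<in>U. length js \<le> n \<longrightarrow> norm (iter_partial js g x) \<le> 1) \<and>
        (\<exists>w\<in>W. norm (iter_partial [] (T g) w) > M)"
      using g W big by (intro bexI[of _ g] conjI bexI[of _ y]) auto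
  qed auto
qed

text \<open>Since unboundedness happens at isolated points only and \<open>D\<close> has no isolated points, \<open>J0 y0\<close> is a
  pointwise limit of continuous operators.\<close>

lemma bounded_linear_J0:
  assumes y0: "y0 \<in> D" shows "bounded_linear (J0 y0)"
proof -
  obtain W where W: "open W" "y0 \<in> W" "\<And>y. y \<in> W \<Longrightarrow> y \<in> D \<Longrightarrow> y \<noteq> y0 \<Longrightarrow> bounded_linear (J0 y)"
    using J0_unbounded_isolated[OF y0] unfolding islimpt_def by blast
  have "open (W \<inter> D)" "y0 \<in> W \<inter> D" using W y0 open_D by auto
  then obtain \<delta> where \<delta>: "\<delta> > 0" "ball y0 \<delta> \<subseteq> W \<inter> D" by (rule openE)
  define y where "y = (\<lambda>k. y0 + (\<delta> / 2 * inverse (real (Suc k))) *\<^sub>R axis undefined (1::real))"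
  have y_bd: "bounded_linear (J0 (y k))" for k
  proof -
    have "inverse (real (Suc k)) \<le> 1" by (simp add: field_simps)
    then have "\<delta> / 2 * inverse (real (Suc k)) \<le> \<delta> / 2 * 1" by (rule mult_left_mono) (use \<delta> in simp)
    then have "\<delta> / 2 * inverse (real (Suc k)) < \<delta>" using \<delta>(1) by simp
    then have "y k \<in> ball y0 \<delta>" using \<delta>(1) by (simp add: y_def dist_norm)
    moreover have "y k \<noteq> y0" using \<delta>(1) by (simp add: y_def axis_eq_0_iff)
    ultimately show ?thesis using W(3) \<delta>(2) by blast
  qed
  have "(\<lambda>k. \<delta> / 2 * inverse (real (Suc k))) \<longlonglongrightarrow> \<delta> / 2 * 0"
    by (intro tendsto_mult tendsto_const LIMSEQ_inverse_real_of_nat)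
  then have "y \<longlonglongrightarrow> y0 + (\<delta> / 2 * 0) *\<^sub>R axis undefined 1"
    unfolding y_def by (intro tendsto_add tendsto_const tendsto_scaleR)
  then have "y \<longlonglongrightarrow> y0" by simp
  then have "(\<lambda>k. blinfun_apply (Blinfun (J0 (y k))) e) \<longlonglongrightarrow> J0 y0 e" for e
    using isCont_tendsto_compose[OF isCont_J0[of y0 e], of y] y0 D_subset
    by (auto simp: bounded_linear_Blinfun_apply[OF y_bd])
  then show ?thesis by (rule bounded_linear_limit)
qed

lemma J0_tendsto_zero:
  assumes y: "\<And>k. y k \<in> D" "y \<longlonglongrightarrow> y0" "y0 \<in> D" and e: "e \<longlonglongrightarrow> 0"
  shows "(\<lambda>k. J0 (y k) (e k)) \<longlonglongrightarrow> 0"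
proof -
  have y0V: "y0 \<in> V" using y(3) D_subset by blast
  have app: "blinfun_apply (Blinfun (J0 (y k))) = J0 (y k)" for k
    by (rule bounded_linear_Blinfun_apply[OF bounded_linear_J0[OF y(1)]])
  have "\<exists>M. \<forall>k\<in>UNIV. norm (blinfun_apply (Blinfun (J0 (y k))) e) \<le> M" for e
  proof -
    have "(\<lambda>k. J0 (y k) e) \<longlonglongrightarrow> J0 y0 e"
      by (rule isCont_tendsto_compose[OF isCont_J0[OF y0V] y(2)])
    then have "Bseq (\<lambda>k. J0 (y k) e)" by (intro convergent_imp_Bseq) (auto simp: convergent_def)
    then show ?thesis unfolding Bseq_def app by blast
  qed
  then have "\<exists>M. \<forall>k\<in>UNIV. norm (Blinfun (J0 (y k))) \<le> M" by (rule uniform_boundedness)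
  then obtain M where M: "\<And>k. norm (Blinfun (J0 (y k))) \<le> M" by blast
  show ?thesis
  proof (rule Lim_null_comparison)
    show "\<forall>\<^sub>F k in sequentially. norm (J0 (y k) (e k)) \<le> M * norm (e k)"
    proof (intro always_eventually allI)
      fix k
      have "norm (J0 (y k) (e k)) \<le> norm (Blinfun (J0 (y k))) * norm (e k)"
        using norm_blinfun[of "Blinfun (J0 (y k))" "e k"] by (simp add: app)
      also have "\<dots> \<le> M * norm (e k)" by (rule mult_right_mono[OF M]) simp
      finally show "norm (J0 (y k) (e k)) \<le> M * norm (e k)" .
    qed
    show "(\<lambda>k. M * norm (e k)) \<longlonglongrightarrow> 0"
      using tendsto_mult[OF tendsto_const[of M] tendsto_norm[OF e]] by simp
  qed
qed

section \<open>The order of a biseparating map\<close>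

text \<open>The bump has width \<open>1 / s\<close>, and each derivative costs a factor \<open>s\<close>.  For \<open>r = 1\<close> the function is of size
  \<open>1 / s\<close> on the support of the bump, which saves one factor.\<close>

lemma localized_bump:
  assumes f: "f \<in> A" and x: "x \<in> U" and r: "r = 0 \<or> r = 1 \<and> f x = 0"
  obtains C s0 where "C > 0" "s0 > 0"
    "\<And>s. s \<ge> s0 \<Longrightarrow> \<exists>g\<in>A. (\<forall>z. norm (z - x) \<le> 1 / s \<longrightarrow> g z = f z) \<and>
      (\<forall>z. norm (z - x) \<ge> 2 / s \<longrightarrow> g z = 0) \<and>
      (\<forall>js. \<forall>z\<in>U. length js \<le> n \<longrightarrow> norm (iter_partial js g z) \<le> C * s ^ (n - r))"
proof -
  have fC: "class_C n U f" by (rule A_class[OF f])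
  obtain R where R: "R > 0" "cball x R \<subseteq> U" using U(1) x open_contains_cball by blast
  obtain K where K: "K > 0" "\<And>ks z. length ks \<le> n \<Longrightarrow> z \<in> cball x R \<Longrightarrow> norm (iter_partial ks f z) \<le> K"
    using class_C_bounded_on_compact[OF fC compact_cball R(2)] by blast
  have lip: "norm (f z - f x) \<le> real CARD('p) * K * norm (z - x)" if "z \<in> cball x R" for z
  proof (rule norm_increment_le)
    fix i w assume "w \<in> cball x (norm (z - x))"
    then have w: "w \<in> cball x R" using that by (auto simp: dist_norm norm_minus_commute)
    then have wU: "w \<in> U" using R(2) by blast
    show "has_pd i f (iter_partial [i] f w) w"
      using class_C_has_pd[OF fC _ wU, of "[]" i] n by simp
    show "norm (iter_partial [i] f w) \<le> K" using K(2)[OF _ w, of "[i]"] n by simp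
  qed
  obtain \<kappa> where \<kappa>: "\<kappa> > 0" "\<And>(a::real^'p) s. s > 0 \<Longrightarrow> \<exists>\<phi>. is_cutoff n \<kappa> a s \<phi>"
    using cutoff[of n] by metis
  define K' where "K' = 2 * real CARD('p) * K + K"
  have K': "K' > 0" "K \<le> K'" using K(1) by (auto simp: K'_def add_nonneg_pos)
  define C where "C = 2 ^ n * (\<kappa> * K')"
  have C: "C > 0" using \<kappa>(1) K'(1) by (simp add: C_def)
  show thesis
  proof (rule that[OF C])
    show "max 1 (2 / R) > 0" by simp
    fix s assume "s \<ge> max 1 (2 / R)"
    then have s: "s \<ge> 1" "2 / s \<le> R" using R(1) by (auto simp: field_simps)
    then have s0: "s > 0" by simp
    from \<kappa>(2)[OF s0, of x] obtain \<phi> where \<phi>: "class_C n UNIV \<phi>" "\<And>z. norm (z - x) \<le> 1 / s \<Longrightarrow> \<phi> z = (1::real)"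
      "\<And>z. norm (z - x) \<ge> 2 / s \<Longrightarrow> \<phi> z = 0"
      "\<And>ks z. length ks \<le> n \<Longrightarrow> norm (iter_partial ks \<phi> z) \<le> \<kappa> * s ^ length ks"
        unfolding is_cutoff_def by auto
    define g where "g = (\<lambda>z. \<phi> z *\<^sub>R f z)"
    have "norm (iter_partial js g z) \<le> C * s ^ (n - r)" if js: "length js \<le> n" and z: "z \<in> U" for js z
    proof (cases "norm (z - x) \<le> 2 / s")
      case False
      have "iter_partial js g z = 0"
        by (rule iter_partial_zero_outside[of "- cball x (2 / s)"])
           (use False \<phi>(3) in \<open>auto simp: g_def dist_norm norm_minus_commute\<close>)
      then show ?thesis using C s0 by simp
    next
      case True
      have zR: "z \<in> cball x R" using True s(2) by (simp add: dist_norm norm_minus_commute)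
      have fz: "norm (iter_partial ks f z) \<le> (K' / s ^ r) * s ^ length ks" if ks: "length ks \<le> n" for ks
      proof -
        have le1: "1 \<le> s ^ k" for k using s(1) by (rule one_le_power)
        \<comment> \<open>For \<open>r = 1\<close> the gain comes from the Lipschitz estimate for \<open>f\<close> itself; for its derivatives \<open>s ^ length ks\<close>
          has a factor \<open>s\<close> to spare.\<close>
        consider "r = 0" | "r = 1" "ks = []" | "r = 1" "ks \<noteq> []" using r by auto
        then show ?thesis
        proof cases
          case 1
          have "K \<le> K' * s ^ length ks"
            using mult_mono[OF K'(2) le1[of "length ks"]] K' K(1) by simp
          then show ?thesis using K(2)[OF ks zR] 1 by simp
        next
          case 2
          have "norm (f z) \<le> real CARD('p) * K * norm (z - x)" using lip[OF zR] r 2 by simp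
          also have "\<dots> \<le> real CARD('p) * K * (2 / s)"
            by (rule mult_left_mono[OF True]) (use K(1) in simp)
          also have "\<dots> \<le> K' / s" using s0 K(1) by (simp add: K'_def field_simps)
          finally show ?thesis using 2 by simp
        next
          case 3
          then obtain l where l: "length ks = Suc l" by (cases ks) auto
          have "K \<le> K' * s ^ l" using mult_mono[OF K'(2) le1[of l]] K' K(1) by simp
          then show ?thesis using K(2)[OF ks zR] 3 l s0 by simp
        qed
      qed
      have "norm (iter_partial js g z) \<le> 2 ^ length js * (\<kappa> * (K' / s ^ r)) * s ^ length js"
        unfolding g_def
        by (rule Leibniz_bound[OF U(1) class_C_subset[OF \<phi>(1)] fC z]) (use \<kappa>(1) s0 \<phi>(4) js fz in auto)
      also have "\<dots> \<le> 2 ^ n * (\<kappa> * (K' / s ^ r)) * s ^ n"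
        using s js \<kappa>(1) K'(1) by (intro mult_mono power_increasing) auto
      also have "\<dots> = C * (s ^ n / s ^ r)" by (simp add: C_def)
      also have "s ^ n / s ^ r = s ^ (n - r)" using r n s0 by (intro power_diff[symmetric]) auto
      finally show ?thesis .
    qed
    moreover have "g \<in> A" unfolding g_def by (rule A_mult[OF \<phi>(1) f])
    ultimately show "\<exists>g\<in>A. (\<forall>z. norm (z - x) \<le> 1 / s \<longrightarrow> g z = f z) \<and>
      (\<forall>z. norm (z - x) \<ge> 2 / s \<longrightarrow> g z = 0) \<and>
      (\<forall>js. \<forall>z\<in>U. length js \<le> n \<longrightarrow> norm (iter_partial js g z) \<le> C * s ^ (n - r))"
      using \<phi>(2,3) by (intro bexI[of _ g]) (auto simp: g_def)
  qed
qed

text \<open>Assume \<open>m > d\<close> with \<open>d = n - r\<close>, and move from \<open>y\<close> along a fixed axis by \<open>t\<close>; let \<open>\<Delta> y t\<close> be the distance by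
  which \<open>h\<close> moves.  A bump about \<open>h y\<close> whose support has a radius smaller than \<open>\<Delta> y t\<close> has derivatives of
  size \<open>\<Delta> y t ^ - d\<close>, and its image falls from \<open>T f y\<close> to zero over the distance \<open>t\<close>, so that it has an \<open>m\<close>-th
  derivative of size \<open>\<bar>t\<bar> ^ - m\<close>.  At a point of \<open>Bad\<close> the quotient \<open>\<Delta> y t ^ d / \<bar>t\<bar> ^ m\<close> is unbounded as \<open>t\<close>
  tends to \<open>0\<close>, which makes these bumps humps; so \<open>Bad\<close> has no limit points in \<open>D\<close>.  At any other
  point \<open>\<Delta> y t ^ d\<close> is at most a multiple of \<open>\<bar>t\<bar> ^ (d + 1)\<close>, and \<open>h\<close> has derivative zero along the axis.  A
  continuous function with zero derivative off a finite set is constant, but \<open>h\<close> is injective.\<close>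

lemma order_estimate:
  assumes r: "r = 0 \<or> r = 1" and y0: "y0 \<in> D" and W: "open W" "y0 \<in> W" "W \<subseteq> D"
    and F: "\<And>y. y \<in> W \<Longrightarrow> \<exists>f\<in>A. T f y \<noteq> 0 \<and> (r = 1 \<longrightarrow> f (h y) = 0)"
  shows "m + r \<le> n"
proof (rule ccontr)
  assume "\<not> m + r \<le> n"
  define d where "d = n - r"
  have md: "Suc d \<le> m" using \<open>\<not> m + r \<le> n\<close> r n by (auto simp: d_def)
  obtain i :: 'q where True by simp
  define L where "L = (\<lambda>y t. y + t *\<^sub>R axis i (1::real))"
  have L0: "L y 0 = y" for y by (simp add: L_def)
  have Lcont: "isCont (L y) t" for y t unfolding L_def by (intro continuous_intros)
  define \<Delta> where "\<Delta> = (\<lambda>y t. norm (h (L y t) - h y))"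
  define Bad where "Bad = {y \<in> W. \<forall>M. \<forall>\<eta>>0. \<exists>t. 0 < \<bar>t\<bar> \<and> \<bar>t\<bar> < \<eta> \<and> \<Delta> y t \<noteq> 0 \<and> \<Delta> y t ^ d > M * \<bar>t\<bar> ^ m}"
  have near: "\<forall>\<^sub>F t in nhds 0. L y t \<in> W' \<and> \<Delta> y t < \<epsilon>" if "y \<in> D" "open W'" "y \<in> W'" "\<epsilon> > 0" for y W' \<epsilon>
  proof -
    have "isCont h (L y 0)" using isCont_h[OF that(1)] by (simp add: L0)
    then have "isCont (\<Delta> y) 0"
      unfolding \<Delta>_def by (intro continuous_intros isCont_o2[OF Lcont])
    then have "((\<lambda>t. \<Delta> y t) \<longlongrightarrow> \<Delta> y 0) (nhds 0)"
      using tendsto_at_iff_tendsto_nhds[of "\<Delta> y" 0] by (simp add: isCont_def)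
    then have "((\<lambda>t. \<Delta> y t) \<longlongrightarrow> 0) (nhds 0)" by (simp add: \<Delta>_def L0)
    then have "\<forall>\<^sub>F t in nhds 0. \<Delta> y t < \<epsilon>"
      by (rule order_tendstoD(2)) (rule that(4))
    moreover have "\<forall>\<^sub>F t in nhds 0. t \<in> {t. L y t \<in> W'}"
      by (rule eventually_nhds_in_open) (use open_axis_line[OF that(2), of y i] that(3) in \<open>auto simp: L_def\<close>)
    ultimately show ?thesis by eventually_elim simp
  qed
  have not_limit: "\<not> y1 islimpt Bad" if y1: "y1 \<in> D" for y1
  proof
    assume lim: "y1 islimpt Bad"
    have BadD: "Bad \<subseteq> D" using W(3) by (auto simp: Bad_def)
    show False
    proof (rule gliding_hump[OF _ y1 BadD lim, of "replicate m i"])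
      fix y :: "real^'q" and W' and \<rho> M :: real
      assume y: "y \<in> Bad" and W': "open W'" "y \<in> W'" and \<rho>: "\<rho> > 0"
      have yD: "y \<in> D" using y BadD by blast
      have yW: "y \<in> W" using y by (simp add: Bad_def)
      obtain f where f: "f \<in> A" "T f y \<noteq> 0" "r = 1 \<longrightarrow> f (h y) = 0" using F[OF yW] by blast
      have r': "r = 0 \<or> r = 1 \<and> f (h y) = 0" using r f(3) by blast
      obtain C s0 where C: "C > 0" "s0 > 0" "\<And>s. s \<ge> s0 \<Longrightarrow> \<exists>g\<in>A. (\<forall>z. norm (z - h y) \<le> 1 / s \<longrightarrow> g z = f z) \<and>
          (\<forall>z. norm (z - h y) \<ge> 2 / s \<longrightarrow> g z = 0) \<and>
          (\<forall>js. \<forall>z\<in>U. length js \<le> n \<longrightarrow> norm (iter_partial js g z) \<le> C * s ^ d)"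
        using localized_bump[OF f(1) h_in[OF yD] r'] unfolding d_def by blast
      have "open (W' \<inter> D)" "y \<in> W' \<inter> D" using W' yD open_D by auto
      moreover have "min (3 / s0) \<rho> > 0" using C(2) \<rho> by simp
      ultimately have "\<forall>\<^sub>F t in nhds 0. L y t \<in> W' \<inter> D \<and> \<Delta> y t < min (3 / s0) \<rho>"
        by (rule near[OF yD])
      then obtain \<eta> where \<eta>: "\<eta> > 0" "\<And>t. dist t 0 < \<eta> \<Longrightarrow> L y t \<in> W' \<inter> D \<and> \<Delta> y t < min (3 / s0) \<rho>"
        unfolding eventually_nhds_metric by blast
      obtain t where t: "0 < \<bar>t\<bar>" "\<bar>t\<bar> < \<eta>" "\<Delta> y t \<noteq> 0" "\<Delta> y t ^ d > M * C * 3 ^ d / norm (T f y) * \<bar>t\<bar> ^ m"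
        using y \<eta>(1) unfolding Bad_def by blast
      have \<Delta>: "\<Delta> y t > 0" using t(3) by (simp add: \<Delta>_def)
      have \<Delta>small: "\<Delta> y t < 3 / s0" "\<Delta> y t < \<rho>" using \<eta>(2)[of t] t(2) by auto
      \<comment> \<open>The support of the bump has radius \<open>2 / s\<close>, less than \<open>\<Delta> y t\<close>, so the image vanishes near \<open>L y t\<close>.\<close>
      define s where "s = 3 / \<Delta> y t"
      have s: "s \<ge> s0" "s > 0" "2 / s < \<Delta> y t" "2 / s \<le> \<rho>"
        using \<Delta> \<Delta>small C(2) by (auto simp: s_def field_simps)
      from C(3)[OF s(1)] obtain g where g: "g \<in> A" "\<And>z. norm (z - h y) \<le> 1 / s \<Longrightarrow> g z = f z"
        "\<And>z. norm (z - h y) \<ge> 2 / s \<Longrightarrow> g z = 0"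
        "\<And>js z. z \<in> U \<Longrightarrow> length js \<le> n \<Longrightarrow> norm (iter_partial js g z) \<le> C * s ^ d" by blast
      have Tgy: "T g y = T f y"
      proof (rule T_local[OF related_h[OF yD] g(1) f(1)])
        have "\<forall>\<^sub>F z in nhds (h y). z \<in> ball (h y) (1 / s)"
          by (rule eventually_nhds_in_open) (use s(2) in auto)
        then show "\<forall>\<^sub>F z in nhds (h y). g z = f z"
          by eventually_elim (use g(2) in \<open>auto simp: dist_norm norm_minus_commute\<close>)
      qed
      have seg: "L y u \<in> W' \<inter> D" if "u \<in> closed_segment 0 t" for u
        using \<eta>(2)[of u] that t(2) by (auto simp: closed_segment_eq_real_ivl split: if_splits)
      have flat: "iter_partial ks (T g) (L y t) = 0" for ks
      proof -
        define Z where "Z = D \<inter> h -` (- cball (h y) (2 / s))"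
        have oZ: "open Z" unfolding Z_def
          by (rule continuous_open_preimage[OF continuous_on_h open_D]) auto
        have "L y t \<in> Z"
          using seg[of t] s(3) by (auto simp: Z_def \<Delta>_def dist_norm norm_minus_commute)
        moreover have "T g z = 0" if "z \<in> Z" for z
        proof -
          have zD: "z \<in> D" and hz: "h z \<in> - cball (h y) (2 / s)" using that by (auto simp: Z_def)
          have "\<forall>\<^sub>F x in nhds (h z). x \<in> - cball (h y) (2 / s)"
            by (rule eventually_nhds_in_open) (use hz in auto)
          then have "\<forall>\<^sub>F x in nhds (h z). g x = 0"
            by eventually_elim (use g(3) in \<open>auto simp: dist_norm norm_minus_commute\<close>)
          then show ?thesis using related_h[OF zD] g(1) unfolding related_def by blast
        qed
        ultimately show ?thesis using iter_partial_zero_outside[OF oZ] by blast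
      qed
      have "\<exists>u\<in>closed_segment 0 t. norm (iter_partial (replicate m i) (T g) (L y u)) > M * (C * s ^ d)"
      proof (rule ccontr)
        assume "\<not> ?thesis"
        then have "norm (T g y) \<le> M * (C * s ^ d) * \<bar>t\<bar> ^ m"
          using seg D_subset flat
          by (intro norm_le_of_flat_end[OF T_class[OF g(1)], of t y i]) (auto simp: not_less L_def)
        also have "\<dots> = M * C * 3 ^ d * \<bar>t\<bar> ^ m / \<Delta> y t ^ d"
          by (simp add: s_def power_divide)
        finally have "norm (T f y) * \<Delta> y t ^ d \<le> M * C * 3 ^ d * \<bar>t\<bar> ^ m"
          using \<Delta> by (simp add: Tgy pos_le_divide_eq)
        then have "\<Delta> y t ^ d \<le> M * C * 3 ^ d / norm (T f y) * \<bar>t\<bar> ^ m"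
          using f(2) by (simp add: pos_le_divide_eq mult.commute)
        then show False using t(4) by simp
      qed
      then obtain u where u: "u \<in> closed_segment 0 t" "norm (iter_partial (replicate m i) (T g) (L y u)) > M * (C * s ^ d)"
        by blast
      define c where "c = C * s ^ d"
      have c: "c > 0" using C(1) s(2) by (simp add: c_def)
      let ?g = "\<lambda>x. (1 / c) *\<^sub>R g x"
      have uV: "L y u \<in> V" using seg[OF u(1)] D_subset by blast
      show "\<exists>g\<in>A. (\<forall>x. x \<notin> ball (h y) \<rho> \<longrightarrow> g x = 0) \<and>
        (\<forall>js. \<forall>x\<in>U. length js \<le> n \<longrightarrow> norm (iter_partial js g x) \<le> 1) \<and>
        (\<exists>w\<in>W'. norm (iter_partial (replicate m i) (T g) w) > M)"
      proof (intro bexI[of _ ?g] conjI allI ballI impI bexI[of _ "L y u"])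
        show "?g x = 0" if "x \<notin> ball (h y) \<rho>" for x
          using g(3)[of x] that s(4) by (simp add: dist_norm norm_minus_commute)
        show "norm (iter_partial js ?g x) \<le> 1" if "x \<in> U" "length js \<le> n" for js x
          using class_C_linear(2)[OF U(1) A_class[OF g(1)] bounded_linear_scaleR_right[of "1 / c"] that(2,1)]
            g(4)[OF that] c by (simp add: c_def[symmetric])
        have "iter_partial (replicate m i) (T ?g) (L y u) = (1 / c) *\<^sub>R iter_partial (replicate m i) (T g) (L y u)"
          using class_C_linear(2)[OF V(1) T_class[OF g(1)] bounded_linear_scaleR_right[of "1 / c"] _ uV, of "replicate m i"]
          by (simp add: T_scaleR[OF g(1)])
        then show "norm (iter_partial (replicate m i) (T ?g) (L y u)) > M"
          using u(2) c by (simp add: c_def[symmetric] pos_less_divide_eq)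
        show "L y u \<in> W'" using seg[OF u(1)] by blast
        show "?g \<in> A" by (rule A_scaleR[OF g(1)])
      qed
    qed simp
  qed
  have deriv0: "((\<lambda>t. h (L y t)) has_derivative (\<lambda>t. 0)) (at 0)" if y: "y \<in> W" "y \<notin> Bad" for y
  proof -
    have yD: "y \<in> D" using y W(3) by blast
    obtain M0 \<eta> where M0: "\<eta> > 0" "\<And>t. 0 < \<bar>t\<bar> \<Longrightarrow> \<bar>t\<bar> < \<eta> \<Longrightarrow> \<Delta> y t \<noteq> 0 \<Longrightarrow> \<Delta> y t ^ d \<le> M0 * \<bar>t\<bar> ^ m"
    proof -
      have "\<not> (\<forall>M. \<forall>\<eta>>0. \<exists>t. 0 < \<bar>t\<bar> \<and> \<bar>t\<bar> < \<eta> \<and> \<Delta> y t \<noteq> 0 \<and> \<Delta> y t ^ d > M * \<bar>t\<bar> ^ m)"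
        using y by (simp add: Bad_def)
      then obtain M0 \<eta> where "\<eta> > 0" "\<forall>t. \<not> (0 < \<bar>t\<bar> \<and> \<bar>t\<bar> < \<eta> \<and> \<Delta> y t \<noteq> 0 \<and> \<Delta> y t ^ d > M0 * \<bar>t\<bar> ^ m)"
        by blast
      then show ?thesis using that[of \<eta> M0] by (meson not_less)
    qed
    define M where "M = max M0 1"
    \<comment> \<open>The extra factor \<open>\<Delta> y t\<close>, which tends to \<open>0\<close>, covers the case \<open>d = 0\<close> and the case \<open>\<Delta> y t = 0\<close> as well.\<close>
    have bound: "(\<Delta> y t / \<bar>t\<bar>) ^ Suc d \<le> M * \<Delta> y t" if t: "0 < \<bar>t\<bar>" "\<bar>t\<bar> < min \<eta> 1" for t
    proof (cases "\<Delta> y t = 0")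
      case False
      have \<Delta>: "\<Delta> y t \<ge> 0" by (simp add: \<Delta>_def)
      have "\<Delta> y t ^ d \<le> M0 * \<bar>t\<bar> ^ m" by (rule M0(2)) (use t False in auto)
      also have "\<dots> \<le> M * \<bar>t\<bar> ^ Suc d"
        using t md by (intro mult_mono power_decreasing) (auto simp: M_def)
      finally have "\<Delta> y t ^ d * \<Delta> y t \<le> M * \<bar>t\<bar> ^ Suc d * \<Delta> y t"
        by (rule mult_right_mono[OF _ \<Delta>])
      then have "\<Delta> y t ^ Suc d \<le> (M * \<Delta> y t) * \<bar>t\<bar> ^ Suc d" by (simp add: mult_ac)
      then show ?thesis
        using t by (simp add: power_divide pos_divide_le_eq del: power_Suc)
    qed simp
    have "((\<lambda>t. \<Delta> y t / \<bar>t\<bar>) \<longlongrightarrow> 0) (at 0)"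
    proof (rule tendstoI)
      fix \<epsilon> :: real assume \<epsilon>: "\<epsilon> > 0"
      have M: "M > 0" by (simp add: M_def)
      have "\<forall>\<^sub>F t in nhds 0. L y t \<in> UNIV \<and> \<Delta> y t < \<epsilon> ^ Suc d / M"
        by (rule near[OF yD]) (use \<epsilon> M in auto)
      moreover have "\<forall>\<^sub>F t in nhds 0. t \<in> ball (0::real) (min \<eta> 1)"
        by (rule eventually_nhds_in_open) (use M0(1) in auto)
      ultimately have "\<forall>\<^sub>F t in nhds 0. t \<noteq> 0 \<longrightarrow> dist (\<Delta> y t / \<bar>t\<bar>) 0 < \<epsilon>"
      proof eventually_elim
        case (elim t)
        show ?case
        proof
          assume "t \<noteq> 0"
          then have "(\<Delta> y t / \<bar>t\<bar>) ^ Suc d \<le> M * \<Delta> y t"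
            by (intro bound) (use elim in auto)
          also have "\<dots> < \<epsilon> ^ Suc d" using elim M by (simp add: pos_less_divide_eq mult.commute)
          finally have "\<Delta> y t / \<bar>t\<bar> < \<epsilon>" by (rule power_less_imp_less_base) (use \<epsilon> in simp)
          then show "dist (\<Delta> y t / \<bar>t\<bar>) 0 < \<epsilon>" by (simp add: \<Delta>_def)
        qed
      qed
      then show "\<forall>\<^sub>F t in at 0. dist (\<Delta> y t / \<bar>t\<bar>) 0 < \<epsilon>" by (simp add: eventually_at_filter)
    qed
    then show ?thesis by (simp add: has_derivative_at \<Delta>_def L0)
  qed
  have "\<forall>\<^sub>F t in nhds 0. L y0 t \<in> W \<and> \<Delta> y0 t < 1" by (rule near[OF y0 W(1,2)]) simp
  then obtain \<eta> where \<eta>: "\<eta> > 0" "\<And>t. dist t 0 < \<eta> \<Longrightarrow> L y0 t \<in> W"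
    unfolding eventually_nhds_metric by blast
  define \<tau> where "\<tau> = \<eta> / 2"
  have \<tau>: "\<tau> > 0" using \<eta>(1) by (simp add: \<tau>_def)
  have LW: "L y0 t \<in> W" if "t \<in> {0..\<tau>}" for t by (rule \<eta>(2)) (use that \<eta>(1) in \<open>auto simp: \<tau>_def\<close>)
  define K where "K = {t \<in> {0..\<tau>}. L y0 t \<in> Bad}"
  have inj: "inj (L y0)" by (rule injI) (simp add: L_def axis_eq_0_iff)
  have "finite K"
  proof (rule ccontr)
    assume "infinite K"
    then have inf: "infinite (L y0 ` K)" using finite_imageD inj inj_on_subset by blast
    have "compact (L y0 ` {0..\<tau>})"
      by (intro compact_continuous_image continuous_at_imp_continuous_on ballI Lcont) simp
    moreover have "L y0 ` K \<subseteq> L y0 ` {0..\<tau>}" by (auto simp: K_def)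
    ultimately obtain z where z: "z \<in> L y0 ` {0..\<tau>}" "z islimpt L y0 ` K"
      using Heine_Borel_imp_Bolzano_Weierstrass[OF _ inf] by blast
    have "L y0 ` K \<subseteq> Bad" by (auto simp: K_def)
    then have "z islimpt Bad" using z(2) islimpt_subset by blast
    moreover have "z \<in> D" using z(1) LW W(3) by blast
    ultimately show False using not_limit by blast
  qed
  have "h (L y0 \<tau>) = h (L y0 0)"
  proof (rule has_derivative_zero_unique_strong_interval[OF \<open>finite K\<close>, of 0 \<tau> "\<lambda>t. h (L y0 t)"])
    show "continuous_on {0..\<tau>} (\<lambda>t. h (L y0 t))"
      by (intro continuous_at_imp_continuous_on ballI isCont_o2[OF Lcont] isCont_h) (use LW W(3) in blast)
    show "((\<lambda>t. h (L y0 t)) has_derivative (\<lambda>h. 0)) (at t within {0..\<tau>})" if "t \<in> {0..\<tau>} - K" for t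
    proof (rule has_derivative_at_withinI)
      have 1: "((\<lambda>u. h (L (L y0 t) u)) has_derivative (\<lambda>t. 0)) (at (t - t))"
        using deriv0[of "L y0 t"] LW that by (simp add: K_def)
      have 2: "((\<lambda>u. u - t) has_derivative (\<lambda>u. u)) (at t)"
        by (auto intro!: derivative_eq_intros)
      have "L (L y0 t) (u - t) = L y0 u" for u by (simp add: L_def algebra_simps)
      then show "((\<lambda>t. h (L y0 t)) has_derivative (\<lambda>h. 0)) (at t)"
        using has_derivative_compose[OF 2 1] by simp
    qed
  qed (use \<tau> in auto)
  then have "L y0 \<tau> = L y0 0"
    using inj_onD[OF inj_on_h] LW W(3) \<tau> by (metis atLeastAtMost_iff less_eq_real_def order_refl subsetD)
  then show False using inj \<tau> by (auto dest: injD)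
qed

text \<open>The case \<open>r = 0\<close>, for which any functions with nonvanishing images will do.\<close>

lemma order_le: "m \<le> n"
proof -
  obtain y0 where y0: "y0 \<in> D" using D_nonempty by blast
  have "m + 0 \<le> n"
  proof (rule order_estimate[OF _ y0 open_D y0])
    show "\<exists>f\<in>A. T f y \<noteq> 0 \<and> (0 = (1::nat) \<longrightarrow> f (h y) = 0)" if "y \<in> D" for y
      using T_nonzero[of y] D_subset that by auto
  qed auto
  then show ?thesis by simp
qed

lemma order_eq: "n = m"
  using order_le biseparating_pair.order_le[OF swap] by simp

text \<open>If \<open>T f y0 \<noteq> 0\<close>, then for \<open>y\<close> near \<open>y0\<close> the function \<open>f\<close> minus the constant \<open>f (h y)\<close> vanishes at \<open>h y\<close>
  while its image at \<open>y\<close> does not, because \<open>J0 y (f (h y))\<close> is small.  The case \<open>r = 1\<close> of the order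
  estimate then gives \<open>m < n\<close>.\<close>

lemma T_zero_at:
  assumes y0: "y0 \<in> D" and f: "f \<in> A" "f (h y0) = 0"
  shows "T f y0 = 0"
proof (rule ccontr)
  assume nz: "T f y0 \<noteq> 0"
  have y0V: "y0 \<in> V" using y0 D_subset by blast
  have "\<forall>\<^sub>F y in nhds y0. y \<in> D \<longrightarrow> T f y \<noteq> J0 y (f (h y))"
  proof (rule ccontr)
    assume "\<not> ?thesis"
    then have "\<exists>y. dist y y0 < inverse (real (Suc k)) \<and> y \<in> D \<and> T f y = J0 y (f (h y))" for k
      unfolding eventually_nhds_metric by (metis inverse_positive_iff_positive of_nat_0_less_iff zero_less_Suc)
    then obtain y where y: "\<And>k. dist (y k) y0 < inverse (real (Suc k))" "\<And>k. y k \<in> D"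
      "\<And>k. T f (y k) = J0 (y k) (f (h (y k)))" by metis
    have lim: "y \<longlonglongrightarrow> y0"
      by (rule metric_tendsto_imp_tendsto[OF LIMSEQ_inverse_real_of_nat])
         (use y(1) in \<open>auto intro!: always_eventually less_imp_le\<close>)
    have "isCont f (h y0)"
      using class_C_continuous_0[OF A_class[OF f(1)]] U(1) h_in[OF y0] by (simp add: continuous_on_eq_continuous_at)
    then have "(\<lambda>k. f (h (y k))) \<longlonglongrightarrow> f (h y0)"
      by (rule isCont_tendsto_compose[OF _ isCont_tendsto_compose[OF isCont_h[OF y0] lim]])
    then have "(\<lambda>k. J0 (y k) (f (h (y k)))) \<longlonglongrightarrow> 0"
      by (intro J0_tendsto_zero[OF y(2) lim y0]) (simp add: f(2))
    moreover have "(\<lambda>k. T f (y k)) \<longlonglongrightarrow> T f y0"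
      by (rule isCont_tendsto_compose[OF T_isCont[OF f(1) y0V] lim])
    ultimately have "T f y0 = 0" unfolding y(3) by (rule LIMSEQ_unique[rotated])
    then show False using nz by simp
  qed
  then have "\<forall>\<^sub>F y in nhds y0. y \<in> D \<and> T f y \<noteq> J0 y (f (h y))"
    using eventually_nhds_in_open[OF open_D y0] by eventually_elim simp
  then obtain W where W: "open W" "y0 \<in> W" "\<And>y. y \<in> W \<Longrightarrow> y \<in> D \<and> T f y \<noteq> J0 y (f (h y))"
    unfolding eventually_nhds by blast
  have "m + 1 \<le> n"
  proof (rule order_estimate[OF _ y0 W(1,2)])
    fix y assume y: "y \<in> W"
    let ?f = "\<lambda>x. f x - (if x \<in> U then f (h y) else 0)"
    have "T ?f y \<noteq> 0" using T_diff[OF f(1) A_const, of "f (h y)" y] W(3)[OF y] by (simp add: J0_def)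
    moreover have "?f (h y) = 0" using h_in W(3)[OF y] by simp
    moreover have "?f \<in> A" by (rule A_diff[OF f(1) A_const])
    ultimately show "\<exists>f\<in>A. T f y \<noteq> 0 \<and> ((1::nat) = 1 \<longrightarrow> f (h y) = 0)" by blast
  qed (use W(3) in auto)
  then show False using order_eq by simp
qed

lemma T_representation:
  assumes y: "y \<in> D" and f: "f \<in> A"
  shows "T f y = J0 y (f (h y))"
proof -
  have "T (\<lambda>x. f x - (if x \<in> U then f (h y) else 0)) y = 0"
    by (rule T_zero_at[OF y A_diff[OF f A_const]]) (simp add: h_in[OF y])
  then show ?thesis using T_diff[OF f A_const, of "f (h y)" y] by (simp add: J0_def)
qed

end

section \<open>The support map is a diffeomorphism between the two open sets\<close>

context biseparating_pair
begin

lemma J0_left_inverse: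
  assumes y: "y \<in> D"
  shows "biseparating_pair.J0 V S (h y) (J0 y e) = e"
proof -
  interpret inv: biseparating_pair V U m n B A S T by (rule swap)
  let ?c = "const_on U e"
  have "S (T ?c) (h y) = inv.J0 (h y) (T ?c (inv.h (h y)))"
    by (rule inv.T_representation[OF h_inverse(1)[OF y] T_in[OF A_const]])
  moreover have "S (T ?c) (h y) = e" using h_in[OF y] by (simp add: S_T[OF A_const])
  ultimately show ?thesis by (simp add: h_inverse(2)[OF y] J0_def)
qed

lemma bij_J0:
  assumes y: "y \<in> D" shows "bij (J0 y)"
proof -
  interpret inv: biseparating_pair V U m n B A S T by (rule swap)
  have "J0 y (inv.J0 (h y) e) = e" for e
    using inv.J0_left_inverse[OF h_inverse(1)[OF y], of e] by (simp add: h_inverse(2)[OF y])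
  then show ?thesis
    using J0_left_inverse[OF y] by (intro o_bij[of "inv.J0 (h y)"]) (auto simp: fun_eq_iff)
qed

text \<open>The function whose image is the constant \<open>e\<close>, multiplied by a coordinate, is sent to \<open>e\<close> times the
  corresponding component of the support map.\<close>

lemma T_coordinate:
  assumes y: "y \<in> D"
  shows "T (\<lambda>x. (x $ i) *\<^sub>R S (const_on V e) x) y = (h y $ i) *\<^sub>R e"
proof -
  interpret inv: biseparating_pair V U m n B A S T by (rule swap)
  let ?f = "S (const_on V e)"
  have f: "?f \<in> A" by (rule S_in[OF inv.A_const])
  have yV: "y \<in> V" using y D_subset by blast
  have "T (\<lambda>x. (x $ i) *\<^sub>R ?f x) y = J0 y ((h y $ i) *\<^sub>R ?f (h y))"
    by (rule T_representation[OF y A_mult[OF class_C_coordinate f]])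
  also have "\<dots> = (h y $ i) *\<^sub>R J0 y (?f (h y))" by (rule J0_scaleR)
  also have "J0 y (?f (h y)) = T ?f y" by (rule T_representation[OF y f, symmetric])
  also have "T ?f y = e" using yV by (simp add: T_S[OF inv.A_const])
  finally show ?thesis .
qed

text \<open>By \<open>T_coordinate\<close>, \<open>h\<close> has limits at all points of \<open>V\<close>, not only at those of \<open>D\<close>.\<close>

lemma h_limit:
  assumes y: "y \<in> V" and e: "e \<noteq> 0"
  shows "\<exists>y' x. (\<forall>k. y' k \<in> D) \<and> y' \<longlonglongrightarrow> y \<and> (\<lambda>k. h (y' k)) \<longlonglongrightarrow> x \<and>
    (\<forall>i. T (\<lambda>x. (x $ i) *\<^sub>R S (const_on V e) x) y = (x $ i) *\<^sub>R e)"
proof -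
  interpret inv: biseparating_pair V U m n B A S T by (rule swap)
  let ?w = "\<lambda>i. T (\<lambda>x. (x $ i) *\<^sub>R S (const_on V e) x)"
  have "\<exists>z. z \<in> ball y (inverse (real (Suc k))) \<inter> D" for k
    using D_dense[OF open_ball _ y, of y "inverse (real (Suc k))"] by auto
  then obtain y' where y': "\<And>k. y' k \<in> ball y (inverse (real (Suc k))) \<inter> D" by metis
  then have y'D: "\<And>k. y' k \<in> D" by blast
  have lim: "y' \<longlonglongrightarrow> y"
    by (rule metric_tendsto_imp_tendsto[OF LIMSEQ_inverse_real_of_nat])
       (use y' in \<open>auto intro!: always_eventually less_imp_le simp: dist_commute\<close>)
  have w: "(\<lambda>k. (h (y' k) $ i) *\<^sub>R e) \<longlonglongrightarrow> ?w i y" for i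
  proof -
    have "isCont (?w i) y"
      by (rule T_isCont[OF A_mult[OF class_C_coordinate S_in[OF inv.A_const]] y])
    then have "(\<lambda>k. ?w i (y' k)) \<longlonglongrightarrow> ?w i y" using lim by (rule isCont_tendsto_compose)
    then show ?thesis by (simp only: T_coordinate[OF y'D])
  qed
  have "\<exists>c. (\<lambda>k. h (y' k) $ i) \<longlonglongrightarrow> c \<and> ?w i y = c *\<^sub>R e" for i
    by (rule scaleR_tendsto_cancel[OF e trivial_limit_sequentially w[of i]]) blast
  then obtain c where c: "\<And>i. (\<lambda>k. h (y' k) $ i) \<longlonglongrightarrow> c i" "\<And>i. ?w i y = c i *\<^sub>R e" by metis
  have "(\<lambda>k. h (y' k)) \<longlonglongrightarrow> (\<chi> i. c i)"
    by (rule vec_tendstoI) (simp add: c(1))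
  moreover have "?w i y = ((\<chi> i. c i) $ i) *\<^sub>R e" for i by (simp add: c(2))
  ultimately show ?thesis using y'D lim by blast
qed

text \<open>If the limit \<open>x\<close> of \<open>h\<close> at \<open>y\<close> were not in \<open>U\<close>, then multiplication by \<open>1 / norm (z - x) ^ 2\<close> would be possible
  in \<open>A\<close> and would produce an image that is unbounded near \<open>y\<close>.\<close>

lemma D_eq_V_open:
  assumes mult: "\<And>\<phi> f. class_C n U \<phi> \<Longrightarrow> f \<in> A \<Longrightarrow> (\<lambda>x. \<phi> x *\<^sub>R f x) \<in> A"
  shows "D = V"
proof (intro equalityI D_subset subsetI)
  interpret inv: biseparating_pair V U m n B A S T by (rule swap)
  fix y assume y: "y \<in> V"
  obtain e :: 'f where e: "e \<noteq> 0" using F by blast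
  obtain y' x where y': "\<And>k. y' k \<in> D" "y' \<longlonglongrightarrow> y" and x: "(\<lambda>k. h (y' k)) \<longlonglongrightarrow> x"
    using h_limit[OF y e] by blast
  have "x \<in> U"
  proof (rule ccontr)
    assume xU: "x \<notin> U"
    define \<phi> where "\<phi> = (\<lambda>z. inverse ((norm (z - x))\<^sup>2))"
    let ?f = "S (const_on V e)"
    have f: "?f \<in> A" by (rule S_in[OF inv.A_const])
    have "class_C n U \<phi>" unfolding \<phi>_def
      by (rule class_C_inverse[OF U(1) class_C_norm_square]) (use xU in auto)
    then have g: "(\<lambda>z. \<phi> z *\<^sub>R ?f z) \<in> A" by (rule mult[OF _ f])
    have "T (\<lambda>z. \<phi> z *\<^sub>R ?f z) (y' k) = \<phi> (h (y' k)) *\<^sub>R e" for k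
    proof -
      have "T (\<lambda>z. \<phi> z *\<^sub>R ?f z) (y' k) = \<phi> (h (y' k)) *\<^sub>R J0 (y' k) (?f (h (y' k)))"
        using T_representation[OF y'(1) g] by (simp add: J0_scaleR)
      also have "J0 (y' k) (?f (h (y' k))) = T ?f (y' k)" by (rule T_representation[OF y'(1) f, symmetric])
      also have "\<dots> = e" using y'(1)[of k] D_subset by (auto simp: T_S[OF inv.A_const])
      finally show ?thesis .
    qed
    then have "(\<lambda>k. \<phi> (h (y' k)) *\<^sub>R e) \<longlonglongrightarrow> T (\<lambda>z. \<phi> z *\<^sub>R ?f z) y"
      using isCont_tendsto_compose[OF T_isCont[OF g y] y'(2)] by simp
    then obtain c where "(\<lambda>k. \<phi> (h (y' k))) \<longlonglongrightarrow> c"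
      by (rule scaleR_tendsto_cancel[OF e trivial_limit_sequentially])
    moreover have "(\<lambda>k. (norm (h (y' k) - x))\<^sup>2) \<longlonglongrightarrow> (norm (x - x))\<^sup>2"
      by (intro tendsto_intros x)
    ultimately have "(\<lambda>k. \<phi> (h (y' k)) * (norm (h (y' k) - x))\<^sup>2) \<longlonglongrightarrow> c * (norm (x - x))\<^sup>2"
      by (rule tendsto_mult)
    moreover have "\<phi> (h (y' k)) * (norm (h (y' k) - x))\<^sup>2 = 1" for k
    proof -
      have "h (y' k) \<noteq> x" using h_in[OF y'(1)[of k]] xU by auto
      then show ?thesis by (simp add: \<phi>_def)
    qed
    ultimately have "(\<lambda>k::nat. 1::real) \<longlonglongrightarrow> 0" by simp
    then show False by (simp add: LIMSEQ_const_iff)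
  qed
  then have "related x y" by (rule related_limit[OF y' y x])
  then show "y \<in> D" by (rule relatedD)
qed

lemma dimension_le: "CARD('q) \<le> CARD('p)"
  using invariance_of_dimension[OF continuous_on_h open_D inj_on_h D_nonempty] by simp

text \<open>The support map extends continuously to a map \<open>H\<close> from \<open>V\<close> to \<open>closure U\<close>.  Its inverse extends
  to \<open>closure U\<close>, since it is given by functions in \<open>A\<close> as in \<open>T_coordinate\<close>; so \<open>H\<close> is injective.  By
  invariance of domain its range is open, and hence contained in the interior of \<open>closure U\<close>.\<close>

lemma D_eq_V_closure:
  assumes reg: "interior (closure U) = U"
    and ext: "\<And>f. f \<in> A \<Longrightarrow> \<exists>g. continuous_on (closure U) g \<and> (\<forall>x\<in>U. g x = f x)"
  shows "D = V"
proof (intro equalityI D_subset subsetI)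
  interpret inv: biseparating_pair V U m n B A S T by (rule swap)
  obtain e :: 'f where e: "e \<noteq> 0" using F by blast
  obtain e' :: 'e where e': "e' \<noteq> 0" using E by blast
  define w where "w = (\<lambda>i. T (\<lambda>x. (x $ i) *\<^sub>R S (const_on V e) x))"
  define H where "H = (\<lambda>y. SOME x. \<forall>i. w i y = (x $ i) *\<^sub>R e)"
  have H: "w i y = (H y $ i) *\<^sub>R e" if "y \<in> V" for i y
  proof -
    have "\<exists>x. \<forall>i. w i y = (x $ i) *\<^sub>R e"
      using h_limit[OF that e] unfolding w_def by blast
    then have "\<forall>i. w i y = (H y $ i) *\<^sub>R e" unfolding H_def by (rule someI_ex)
    then show ?thesis by blast
  qed
  have lim: "\<exists>y'. (\<forall>k. y' k \<in> D) \<and> y' \<longlonglongrightarrow> y \<and> (\<lambda>k. h (y' k)) \<longlonglongrightarrow> H y" if y: "y \<in> V" for y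
  proof -
    obtain y' x where y': "\<And>k. y' k \<in> D" "y' \<longlonglongrightarrow> y" "(\<lambda>k. h (y' k)) \<longlonglongrightarrow> x"
      and x: "\<And>i. w i y = (x $ i) *\<^sub>R e" unfolding w_def using h_limit[OF y e] by blast
    have "x = H y" using x H[OF y] e by (simp add: vec_eq_iff)
    then show ?thesis using y' by blast
  qed
  have "class_C 0 V H"
  proof (rule class_C_vec[OF V(1)])
    fix i
    have "continuous_on V (w i)" unfolding w_def
      by (rule class_C_continuous_0[OF T_class[OF A_mult[OF class_C_coordinate S_in[OF inv.A_const]]]])
    then have "continuous_on V (\<lambda>y. (H y $ i) *\<^sub>R e)" by (rule continuous_on_eq) (rule H)
    then show "class_C 0 V (\<lambda>y. H y $ i)" unfolding class_C_0 by (rule continuous_on_scaleR_cancel[OF e])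
  qed
  then have contH: "continuous_on V H" by (simp add: class_C_0)
  have Hcl: "H y \<in> closure U" if "y \<in> V" for y
  proof -
    obtain y' where y': "\<And>k. y' k \<in> D" "(\<lambda>k. h (y' k)) \<longlonglongrightarrow> H y" using lim[OF \<open>y \<in> V\<close>] by blast
    then show ?thesis
      unfolding closure_sequential by (intro exI[of _ "\<lambda>k. h (y' k)"] conjI allI h_in)
  qed
  have injH: "inj_on H V"
  proof (rule inj_onI)
    have *: "\<exists>g. \<forall>y\<in>V. g (H y) = (y $ j) *\<^sub>R e'" for j
    proof -
      let ?f = "S (\<lambda>y. (y $ j) *\<^sub>R T (const_on U e') y)"
      have "?f \<in> A" by (rule S_in[OF inv.A_mult[OF class_C_coordinate T_in[OF A_const]]])
      then obtain g where g: "continuous_on (closure U) g" "\<And>x. x \<in> U \<Longrightarrow> g x = ?f x"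
        using ext by blast
      have gD: "g (h y) = (y $ j) *\<^sub>R e'" if "y \<in> D" for y
        using inv.T_coordinate[OF h_inverse(1)[OF that], of j e'] g(2)[OF h_in[OF that]]
        by (simp add: h_inverse(2)[OF that])
      have "g (H y) = (y $ j) *\<^sub>R e'" if y: "y \<in> V" for y
      proof -
        obtain y' where y': "\<And>k. y' k \<in> D" "y' \<longlonglongrightarrow> y" "(\<lambda>k. h (y' k)) \<longlonglongrightarrow> H y"
          using lim[OF y] by blast
        have "(\<lambda>k. g (h (y' k))) \<longlonglongrightarrow> g (H y)"
          by (rule continuous_on_tendsto_compose[OF g(1) y'(3) Hcl[OF y]])
             (intro always_eventually allI subsetD[OF closure_subset] h_in y'(1))
        then have "(\<lambda>k. (y' k $ j) *\<^sub>R e') \<longlonglongrightarrow> g (H y)" by (simp only: gD[OF y'(1)])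
        moreover have "(\<lambda>k. (y' k $ j) *\<^sub>R e') \<longlonglongrightarrow> (y $ j) *\<^sub>R e'"
          by (intro tendsto_intros y'(2))
        ultimately show ?thesis by (rule LIMSEQ_unique)
      qed
      then show ?thesis by blast
    qed
    fix y1 y2 assume "y1 \<in> V" "y2 \<in> V" "H y1 = H y2"
    then have "(y1 $ j) *\<^sub>R e' = (y2 $ j) *\<^sub>R e'" for j using *[of j] by metis
    then show "y1 = y2" using e' by (simp add: vec_eq_iff)
  qed
  have "open (H ` V)"
    by (rule invariance_of_domain_gen[OF V(1) contH injH]) (use inv.dimension_le in simp)
  then have HU: "H ` V \<subseteq> U" using interior_maximal[of "H ` V" "closure U"] Hcl reg by blast
  fix y assume y: "y \<in> V"
  obtain y' where y': "\<And>k. y' k \<in> D" "y' \<longlonglongrightarrow> y" "(\<lambda>k. h (y' k)) \<longlonglongrightarrow> H y"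
    using lim[OF y] by blast
  have "related (H y) y" by (rule related_limit[OF y'(1,2) y y'(3)]) (use HU y in blast)
  then show "y \<in> D" by (rule relatedD)
qed

lemma class_C_h:
  assumes "D = V" shows "class_C m V h"
proof (rule class_C_vec[OF V(1)])
  interpret inv: biseparating_pair V U m n B A S T by (rule swap)
  obtain e :: 'f where e: "e \<noteq> 0" using F by blast
  fix i
  have "class_C m V (T (\<lambda>x. (x $ i) *\<^sub>R S (const_on V e) x))"
    by (rule T_class[OF A_mult[OF class_C_coordinate S_in[OF inv.A_const]]])
  then have "class_C m V (\<lambda>y. (h y $ i) *\<^sub>R e)"
    by (rule class_C_cong[OF V(1), rotated]) (use T_coordinate assms in blast)
  then show "class_C m V (\<lambda>y. h y $ i)" by (rule class_C_scaleR_cancel[OF V(1) e])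
qed

lemma diffeomorphism_h:
  assumes DV: "D = V" and DU: "biseparating_pair.D V U B S = U"
  shows "diffeomorphism_C n V U h"
proof -
  interpret inv: biseparating_pair V U m n B A S T by (rule swap)
  have inj: "inj_on h V" using inj_on_h DV by simp
  have hk: "inv.h x \<in> V" "h (inv.h x) = x" if "x \<in> U" for x
    using inv.h_inverse[of x] that DU DV by auto
  have img: "h ` V = U"
  proof
    show "h ` V \<subseteq> U" using h_in DV by blast
    show "U \<subseteq> h ` V" using hk by (metis image_eqI subsetI)
  qed
  have "class_C n U (the_inv_into V h)"
  proof (rule class_C_cong[OF U(1)])
    show "class_C n U inv.h" by (rule inv.class_C_h[OF DU])
    show "inv.h x = the_inv_into V h x" if "x \<in> U" for x
      using the_inv_into_f_eq[OF inj hk(2)[OF that] hk(1)[OF that]] by simp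
  qed
  then show ?thesis
    using inj img class_C_h[OF DV] order_eq unfolding diffeomorphism_C_def bij_betw_def by simp
qed

end

section \<open>Linear biseparating maps are weighted composition operators\<close>

text \<open>The inverse of \<open>T\<close> inherits linearity, and injectivity of \<open>T\<close> excludes that \<open>\<Omega>'\<close> is empty or \<open>F\<close> is
  zero; so \<open>T\<close> and its inverse form a pair to which the preceding results apply in both directions.
  Linearity over the scalar field, rather than over the reals, passes from \<open>T\<close> to \<open>J\<close> by evaluation on
  constants.\<close>

theorem theorem5p2:
  fixes scaleE :: "'k::real_or_complex \<Rightarrow> 'e::banach \<Rightarrow> 'e"
    and scaleF :: "'k \<Rightarrow> 'f::banach \<Rightarrow> 'f"
    and \<Omega> :: "(real^'p) set"
    and \<Omega>' :: "(real^'q) set"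
    and n m :: nat
    and A :: "(real^'p \<Rightarrow> 'e) set"
    and B :: "(real^'q \<Rightarrow> 'f) set"
    and T :: "(real^'p \<Rightarrow> 'e) \<Rightarrow> real^'q \<Rightarrow> 'f"
  assumes E: "banach_over scaleE" and F: "banach_over scaleF"
    and E_nonzero: "\<exists>e::'e. e \<noteq> 0"
    and n: "n \<ge> 1" and m: "m \<ge> 1"
    and \<Omega>: "open \<Omega>" "\<Omega> \<noteq> {}" and \<Omega>': "open \<Omega>'"
    and situation:
      "A = C_open n \<Omega> \<and> B = C_open m \<Omega>' \<or>
       bounded \<Omega> \<and> bounded \<Omega>' \<and>
       interior (closure \<Omega>) = \<Omega> \<and> interior (closure \<Omega>') = \<Omega>' \<and>
       A = C_closure n \<Omega> \<and> B = C_closure m \<Omega>'"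
    and T_linear: "linear_over scaleE scaleF A T"
    and T_biseparating: "biseparating \<Omega> \<Omega>' A B T"
  shows "CARD('p) = CARD('q) \<and> n = m \<and>
    (\<exists>(h :: real^'q \<Rightarrow> real^'p) (J :: real^'q \<Rightarrow> 'e \<Rightarrow>\<^sub>L 'f).
        diffeomorphism_C n \<Omega>' \<Omega> h \<and>
        J \<in> \<Omega>' \<rightarrow> ops scaleE scaleF \<and>
        class_sC scaleE scaleF n \<Omega>' J \<and>
        (\<forall>y\<in>\<Omega>'. \<forall>f\<in>A. T f y = blinfun_apply (J y) (f (h y))) \<and>
        (\<forall>y\<in>\<Omega>'. J y \<in> bij_ops scaleE scaleF))"
proof -
  interpret E: banach_over scaleE by (rule E)
  interpret F: banach_over scaleF by (rule F)
  have fsA: "function_space n \<Omega> A" and fsB: "function_space m \<Omega>' B"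
    using situation function_space_C_open function_space_C_closure \<Omega>(1) \<Omega>' by auto
  define S where "S = the_inv_into A T"
  have bij: "bij_betw T A B" and sep: "separating \<Omega> \<Omega>' A B T" and sepS: "separating \<Omega>' \<Omega> B A S"
    using T_biseparating unfolding biseparating_def S_def by auto
  have A0: "f x = 0" if "f \<in> A" "x \<notin> \<Omega>" for f x
    using subsetD[OF fsA[unfolded function_space_def, THEN conjunct1] that(1)] that(2)
    by (simp add: C_open_def)
  have B0: "g y = 0" if "g \<in> B" "y \<notin> \<Omega>'" for g y
    using subsetD[OF fsB[unfolded function_space_def, THEN conjunct1] that(1)] that(2)
    by (simp add: C_open_def)
  have T_in: "T f \<in> B" if "f \<in> A" for f using bij that by (auto simp: bij_betw_def)
  have S_in: "S g \<in> A" if "g \<in> B" for g using sepS that by (auto simp: separating_def)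
  have S_T: "S (T f) = f" if "f \<in> A" for f
    using bij that unfolding S_def bij_betw_def by (simp add: the_inv_into_f_f)
  have T_S: "T (S g) = g" if "g \<in> B" for g
    using bij that unfolding S_def by (simp add: f_the_inv_into_f_bij_betw)
  have T_scale: "T (\<lambda>x. scaleE c (f x)) = (\<lambda>y. scaleF c (T f y))" if "f \<in> A" for c f
    using T_linear that unfolding linear_over_def by blast
  have T_scaleR: "T (\<lambda>x. r *\<^sub>R f x) = (\<lambda>y. r *\<^sub>R T f y)" if "f \<in> A" for r f
    using T_scale[OF that, of "of_real r"] by (simp add: E.scale_of_real F.scale_of_real)
  have A_scaleR: "(\<lambda>x. r *\<^sub>R f x) \<in> A" if "f \<in> A" for r f
    by (rule fsA[unfolded function_space_def, THEN conjunct2, THEN conjunct2, THEN conjunct1, rule_format,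
          OF that class_C_const(1)[OF open_UNIV]])
  have const: "(const_on \<Omega> e) \<in> A" for e
    by (rule fsA[unfolded function_space_def, THEN conjunct2, THEN conjunct2, THEN conjunct2, THEN conjunct2, rule_format])
  obtain e :: 'e where e: "e \<noteq> 0" using E_nonzero by blast
  obtain y where y: "T (const_on \<Omega> e) y \<noteq> 0"
  proof (rule ccontr)
    let ?c = "const_on \<Omega> e"
    assume "\<not> thesis"
    then have z: "T ?c = (\<lambda>y. 0)" using that by blast
    have "T (\<lambda>x. 0 *\<^sub>R ?c x) = (\<lambda>y. 0 *\<^sub>R T ?c y)" by (rule T_scaleR[OF const])
    then have "T (\<lambda>x. 0 *\<^sub>R ?c x) = T ?c" using z by simp
    then have "S (T (\<lambda>x. 0 *\<^sub>R ?c x)) = S (T ?c)" by simp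
    then have "(\<lambda>x. 0 *\<^sub>R ?c x) = ?c" unfolding S_T[OF const] S_T[OF A_scaleR[OF const]] .
    moreover obtain x where "x \<in> \<Omega>" using \<Omega>(2) by blast
    ultimately show False using e by (auto dest: fun_cong[of _ _ x])
  qed
  have y_in: "y \<in> \<Omega>'" using y B0[OF T_in[OF const]] by blast
  interpret T: biseparating_pair \<Omega> \<Omega>' n m A B T S
  proof
    show "open \<Omega>" "\<Omega> \<noteq> {}" "open \<Omega>'" "n \<ge> 1" "m \<ge> 1" by (fact \<Omega> \<Omega>' n m)+
    show "\<Omega>' \<noteq> {}" using y_in by blast
    show "\<exists>e::'e. e \<noteq> 0" by (fact E_nonzero)
    show "\<exists>e::'f. e \<noteq> 0" using y by blast
    show "function_space n \<Omega> A" "function_space m \<Omega>' B" by (fact fsA fsB)+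
    show "T f \<in> B" "S (T f) = f" if "f \<in> A" for f using that by (fact T_in S_T)+
    show "S g \<in> A" "T (S g) = g" if "g \<in> B" for g using that by (fact S_in T_S)+
    show "T (\<lambda>x. f x + g x) = (\<lambda>y. T f y + T g y)" if "f \<in> A" "g \<in> A" for f g
      using sep that unfolding separating_def by blast
    show "S (\<lambda>x. f x + g x) = (\<lambda>y. S f y + S g y)" if "f \<in> B" "g \<in> B" for f g
      using sepS that unfolding separating_def by blast
    show "T (\<lambda>x. r *\<^sub>R f x) = (\<lambda>y. r *\<^sub>R T f y)" if "f \<in> A" for f r by (rule T_scaleR[OF that])
    show "S (\<lambda>x. r *\<^sub>R g x) = (\<lambda>y. r *\<^sub>R S g y)" if "g \<in> B" for g r
    proof -
      have "T (\<lambda>y. r *\<^sub>R S g y) = (\<lambda>x. r *\<^sub>R g x)"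
        using T_scaleR[OF S_in[OF that]] T_S[OF that] by simp
      then show ?thesis using S_T[OF A_scaleR[OF S_in[OF that]]] by metis
    qed
    show "T f y = 0 \<or> T g y = 0" if "f \<in> A" "g \<in> A" "\<And>x. f x = 0 \<or> g x = 0" for f g y
    proof -
      have "coz \<Omega> f \<inter> coz \<Omega> g = {}" using that(3) by (auto simp: coz_def)
      then have "coz \<Omega>' (T f) \<inter> coz \<Omega>' (T g) = {}"
        using sep that(1,2) unfolding separating_def by blast
      then show ?thesis using B0[OF T_in[OF that(1)], of y] unfolding coz_def by blast
    qed
    show "S f x = 0 \<or> S g x = 0" if "f \<in> B" "g \<in> B" "\<And>x. f x = 0 \<or> g x = 0" for f g x
    proof -
      have "coz \<Omega>' f \<inter> coz \<Omega>' g = {}" using that(3) by (auto simp: coz_def)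
      then have "coz \<Omega> (S f) \<inter> coz \<Omega> (S g) = {}"
        using sepS that(1,2) unfolding separating_def by blast
      then show ?thesis using A0[OF S_in[OF that(1)], of x] unfolding coz_def by blast
    qed
  qed
  interpret S: biseparating_pair \<Omega>' \<Omega> m n B A S T by (rule T.swap)
  have D: "T.D = \<Omega>'" "S.D = \<Omega>"
  proof -
    have ext: "\<exists>g. continuous_on (closure W) g \<and> (\<forall>x\<in>W. g x = f x)" if "f \<in> C_closure l W"
      for l and W :: "(real^'r) set" and f :: "real^'r \<Rightarrow> 'g::real_normed_vector"
      using that unfolding C_closure_def by (auto dest!: spec[of _ "[]"])
    show "T.D = \<Omega>'"
      using situation
    proof (elim disjE conjE)
      assume "A = C_open n \<Omega>"
      then show ?thesis by (intro T.D_eq_V_open) (simp add: C_open_scaleR[OF \<Omega>(1)])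
    next
      assume "interior (closure \<Omega>) = \<Omega>" "A = C_closure n \<Omega>"
      then show ?thesis by (intro T.D_eq_V_closure) (simp_all add: ext)
    qed
    show "S.D = \<Omega>"
      using situation
    proof (elim disjE conjE)
      assume "B = C_open m \<Omega>'"
      then show ?thesis by (intro S.D_eq_V_open) (simp add: C_open_scaleR[OF \<Omega>'])
    next
      assume "interior (closure \<Omega>') = \<Omega>'" "B = C_closure m \<Omega>'"
      then show ?thesis by (intro S.D_eq_V_closure) (simp_all add: ext)
    qed
  qed
  define J where "J = (\<lambda>y. Blinfun (T.J0 y))"
  have J: "blinfun_apply (J y) = T.J0 y" if "y \<in> \<Omega>'" for y
    unfolding J_def by (rule bounded_linear_Blinfun_apply[OF T.bounded_linear_J0]) (use that D in simp)
  have ops: "J y \<in> ops scaleE scaleF" if y: "y \<in> \<Omega>'" for y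
  proof -
    have "T.J0 y (scaleE c e) = scaleF c (T.J0 y e)" for c e
    proof -
      have "(\<lambda>x. if x \<in> \<Omega> then scaleE c e else 0) = (\<lambda>x. scaleE c (if x \<in> \<Omega> then e else 0))" by auto
      then show ?thesis by (simp add: T.J0_def T_scale[OF const])
    qed
    then show ?thesis by (simp add: ops_def J[OF y])
  qed
  have bij_ops: "J y \<in> bij_ops scaleE scaleF" if y: "y \<in> \<Omega>'" for y
    using ops[OF y] T.bij_J0[of y] y D by (simp add: bij_ops_def J)
  have "class_C n \<Omega>' (\<lambda>y. J y e)" for e
  proof (rule class_C_cong[OF \<Omega>'])
    show "class_C n \<Omega>' (T (const_on \<Omega> e))"
      unfolding T.order_eq by (rule T.T_class[OF const])
  qed (simp add: J T.J0_def)
  then have "class_sC scaleE scaleF n \<Omega>' J"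
    by (intro class_sC_pointwise[OF F \<Omega>' n]) (use ops in auto)
  moreover have "T f y = blinfun_apply (J y) (f (T.h y))" if "y \<in> \<Omega>'" "f \<in> A" for y f
    using T.T_representation[of y f] that D by (simp add: J)
  moreover have "CARD('p) = CARD('q)"
    using T.dimension_le S.dimension_le by simp
  moreover have "diffeomorphism_C n \<Omega>' \<Omega> T.h" by (rule T.diffeomorphism_h[OF D])
  ultimately show ?thesis
    using T.order_eq ops bij_ops by (intro conjI exI[of _ T.h] exI[of _ J]) auto
qed

end
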